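(* Let $K$ be a field with $\operatorname{char}(K)\neq 2,3$ containing a primitive cubic root of unity $\zeta_3$. Let $f(x)=x^6+ax^3+b\in K[x]$ be irreducible over $K$, let $F$ be its splitting field over $K$, and put $\Delta=a^2-4b$, $R(x)=x^3-3bx+ab$. Let $\alpha,\beta\in F$ be roots of $f$ with $\alpha^3\neq\beta^3$, and write $\sqrt[3]{b}=\alpha\beta$. Then the following are complete lists, without repetition, of the intermediate fields strictly between $K$ and $F$, arranged by degree over $K$; the fields marked (normal) are normal over $K$ and the others are not. (A) If no cubic root of $b$ lies in $K$ and $R(x)$ is reducible over $K$, there are $2$ fields: - degree 2: $K(\sqrt\Delta)$ (normal); - degree 3: $K(\sqrt[3]b)$ (normal). (B) If the cubic roots of $b$ lie in $K$ and $R(x)$ is irreducible over $K$, there are $4$ fields: - degree 2: $K(\sqrt\Delta)$ (normal); - degree 3: $K(\alpha+\beta)$, $K(\alpha\zeta_3+\beta\zeta_3^2)$, $K(\alpha\zeta_3^2+\beta\zeta_3)$. (C) If no cubic root of $b$ lies in $K$ and $R(x)$ is irreducible over $K$, there are $12$ fields: - degree 2: $K(\sqrt\Delta)$ (normal); - degree 3: $K(\sqrt[3]b)$ (normal); $K(\sqrt[3]b(\alpha+\beta))$, $K(\sqrt[3]b(\alpha\zeta_3+\beta\zeta_3^2))$, $K(\sqrt[3]b(\alpha\zeta_3^2+\beta\zeta_3))$; - degree 6: $K(\sqrt\Delta,\sqrt[3]b(\alpha+\beta))$ and $K(\sqrt\Delta,\sqrt[3]b)$ (both normal); $K(\alpha)$,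 $K(\beta)$; - degree 9: $K(\alpha+\beta)$, $K(\alpha\zeta_3+\beta\zeta_3^2)$, $K(\alpha\zeta_3^2+\beta\zeta_3)$.
   Context: The roots of $f$ are $\alpha,\alpha\zeta_3,\alpha\zeta_3^2,\beta,\beta\zeta_3,\beta\zeta_3^2$, where $\alpha^3$ and $\beta^3$ are the two roots $\frac{-a\pm\sqrt\Delta}{2}$ of $y^2+ay+b$; so $(\alpha\beta)^3=b$. *)

theory Defs
  imports "HOL-Algebra.Algebra"
begin

definition ring_char :: "('a, 'b) ring_scheme \<Rightarrow> nat" where
  "ring_char R =
     (if \<exists>n::nat. n > 0 \<and> [n] \<cdot>\<^bsub>R\<^esub> \<one>\<^bsub>R\<^esub> = \<zero>\<^bsub>R\<^esub>
      then LEAST n::nat. n > 0 \<and> [n] \<cdot>\<^bsub>R\<^esub> \<one>\<^bsub>R\<^esub> = \<zero>\<^bsub>R\<^esub> else 0)"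

definition primitive_root_of_unity :: "('a, 'b) ring_scheme \<Rightarrow> nat \<Rightarrow> 'a \<Rightarrow> bool" where
  "primitive_root_of_unity R n z \<longleftrightarrow>
     n > 0 \<and> z \<in> carrier R \<and> z [^]\<^bsub>R\<^esub> n = \<one>\<^bsub>R\<^esub> \<and>
     (\<forall>k::nat. 0 < k \<and> k < n \<longrightarrow> z [^]\<^bsub>R\<^esub> k \<noteq> \<one>\<^bsub>R\<^esub>)"

text \<open>In what follows a field extension is a field \<open>F\<close> together with a subfield \<open>K\<close> of it, and
  intermediate fields are subsets of the carrier of \<open>F\<close>.\<close>

definition adjoin :: "('a, 'b) ring_scheme \<Rightarrow> 'a set \<Rightarrow> 'a set \<Rightarrow> 'a set" where
  "adjoin F K S = generate_field F (K \<union> S)"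

definition splitting_field_over :: "('a, 'b) ring_scheme \<Rightarrow> 'a set \<Rightarrow> 'a list \<Rightarrow> bool" where
  "splitting_field_over F K p \<longleftrightarrow>
     field F \<and> subfield K F \<and> p \<in> carrier (K[X]\<^bsub>F\<^esub>) \<and> p \<noteq> [] \<and>
     ring.splitted F p \<and> adjoin F K {x. ring.is_root F p x} = carrier F"

text \<open>Splitting is tested in \<open>E\<close> regarded as a field of its own; \<open>splitted_on\<close> is not suitable for
  this, as it loses the multiplicities of roots and is degenerate on infinite sets.\<close>

definition normal_extension :: "('a, 'b) ring_scheme \<Rightarrow> 'a set \<Rightarrow> 'a set \<Rightarrow> bool" where
  "normal_extension F K E \<longleftrightarrow>
     (\<forall>x\<in>E. ring.algebraic F K x) \<and>
     (\<forall>p \<in> carrier (K[X]\<^bsub>F\<^esub>). pirreducible\<^bsub>F\<^esub> K p \<and> (\<exists>x\<in>E. ring.eval F p x = \<zero>\<^bsub>F\<^esub>)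
        \<longrightarrow> ring.splitted (F\<lparr>carrier := E\<rparr>) p)"

definition strict_intermediate_fields :: "('a, 'b) ring_scheme \<Rightarrow> 'a set \<Rightarrow> 'a set set" where
  "strict_intermediate_fields F K = {E. subfield E F \<and> K \<subset> E \<and> E \<subset> carrier F}"

text \<open>An entry \<open>(E, d, \<nu>)\<close> records a field \<open>E\<close>, its degree \<open>d\<close> over \<open>K\<close>, and whether \<open>E\<close> is normal
  over \<open>K\<close>.\<close>

definition complete_list_of_intermediate_fields ::
    "('a, 'b) ring_scheme \<Rightarrow> 'a set \<Rightarrow> ('a set \<times> nat \<times> bool) list \<Rightarrow> bool" where
  "complete_list_of_intermediate_fields F K L \<longleftrightarrow>
     distinct (map fst L) \<and>
     set (map fst L) = strict_intermediate_fields F K \<and>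
     (\<forall>(E, d, \<nu>) \<in> set L. ring.dimension F d K E \<and> (normal_extension F K E \<longleftrightarrow> \<nu>))"

end

(*
Every intermediate field E is determined by the set of automorphisms of F over K that fix it: an
element outside E is moved at some step of the tower of Kummer extensions
E <= E(delta) <= E(delta, alpha) <= E(delta, alpha, beta) = F by the conjugation of that step, and
this conjugation extends to F. An automorphism is determined by its values on alpha and beta, hence
is one of 18 explicit maps, which form a group C3 x S3 with 14 subgroups. Which of these maps exist
is read off from the elements of K: K is the fixed field, delta is never in K, and c = alpha beta and
the roots c (alpha zeta^k + beta zeta^2k) of R are in K or not according to the three cases. This
leaves all 18 maps in case (C) and a subgroup S3 or C6 in cases (B) and (A), and each subgroup of it
is the stabilizer of one of the listed sets of generators. A field is normal if and only if its
stabilizer is a normal subgroup, since the minimal polynomial of x divides the product of X - y over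
the conjugates y of x.
*)
theory Submission
  imports Defs
begin

section \<open>Ring identities\<close>

text \<open>No map with a prescribed code is constructed and the order of the group is never
  counted. The codes realized over K form a subgroup of C3 x S3, which is pinned down by exclusion:
  the maximal subgroups are the stabilizers of \<delta>, of \<gamma> = \<alpha>\<beta> and of the
  three roots of R, and the subgroup lies in one of them exactly when the corresponding element lies
  in K. This is the role of the conditions on b and R; irreducibility of f supplies \<delta>
  \<notin> K. R is Cardano's cubic: u = \<gamma>\<alpha> and v = \<gamma>\<beta> satisfy uv = b and
  u^3 + v^3 = -ab, so u + v is a root of x^3 - 3uvx - (u^3 + v^3). A sum r = \<alpha>\<zeta>^k +
  \<beta>\<zeta>^(2k) satisfies r^3 = -a + 3\<gamma>r; for nonzero r this recovers \<gamma>, whence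
  K(r) = K(\<gamma>, \<gamma>r). Degrees come from minimal polynomials and towers, not from group
  indices.\<close>

text \<open>The product of \<open>\<int>\<close> and of all commutative rings with carrier in \<open>'a\<close>, as a type of class
  \<open>comm_ring_1\<close>: an identity that the simplifier proves for this type holds in a structure \<open>R\<close> by
  evaluation at the component \<open>R\<close>. The factor \<open>\<int>\<close> only ensures \<open>0 \<noteq> 1\<close>.\<close>

typedef (overloaded) ('a, 'b) cring_section =
  "{(n, s). (\<forall>R :: ('a, 'b) ring_scheme. if cring R then s R \<in> carrier R else s R = undefined)}
     :: (int \<times> (('a, 'b) ring_scheme \<Rightarrow> 'a)) set"
proof -
  have "(0 :: int, \<lambda>R. if cring R then \<zero>\<^bsub>R\<^esub> else undefined) \<in>
    {(n, s). (\<forall>R :: ('a, 'b) ring_scheme. if cring R then s R \<in> carrier R else s R = undefined)}"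
    by (auto intro: cring.cring_simprules(2))
  then show ?thesis by (rule exI)
qed

setup_lifting type_definition_cring_section

instantiation cring_section :: (type, type) comm_ring_1
begin

lift_definition zero_cring_section :: "('a, 'b) cring_section"
  is "(0, \<lambda>R. if cring R then \<zero>\<^bsub>R\<^esub> else undefined)"
  by (auto intro: cring.cring_simprules(2))

lift_definition one_cring_section :: "('a, 'b) cring_section"
  is "(1, \<lambda>R. if cring R then \<one>\<^bsub>R\<^esub> else undefined)"
  by (auto intro: cring.cring_simprules(6))

lift_definition plus_cring_section ::
    "('a, 'b) cring_section \<Rightarrow> ('a, 'b) cring_section \<Rightarrow> ('a, 'b) cring_section"
  is "\<lambda>(m, s) (n, t). (m + n, \<lambda>R. if cring R then s R \<oplus>\<^bsub>R\<^esub> t R else undefined)"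
  by (fastforce intro: cring.cring_simprules(1))

lift_definition uminus_cring_section :: "('a, 'b) cring_section \<Rightarrow> ('a, 'b) cring_section"
  is "\<lambda>(m, s). (- m, \<lambda>R. if cring R then \<ominus>\<^bsub>R\<^esub> s R else undefined)"
  by (fastforce intro: cring.cring_simprules(3))

lift_definition minus_cring_section ::
    "('a, 'b) cring_section \<Rightarrow> ('a, 'b) cring_section \<Rightarrow> ('a, 'b) cring_section"
  is "\<lambda>(m, s) (n, t). (m - n, \<lambda>R. if cring R then s R \<ominus>\<^bsub>R\<^esub> t R else undefined)"
  by (fastforce intro: cring.cring_simprules(4))

lift_definition times_cring_section ::
    "('a, 'b) cring_section \<Rightarrow> ('a, 'b) cring_section \<Rightarrow> ('a, 'b) cring_section"
  is "\<lambda>(m, s) (n, t). (m * n, \<lambda>R. if cring R then s R \<otimes>\<^bsub>R\<^esub> t R else undefined)"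
  by (fastforce intro: cring.cring_simprules(5))

instance
proof
  fix x y z :: "('a, 'b) cring_section"
  show "x * y * z = x * (y * z)"
    by transfer (auto simp: fun_eq_iff mult.assoc cring.cring_simprules(11))
  show "x * y = y * x"
    by transfer (fastforce simp: fun_eq_iff intro: cring.cring_simprules(14))
  show "1 * x = x"
    by transfer (fastforce simp: fun_eq_iff cring.cring_simprules(12))
  show "x + y + z = x + (y + z)"
    by transfer (auto simp: fun_eq_iff add.assoc cring.cring_simprules(7))
  show "x + y = y + x"
    by transfer (fastforce simp: fun_eq_iff intro: cring.cring_simprules(10))
  show "0 + x = x"
    by transfer (fastforce simp: fun_eq_iff cring.cring_simprules(8))
  show "- x + x = 0"
    by transfer (auto simp: fun_eq_iff cring.cring_simprules(9))
  show "x - y = x + - y"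
    by transfer (auto simp: fun_eq_iff cring.cring_simprules(15))
  show "(x + y) * z = x * z + y * z"
    by transfer (auto simp: fun_eq_iff distrib_right cring.cring_simprules(13))
  show "(0 :: ('a, 'b) cring_section) \<noteq> 1"
    by transfer simp
qed

end

lift_definition section_at :: "('a, 'b) ring_scheme \<Rightarrow> ('a, 'b) cring_section \<Rightarrow> 'a"
  is "\<lambda>R (n, s). s R" .

context cring
begin

text \<open>Take the section that is \<open>x\<close> at \<open>R\<close> and zero at every other
  commutative ring. Elements of \<open>R\<close> thus lift to sections, where identities among them
  can be proved.\<close>

lemma section_atE:
  assumes "x \<in> carrier R"
  obtains P where "x = section_at R P"
proof
  let ?s = "(0, \<lambda>S. if S = R then x else if cring S then \<zero>\<^bsub>S\<^esub> else undefined)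
    :: int \<times> (('a, 'b) ring_scheme \<Rightarrow> 'a)"
  have "?s \<in> {(n, s). \<forall>R. if cring R then s R \<in> carrier R else s R = undefined}"
    using assms is_cring by (simp add: cring.cring_simprules(2))
  from Abs_cring_section_inverse[OF this] show "x = section_at R (Abs_cring_section ?s)"
    by (simp only: section_at.rep_eq prod.case if_True simp_thms)
qed

lemma section_at_zero: "\<zero> = section_at R 0"
  using is_cring by transfer simp

lemma section_at_one: "\<one> = section_at R 1"
  using is_cring by transfer simp

lemma section_at_add: "section_at R P \<oplus> section_at R Q = section_at R (P + Q)"
  using is_cring by transfer (auto split: prod.splits)

lemma section_at_uminus: "\<ominus> section_at R P = section_at R (- P)"
  using is_cring by transfer (auto split: prod.splits)

lemma section_at_minus: "section_at R P \<ominus> section_at R Q = section_at R (P - Q)"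
  using is_cring by transfer (auto split: prod.splits)

lemma section_at_mult: "section_at R P \<otimes> section_at R Q = section_at R (P * Q)"
  using is_cring by transfer (auto split: prod.splits)

lemma section_at_power: "section_at R P [^] (n :: nat) = section_at R (P ^ n)"
  by (induction n) (simp_all add: section_at_one section_at_mult mult.commute)

lemma section_at_add_pow: "add_pow R (n :: nat) (section_at R P) = section_at R (of_nat n * P)"
  by (induction n) (simp_all add: section_at_zero section_at_add algebra_simps add_pow_def)

text \<open>Oriented to pull every ring operation inside \<open>section_at\<close>. Both sides of an
  identity then read \<open>section_at R P\<close>, and \<open>arg_cong\<close> leaves an equation
  in class \<open>comm_ring_1\<close> for \<open>algebra_simps\<close>.\<close>

lemmas section_at_simps = section_at_zero section_at_one section_at_add section_at_uminus
  section_at_minus section_at_mult section_at_power section_at_add_pow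

end


section \<open>Embeddings of subfields\<close>

locale subfield_embedding = field R for R (structure) +
  fixes M :: "'a set" and h :: "'a \<Rightarrow> 'a"
  assumes subfield_dom: "subfield M R"
    and hom: "h \<in> ring_hom (R\<lparr>carrier := M\<rparr>) R"
begin

lemmas subring_dom = subfieldE(1)[OF subfield_dom]
lemmas dom_carrier = subfieldE(3)[OF subfield_dom]

lemma ring_hom_ring_hom: "ring_hom_ring (R\<lparr>carrier := M\<rparr>) R h"
  using ring_hom_ringI2[OF subring_is_ring[OF subring_dom] ring_axioms hom] .

lemma inj: "inj_on h M"
  using non_trivial_field_hom_is_inj[OF hom subfield_iff(2)[OF subfield_dom] field_axioms] by simp

lemma hom_closed: "x \<in> M \<Longrightarrow> h x \<in> carrier R"
  and hom_add: "\<lbrakk>x \<in> M; y \<in> M\<rbrakk> \<Longrightarrow> h (x \<oplus> y) = h x \<oplus> h y"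
  and hom_mult: "\<lbrakk>x \<in> M; y \<in> M\<rbrakk> \<Longrightarrow> h (x \<otimes> y) = h x \<otimes> h y"
  and hom_one: "h \<one> = \<one>"
  using ring_hom_memE[OF hom] by auto

lemma hom_zero: "h \<zero> = \<zero>"
  using ring_hom_zero[OF hom subring_is_ring[OF subring_dom] ring_axioms] by simp

lemma hom_a_inv: "x \<in> M \<Longrightarrow> h (\<ominus> x) = \<ominus> h x"
  using hom_add[of "\<ominus> x" x] subringE(5)[OF subring_dom] hom_zero hom_closed dom_carrier
  by (metis add.inv_equality l_neg subsetD)

lemma hom_minus: "\<lbrakk>x \<in> M; y \<in> M\<rbrakk> \<Longrightarrow> h (x \<ominus> y) = h x \<ominus> h y"
  by (simp add: a_minus_def hom_add hom_a_inv subringE(5)[OF subring_dom])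

lemma hom_pow: "x \<in> M \<Longrightarrow> h (x [^] (n :: nat)) = h x [^] n"
proof (induction n)
  case (Suc n)
  have "x [^] n \<in> M"
    using Suc.prems subringE(3,6)[OF subring_dom] by (induction n) auto
  then show ?case using Suc by (simp add: hom_mult)
qed (simp add: hom_one)

lemma hom_eq_zero_iff: "x \<in> M \<Longrightarrow> h x = \<zero> \<longleftrightarrow> x = \<zero>"
  using inj hom_zero subringE(2)[OF subring_dom] by (metis inj_onD)

text \<open>Injectivity of \<open>h\<close> keeps the leading coefficient nonzero, so the mapped
  coefficient list needs no normalization.\<close>

lemma map_hom_closed: "p \<in> carrier (M[X]) \<Longrightarrow> map h p \<in> carrier (poly_ring R)"
  using hom_closed hom_eq_zero_iff
  unfolding sym[OF univ_poly_carrier] polynomial_def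
  by (cases p) auto

lemma normalize_map_hom:
  assumes "p \<in> carrier (M[X])"
  shows "normalize (map h p) = map h p"
  using map_hom_closed[OF assms] normalize_polynomial univ_poly_carrier by blast

lemma map_hom: "map h \<in> ring_hom (M[X]) (poly_ring R)"
proof -
  interpret h: ring_hom_ring "R\<lparr>carrier := M\<rparr>" R h
    using ring_hom_ring_hom .
  interpret P: ring "M[X]"
    using univ_poly_is_ring[OF subring_dom] .
  have set: "set p \<subseteq> M" if "p \<in> carrier (M[X])" for p
    using that polynomial_incl univ_poly_carrier by blast
  show ?thesis
  proof (rule ring_hom_memI)
    fix p q assume p: "p \<in> carrier (M[X])" and q: "q \<in> carrier (M[X])"
    show "map h (p \<otimes>\<^bsub>M[X]\<^esub> q) = map h p \<otimes>\<^bsub>poly_ring R\<^esub> map h q"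
      using h.poly_mult_hom'[of p q] set[OF p] set[OF q] normalize_map_hom[OF P.m_closed[OF p q]]
      by (simp add: univ_poly_mult poly_mult_consistent[OF subring_dom])
    show "map h (p \<oplus>\<^bsub>M[X]\<^esub> q) = map h p \<oplus>\<^bsub>poly_ring R\<^esub> map h q"
      using h.poly_add_hom'[of p q] set[OF p] set[OF q] normalize_map_hom[OF P.a_closed[OF p q]]
      by (simp add: univ_poly_add poly_add_consistent[OF subring_dom])
  qed (simp_all add: map_hom_closed univ_poly_one hom_one)
qed

lemma hom_eval:
  assumes "p \<in> carrier (M[X])" "x \<in> M"
  shows "h (eval p x) = eval (map h p) (h x)"
proof -
  interpret h: ring_hom_ring "R\<lparr>carrier := M\<rparr>" R h
    using ring_hom_ring_hom .
  have "set p \<subseteq> M"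
    using assms(1) polynomial_incl univ_poly_carrier by blast
  then show ?thesis
    using h.eval_hom'[of x p] assms(2) eval_consistent[OF subring_dom] by simp
qed

text \<open>The map p |-> (h p)(y') kills the multiples of the minimal polynomial of
  \<open>y\<close>, and these are all p with p(y) = 0. Its value therefore depends on p(y) only,
  which defines the extension.\<close>

theorem extends_to_simple_extension:
  assumes y: "y \<in> carrier R" "(algebraic over M) y"
    and y': "y' \<in> carrier R" "eval (map h (Irr M y)) y' = \<zero>"
  obtains g where "subfield_embedding R (simple_extension M y) g"
    "\<And>x. x \<in> M \<Longrightarrow> g x = h x" "g y = y'"
proof -
  interpret P: domain "M[X]"
    using univ_poly_is_domain[OF subring_dom] .
  interpret Q: domain "poly_ring R"
    using univ_poly_is_domain[OF carrier_is_subring] .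
  let ?E = "simple_extension M y"
  define \<Phi> where "\<Phi> p = eval (map h p) y'" for p
  define g where "g z = \<Phi> (SOME p. p \<in> carrier (M[X]) \<and> eval p y = z)" for z
  note ev = ring_hom_memE[OF eval_is_hom[OF subring_dom y(1)]]
  note ev' = ring_hom_memE[OF eval_is_hom[OF carrier_is_subring y'(1)]]
  note mh = ring_hom_memE[OF map_hom]
  have \<Phi>_closed: "\<Phi> p \<in> carrier R" if "p \<in> carrier (M[X])" for p
    using ev'(1) mh(1)[OF that] by (simp add: \<Phi>_def)
  have \<Phi>_add: "\<Phi> (p \<oplus>\<^bsub>M[X]\<^esub> q) = \<Phi> p \<oplus> \<Phi> q"
    and \<Phi>_mult: "\<Phi> (p \<otimes>\<^bsub>M[X]\<^esub> q) = \<Phi> p \<otimes> \<Phi> q"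
    if "p \<in> carrier (M[X])" "q \<in> carrier (M[X])" for p q
    using ev'(2,3)[OF mh(1)[OF that(1)] mh(1)[OF that(2)]] mh(2,3)[OF that]
    by (simp_all add: \<Phi>_def)
  have \<Phi>_Irr: "\<Phi> p = \<zero>" if p: "p \<in> carrier (M[X])" "eval p y = \<zero>" for p
  proof -
    have I: "Irr M y \<in> carrier (M[X])"
      using IrrE(1)[OF subfield_dom y] .
    have "Irr M y pdivides p"
      using Irr_minimal[OF subfield_dom y p] .
    then have "Irr M y divides\<^bsub>M[X]\<^esub> p"
      using pdivides_iff_shell[OF subfield_dom I p(1)] by simp
    then obtain q where "q \<in> carrier (M[X])" "p = Irr M y \<otimes>\<^bsub>M[X]\<^esub> q"
      by (rule dividesE)
    then show ?thesis
      using \<Phi>_mult[OF I] \<Phi>_closed y'(2) by (simp add: \<Phi>_def)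
  qed
  have \<Phi>_eq: "\<Phi> p = \<Phi> q"
    if p: "p \<in> carrier (M[X])" and q: "q \<in> carrier (M[X])" and "eval p y = eval q y" for p q
  proof -
    have d: "p \<ominus>\<^bsub>M[X]\<^esub> q \<in> carrier (M[X])"
      using p q by simp
    \<comment> \<open>Evaluation is used as an additive map, so the difference enters through p = (p
      - q) + q.\<close>
    have s: "(p \<ominus>\<^bsub>M[X]\<^esub> q) \<oplus>\<^bsub>M[X]\<^esub> q = p"
      using p q by (simp add: P.minus_eq P.a_assoc P.l_neg)
    have "eval (p \<ominus>\<^bsub>M[X]\<^esub> q) y \<oplus> eval q y = eval q y"
      using ev(3)[OF d q] that(3) by (simp add: s)
    then have "eval (p \<ominus>\<^bsub>M[X]\<^esub> q) y = \<zero>"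
      using ev(1)[OF d] ev(1)[OF q] by (simp add: add.l_cancel_one)
    then have "\<Phi> (p \<ominus>\<^bsub>M[X]\<^esub> q) = \<zero>"
      using \<Phi>_Irr d by simp
    then show ?thesis
      using \<Phi>_add[OF d q] \<Phi>_closed[OF q] by (simp add: s)
  qed
  have img: "?E = (\<lambda>p. eval p y) ` carrier (M[X])"
    using simple_extension_as_eval_img[OF dom_carrier y(1)] .
  have g_eval: "g (eval p y) = \<Phi> p" if "p \<in> carrier (M[X])" for p
  proof -
    have "\<exists>q. q \<in> carrier (M[X]) \<and> eval q y = eval p y"
      using that by blast
    note some = someI_ex[OF this]
    show ?thesis
      unfolding g_def by (rule \<Phi>_eq[OF conjunct1[OF some] that conjunct2[OF some]])
  qed
  have const: "g x = h x" if "x \<in> M" for x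
  proof -
    \<comment> \<open>The constant polynomial of \<open>x\<close>; for x = 0 it is the empty list,
      which \<open>normalize\<close> accounts for.\<close>
    have "normalize [x] \<in> carrier (M[X])"
      using that normalize_gives_polynomial[of "[x]" M] univ_poly_carrier by auto
    moreover have "eval (normalize [x]) y = x"
      using that dom_carrier y(1) by (cases "x = \<zero>") auto
    moreover have "\<Phi> (normalize [x]) = h x"
      using that hom_closed[OF that] y'(1) hom_zero by (cases "x = \<zero>") (auto simp: \<Phi>_def)
    ultimately show ?thesis
      using g_eval by metis
  qed
  have "g y = y'"
  proof -
    have "[\<one>, \<zero>] \<in> carrier (M[X])"
      using subringE(2,3)[OF subring_dom] unfolding sym[OF univ_poly_carrier] polynomial_def by auto
    moreover have "eval [\<one>, \<zero>] y = y" "\<Phi> [\<one>, \<zero>] = y'"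
      using y(1) y'(1) by (simp_all add: \<Phi>_def hom_one hom_zero)
    ultimately show ?thesis
      using g_eval by metis
  qed
  moreover have "subfield_embedding R ?E g"
  proof (intro subfield_embedding.intro subfield_embedding_axioms.intro field_axioms)
    show "subfield ?E R"
      using simple_extension_is_subfield[OF subfield_dom y(1)] y(2) by (simp add: over_def)
    show "g \<in> ring_hom (R\<lparr>carrier := ?E\<rparr>) R"
    proof (rule ring_hom_memI)
      show "g \<one>\<^bsub>R\<lparr>carrier := ?E\<rparr>\<^esub> = \<one>"
        using const[OF subringE(3)[OF subring_dom]] hom_one by simp
    next
      fix x assume "x \<in> carrier (R\<lparr>carrier := ?E\<rparr>)"
      then obtain p where "p \<in> carrier (M[X])" "x = eval p y"
        using img by auto
      then show "g x \<in> carrier R"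
        using g_eval \<Phi>_closed by simp
    next
      fix x z assume "x \<in> carrier (R\<lparr>carrier := ?E\<rparr>)" "z \<in> carrier (R\<lparr>carrier := ?E\<rparr>)"
      then obtain p q where p: "p \<in> carrier (M[X])" "x = eval p y"
        and q: "q \<in> carrier (M[X])" "z = eval q y"
        using img by auto
      show "g (x \<otimes>\<^bsub>R\<lparr>carrier := ?E\<rparr>\<^esub> z) = g x \<otimes> g z"
        using g_eval[OF P.m_closed[OF p(1) q(1)]] ev(2)[OF p(1) q(1)] \<Phi>_mult[OF p(1) q(1)]
          g_eval[OF p(1)] g_eval[OF q(1)] p(2) q(2) by simp
      show "g (x \<oplus>\<^bsub>R\<lparr>carrier := ?E\<rparr>\<^esub> z) = g x \<oplus> g z"
        using g_eval[OF P.a_closed[OF p(1) q(1)]] ev(3)[OF p(1) q(1)] \<Phi>_add[OF p(1) q(1)]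
          g_eval[OF p(1)] g_eval[OF q(1)] p(2) q(2) by simp
    qed
  qed
  ultimately show thesis
    using that const by blast
qed

end


section \<open>Minimal polynomials of radicals\<close>

text \<open>A nonzero \<open>q\<close> would put y = -p/q into \<open>M\<close>; in other words, 1
  and \<open>y\<close> are linearly independent over \<open>M\<close>.\<close>

lemma (in field) linear_relation_trivial:
  assumes M: "subfield M R" "p \<in> M" "q \<in> M" and y: "y \<in> carrier R" "y \<notin> M"
    and pq: "p \<oplus> q \<otimes> y = \<zero>"
  shows "p = \<zero>" "q = \<zero>"
proof -
  have c: "p \<in> carrier R" "q \<in> carrier R"
    using M subfieldE(3) by auto
  show "q = \<zero>"
  proof (rule ccontr)
    assume "q \<noteq> \<zero>"
    then have inv: "inv q \<in> M" "inv q \<otimes> q = \<one>"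
      using subfield_m_inv[OF M(1)] M(3) by auto
    then have ic: "inv q \<in> carrier R"
      using M(1) subfieldE(3) by auto
    \<comment> \<open>The vanishing terms stay explicit to make this an identity of commutative
      rings; the relation \<open>pq\<close> and the inverse of \<open>q\<close> are inserted
      afterwards.\<close>
    have "y = \<ominus> (inv q \<otimes> p) \<oplus> inv q \<otimes> (p \<oplus> q \<otimes> y) \<oplus> (\<one> \<ominus> inv q \<otimes> q) \<otimes> y"
      using c ic y(1)
      by (elim section_atE) (simp only: section_at_simps, rule arg_cong[of _ _ "section_at R"],
        simp add: algebra_simps)
    then have "y = \<ominus> (inv q \<otimes> p)"
      using c ic y(1) by (simp add: pq inv(2) minus_eq r_neg)
    then show False
      using inv(1) M(2) y(2) subringE(5,6)[OF subfieldE(1)[OF M(1)]] by metis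
  qed
  then show "p = \<zero>"
    using pq c y(1) by simp
qed

text \<open>The minimal polynomial divides \<open>p\<close>, and the cofactor has degree 0 and
  leading coefficient 1. A lower bound on the degree is thus enough to identify a minimal
  polynomial.\<close>

lemma (in field) Irr_eqI:
  assumes M: "subfield M R" and x: "x \<in> carrier R"
    and p: "p \<in> carrier (M[X])" "p \<noteq> []" "lead_coeff p = \<one>" "eval p x = \<zero>"
    and deg: "degree p \<le> degree (Irr M x)"
  shows "Irr M x = p"
proof -
  have alg: "(algebraic over M) x"
    using algebraicI[OF p(1,2,4)] .
  note I = IrrE[OF M x alg]
  note subr = subfieldE(1)[OF M]
  have "Irr M x \<noteq> []"
    using pirreducibleE(1)[OF subr I(1,2)] .
  have "Irr M x pdivides p"
    using Irr_minimal[OF M x alg p(1,4)] .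
  then have "Irr M x divides\<^bsub>M[X]\<^esub> p"
    using pdivides_iff_shell[OF M I(1) p(1)] by simp
  then obtain q where q: "q \<in> carrier (M[X])" "p = poly_mult (Irr M x) q"
    unfolding factor_def univ_poly_mult by auto
  have pol: "polynomial M (Irr M x)" "polynomial M q"
    using I(1) q(1) univ_poly_carrier by auto
  have "q \<noteq> []"
    using q(2) p(2) poly_mult_zero(2)[OF polynomial_in_carrier[OF subr pol(1)]] by auto
  have "length (Irr M x) > 0" "length p > 0" "length q > 0"
    using \<open>Irr M x \<noteq> []\<close> p(2) \<open>q \<noteq> []\<close> by auto
  then have "degree q = 0"
    using poly_mult_degree_eq[OF subr pol] q(2) deg \<open>Irr M x \<noteq> []\<close> \<open>q \<noteq> []\<close> by auto
  then obtain k where k: "q = [k]" "k \<in> M"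
    using \<open>q \<noteq> []\<close> pol(2) unfolding polynomial_def by (cases q) auto
  have "k = \<one>"
    using poly_mult_lead_coeff[OF subr pol \<open>Irr M x \<noteq> []\<close> \<open>q \<noteq> []\<close>] p(3) I(3) k q(2)
      subringE(1)[OF subr] by auto
  then show ?thesis
    using q(2) k(1) poly_mult_one(2)[OF subr pol(1)] by simp
qed

lemma (in field) degree_Irr_ge_2:
  assumes M: "subfield M R" and x: "x \<in> carrier R" "(algebraic over M) x" and "x \<notin> M"
  shows "2 \<le> degree (Irr M x)"
proof (rule ccontr)
  note I = IrrE[OF M x]
  assume "\<not> 2 \<le> degree (Irr M x)"
  with pirreducible_degree[OF M I(1,2)] have "length (Irr M x) = 2"
    by auto
  then obtain u v where uv: "Irr M x = [u, v]"
    by (auto simp: numeral_2_eq_2 length_Suc_conv)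
  have "v \<in> M"
    using I(1) uv unfolding sym[OF univ_poly_carrier] polynomial_def by auto
  have "u = \<one>" "x \<oplus> v = \<zero>"
    using I(3,4) uv x(1) \<open>v \<in> M\<close> subfieldE(3)[OF M] by auto
  then have "x = \<ominus> v"
    using x(1) \<open>v \<in> M\<close> subfieldE(3)[OF M] by (metis add.inv_equality add.inv_inv subsetD
      add.inv_closed minus_minus)
  then show False
    using subringE(5)[OF subfieldE(1)[OF M] \<open>v \<in> M\<close>] assms(4) by simp
qed

lemma (in field) Irr_square_root:
  assumes M: "subfield M R" and x: "x \<in> carrier R" "x [^] (2 :: nat) \<in> M" "x \<notin> M"
  shows "Irr M x = [\<one>, \<zero>, \<ominus> (x [^] (2 :: nat))]" "(algebraic over M) x"
proof -
  let ?p = "[\<one>, \<zero>, \<ominus> (x [^] (2 :: nat))]"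
  have p: "?p \<in> carrier (M[X])"
    using subringE(2,3,5)[OF subfieldE(1)[OF M]] x(2)
    unfolding sym[OF univ_poly_carrier] polynomial_def by auto
  have e: "eval ?p x = \<zero>"
    using x(1) by (simp add: r_neg numeral_2_eq_2)
  show alg: "(algebraic over M) x"
    using algebraicI[OF p _ e] by simp
  show "Irr M x = ?p"
    using Irr_eqI[OF M x(1) p _ _ e] degree_Irr_ge_2[OF M x(1) alg x(3)] by (simp add: numeral_2_eq_2)
qed

text \<open>The root of unity enters through its quadratic relation because identities are proved
  for an arbitrary \<zeta>, with an explicit multiple of \<zeta>^2 + \<zeta> + 1 that then
  vanishes.\<close>

locale field_with_cube_root = field R for R (structure) +
  fixes K :: "'a set" and \<zeta> :: 'a
  assumes subfield_K: "subfield K R"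
    and zeta_K: "\<zeta> \<in> K"
    and zeta_sum: "\<zeta> [^] (2 :: nat) \<oplus> \<zeta> \<oplus> \<one> = \<zero>"
    and two_neq_zero: "[(2 :: nat)] \<cdot> \<one> \<noteq> \<zero>"
    and three_neq_zero: "[(3 :: nat)] \<cdot> \<one> \<noteq> \<zero>"
begin

lemma zeta_closed [simp]: "\<zeta> \<in> carrier R"
  using zeta_K subfieldE(3)[OF subfield_K] by auto

lemma zeta_cube: "\<zeta> [^] (3 :: nat) = \<one>"
proof -
  have "\<zeta> [^] (3 :: nat) \<ominus> \<one> = (\<zeta> \<ominus> \<one>) \<otimes> (\<zeta> [^] (2 :: nat) \<oplus> \<zeta> \<oplus> \<one>)"
    using zeta_closed
    by (elim section_atE) (simp only: section_at_simps, rule arg_cong[of _ _ "section_at R"],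
        simp add: algebra_simps power2_eq_square power3_eq_cube)
  then show ?thesis
    by (simp add: zeta_sum)
qed

lemma cube_eq_cases:
  assumes "x \<in> carrier R" "y \<in> carrier R" "x [^] (3 :: nat) = y [^] (3 :: nat)"
  obtains "x = y" | "x = \<zeta> \<otimes> y" | "x = \<zeta> [^] (2 :: nat) \<otimes> y"
proof -
  \<comment> \<open>The factorization of x^3 - y^3, valid for any \<zeta> because it carries the
    cofactor of \<zeta>^2 + \<zeta> + 1.\<close>
  have "(x \<ominus> y) \<otimes> (x \<ominus> \<zeta> \<otimes> y) \<otimes> (x \<ominus> \<zeta> [^] (2 :: nat) \<otimes> y) = x [^] (3 :: nat) \<ominus> y [^] (3 :: nat) \<ominus>
     (x [^] (2 :: nat) \<otimes> y \<ominus> x \<otimes> y [^] (2 :: nat) \<otimes> \<zeta> \<oplus> (\<zeta> \<ominus> \<one>) \<otimes> y [^] (3 :: nat)) \<otimes> (\<zeta> [^] (2 ::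
       nat) \<oplus> \<zeta> \<oplus> \<one>)"
    using assms(1,2) zeta_closed
    by (elim section_atE) (simp only: section_at_simps, rule arg_cong[of _ _ "section_at R"],
        simp add: algebra_simps power2_eq_square power3_eq_cube)
  then have "(x \<ominus> y) \<otimes> (x \<ominus> \<zeta> \<otimes> y) \<otimes> (x \<ominus> \<zeta> [^] (2 :: nat) \<otimes> y) = \<zero>"
    using assms by (simp add: zeta_sum minus_eq r_neg)
  then show thesis
    using assms(1,2) that by (auto simp: integral_iff)
qed


lemma root_of_cube_mem:
  assumes M: "subfield M R" "K \<subseteq> M" and "x \<in> M" "y \<in> carrier R" "x [^] (3 :: nat) = y [^] (3 :: nat)"
  shows "y \<in> M"
proof -
  have subr: "subring M R" "\<zeta> \<in> M" "\<zeta> [^] (2 :: nat) \<in> M" "x \<in> carrier R"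
    using subfieldE(1,3)[OF M(1)] M(2) zeta_K subringE(6)[OF subfieldE(1)[OF M(1)]] assms(3)
    by (auto simp: numeral_2_eq_2)
  consider "y = x" | "y = \<zeta> \<otimes> x" | "y = \<zeta> [^] (2 :: nat) \<otimes> x"
    using cube_eq_cases[OF assms(4) subr(4) assms(5)[symmetric]] by blast
  then show ?thesis
    using subr assms(3) subringE(6)[OF subr(1)] by cases auto
qed

text \<open>The degree is at least 2 as y \<notin> M, so only degree 2 has to be excluded. A
  quadratic relation for \<open>y\<close> would make y^3 the cube of an element of \<open>M\<close>,
  and then all its cube roots, \<open>y\<close> among them, would lie in \<open>M\<close>.\<close>

lemma Irr_cube_root:
  assumes M: "subfield M R" "K \<subseteq> M" and y: "y \<in> carrier R" "y [^] (3 :: nat) \<in> M" "y \<notin> M"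
  shows "Irr M y = [\<one>, \<zero>, \<zero>, \<ominus> (y [^] (3 :: nat))]" "(algebraic over M) y"
proof -
  let ?p = "[\<one>, \<zero>, \<zero>, \<ominus> (y [^] (3 :: nat))]"
  note subr = subfieldE(1)[OF M(1)]
  note mem = subringE(2,3,5,6,7)[OF subr]
  note MR = subfieldE(3)[OF M(1)]
  have p: "?p \<in> carrier (M[X])"
    using mem y(2) unfolding sym[OF univ_poly_carrier] polynomial_def by auto
  have e: "eval ?p y = \<zero>"
    using y(1) by (simp add: r_neg numeral_3_eq_3)
  show alg: "(algebraic over M) y"
    using algebraicI[OF p _ e] by simp
  note I = IrrE[OF M(1) y(1) alg]
  have "degree (Irr M y) \<noteq> 2"
  proof
    assume "degree (Irr M y) = 2"
    then have "length (Irr M y) = Suc (Suc (Suc 0))"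
      by linarith
    then obtain u v w where uvw: "Irr M y = [w, v, u]"
      by (auto simp: length_Suc_conv)
    have mems: "v \<in> M" "u \<in> M"
      using I(1) uvw unfolding sym[OF univ_poly_carrier] polynomial_def by auto
    then have car [simp]: "u \<in> carrier R" "v \<in> carrier R"
      using MR by auto
    have w: "w = \<one>"
      using I(3) uvw by simp
    have q: "y [^] (2 :: nat) \<oplus> v \<otimes> y \<oplus> u = \<zero>"
      using I(4) uvw y(1) by (simp add: w a_assoc numeral_2_eq_2)
    \<comment> \<open>Modulo X^2 + vX + u, the remainder of X^3 is (v^2 - u)X + uv. Since y \<notin>
      M, the coefficient \<open>s\<close> must vanish, and then v^3 = uv = y^3.\<close>
    define s where "s = v [^] (2 :: nat) \<ominus> u"
    have "s \<in> M"
      unfolding s_def a_minus_def using mems mem by (simp add: numeral_2_eq_2)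
    then have [simp]: "s \<in> carrier R"
      using MR by auto
    have "s \<otimes> y \<ominus> (y [^] (3 :: nat) \<ominus> u \<otimes> v) =
        (v \<ominus> y) \<otimes> (y [^] (2 :: nat) \<oplus> v \<otimes> y \<oplus> u)"
      unfolding s_def using y(1) car
      by (elim section_atE) (simp only: section_at_simps, rule arg_cong[of _ _ "section_at R"],
        simp add: algebra_simps power2_eq_square power3_eq_cube)
    then have sy: "s \<otimes> y = y [^] (3 :: nat) \<ominus> u \<otimes> v"
      using y(1) q by simp
    have d: "y [^] (3 :: nat) \<ominus> u \<otimes> v \<in> M"
      unfolding a_minus_def using mems mem y(2) by simp
    have "\<ominus> (y [^] (3 :: nat) \<ominus> u \<otimes> v) \<oplus> s \<otimes> y = \<zero>"
      unfolding sy using y(1) car by (simp add: l_neg)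
    then have "s = \<zero>"
      using linear_relation_trivial(2)[OF M(1) mem(3)[OF d] \<open>s \<in> M\<close> y(1,3)] by simp
    then have "u = v [^] (2 :: nat)"
      unfolding s_def by simp
    moreover have "y [^] (3 :: nat) = u \<otimes> v"
      using sy[symmetric] y(1) car by (simp add: \<open>s = \<zero>\<close>)
    ultimately have "v [^] (3 :: nat) = y [^] (3 :: nat)"
      by (simp add: numeral_2_eq_2 numeral_3_eq_3)
    then show False
      using root_of_cube_mem[OF M mems(1) y(1)] y(3) by simp
  qed
  then show "Irr M y = ?p"
    using Irr_eqI[OF M(1) y(1) p _ _ e] degree_Irr_ge_2[OF M(1) y(1) alg y(3)] by simp
qed

end


section \<open>Adjunction of generators and conjugations of radical extensions\<close>

lemma (in field)
  assumes "M \<subseteq> carrier R" "S \<subseteq> carrier R"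
  shows subfield_adjoin: "subfield (adjoin R M S) R"
    and adjoin_incl: "M \<subseteq> adjoin R M S" "S \<subseteq> adjoin R M S"
    and adjoin_minimal: "\<lbrakk>subfield E R; M \<subseteq> E; S \<subseteq> E\<rbrakk> \<Longrightarrow> adjoin R M S \<subseteq> E"
  using generate_fieldE[of "M \<union> S" "adjoin R M S"] assms by (auto simp: adjoin_def)

lemma (in field) simple_extension_eq_adjoin:
  assumes M: "subfield M R" and x: "x \<in> carrier R" "(algebraic over M) x"
  shows "simple_extension M x = adjoin R M {x}"
proof
  note subr = subfieldE(1)[OF M] and MR = subfieldE(3)[OF M]
  note adj = subfield_adjoin[OF MR, of "{x}"] adjoin_incl[OF MR, of "{x}"]
  show "simple_extension M x \<subseteq> adjoin R M {x}"
    using simple_extension_subring_incl[OF subfieldE(1)] adj x(1) by auto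
  show "adjoin R M {x} \<subseteq> simple_extension M x"
    using adjoin_minimal[OF MR, of "{x}" "simple_extension M x"] x
      simple_extension_is_subfield[OF M x(1)] simple_extension_incl[OF MR x(1)]
      simple_extension_mem[OF subr x(1)] by (simp add: over_def)
qed

text \<open>Elements of \<open>simple_extension\<close> arise by Horner's scheme; multiplying u + vy
  by \<open>y\<close> folds y^2 back into \<open>M\<close>.\<close>

lemma (in field) mem_simple_extension_square_root:
  assumes M: "subfield M R" and y: "y \<in> carrier R" "y [^] (2 :: nat) \<in> M"
    and "x \<in> simple_extension M y"
  shows "\<exists>u\<in>M. \<exists>v\<in>M. x = u \<oplus> v \<otimes> y"
  using assms(4)
proof induction
  note mem = subringE(2,6,7)[OF subfieldE(1)[OF M]] and MR = subfieldE(3)[OF M]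
  case zero
  then show ?case
    using mem(1) y(1) by (intro bexI[of _ \<zero>]) auto
  case (lin k1 k2)
  then obtain u v where uv: "u \<in> M" "v \<in> M" "k1 = u \<oplus> v \<otimes> y"
    by blast
  have "u \<in> carrier R" "v \<in> carrier R" "k2 \<in> carrier R"
    using uv lin(2) MR by auto
  then have "k1 \<otimes> y \<oplus> k2 = (v \<otimes> y [^] (2 :: nat) \<oplus> k2) \<oplus> u \<otimes> y"
    unfolding uv(3) using y(1)
    by (elim section_atE) (simp only: section_at_simps, rule arg_cong[of _ _ "section_at R"],
      simp add: algebra_simps power2_eq_square power3_eq_cube)
  then show ?case
    using uv lin(2) mem y(2) by blast
qed

lemma (in field) mem_simple_extension_cube_root:
  assumes M: "subfield M R" and y: "y \<in> carrier R" "y [^] (3 :: nat) \<in> M"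
    and "x \<in> simple_extension M y"
  shows "\<exists>u\<in>M. \<exists>v\<in>M. \<exists>w\<in>M. x = u \<oplus> v \<otimes> y \<oplus> w \<otimes> y [^] (2 :: nat)"
  using assms(4)
proof induction
  note mem = subringE(2,6,7)[OF subfieldE(1)[OF M]] and MR = subfieldE(3)[OF M]
  case zero
  then show ?case
    using mem(1) y(1) by (intro bexI[of _ \<zero>]) auto
  case (lin k1 k2)
  then obtain u v w where uv: "u \<in> M" "v \<in> M" "w \<in> M" "k1 = u \<oplus> v \<otimes> y \<oplus> w \<otimes> y [^] (2 :: nat)"
    by blast
  have "u \<in> carrier R" "v \<in> carrier R" "w \<in> carrier R" "k2 \<in> carrier R"
    using uv lin(2) MR by auto
  then have "k1 \<otimes> y \<oplus> k2 = (w \<otimes> y [^] (3 :: nat) \<oplus> k2) \<oplus> u \<otimes> y \<oplus> v \<otimes> y [^] (2 :: nat)"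
    unfolding uv(4) using y(1)
    by (elim section_atE) (simp only: section_at_simps, rule arg_cong[of _ _ "section_at R"],
      simp add: algebra_simps power2_eq_square power3_eq_cube)
  then show ?case
    using uv lin(2) mem y(2) by blast
qed

lemma (in field) subfield_embedding_id: "subfield M R \<Longrightarrow> subfield_embedding R M (\<lambda>x. x)"
  by (intro subfield_embedding.intro subfield_embedding_axioms.intro field_axioms ring_hom_memI)
    (auto dest: subfieldE(3))

text \<open>The conjugation y |-> -y moves x = u + vy by 2vy. Here v is nonzero because x \<notin>
  M, and 2 is nonzero by hypothesis.\<close>

lemma (in field) square_root_conjugation:
  assumes two: "[(2 :: nat)] \<cdot> \<one> \<noteq> \<zero>"
    and M: "subfield M R" and y: "y \<in> carrier R" "y [^] (2 :: nat) \<in> M" "y \<notin> M"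
    and x: "x \<in> simple_extension M y" "x \<notin> M"
  obtains g where "subfield_embedding R (simple_extension M y) g" "\<And>m. m \<in> M \<Longrightarrow> g m = m" "g x \<noteq> x"
proof -
  interpret I: subfield_embedding R M "\<lambda>x. x"
    using subfield_embedding_id[OF M] .
  note irr = Irr_square_root[OF M y]
  have "eval (map (\<lambda>x. x) (Irr M y)) (\<ominus> y) = \<zero>"
    using y(1) by (simp add: irr(1) r_neg numeral_2_eq_2 l_minus r_minus)
  then obtain g where g: "subfield_embedding R (simple_extension M y) g"
      "\<And>m. m \<in> M \<Longrightarrow> g m = m" "g y = \<ominus> y"
    using I.extends_to_simple_extension[OF y(1) irr(2), of "\<ominus> y"] y(1) by auto
  interpret g: subfield_embedding R "simple_extension M y" g
    using g(1) .
  obtain u v where uv: "u \<in> M" "v \<in> M" "x = u \<oplus> v \<otimes> y"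
    using mem_simple_extension_square_root[OF M y(1,2) x(1)] by blast
  have c: "u \<in> carrier R" "v \<in> carrier R"
    using uv I.dom_carrier by auto
  have E: "M \<subseteq> simple_extension M y" "y \<in> simple_extension M y"
    using simple_extension_incl[OF I.dom_carrier y(1)] simple_extension_mem[OF I.subring_dom y(1)]
      by auto
  have "g x = u \<oplus> v \<otimes> (\<ominus> y)"
    using uv E g(2,3) subringE(6)[OF g.subring_dom] by (simp add: g.hom_add g.hom_mult subset_iff)
  moreover have "x \<ominus> (u \<oplus> v \<otimes> (\<ominus> y)) = ([(2 :: nat)] \<cdot> \<one>) \<otimes> (v \<otimes> y)"
    unfolding uv(3) using y(1) c
    by (elim section_atE) (simp only: section_at_simps, rule arg_cong[of _ _ "section_at R"],
      simp add: algebra_simps power2_eq_square power3_eq_cube)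
  moreover have "v \<noteq> \<zero>" "y \<noteq> \<zero>"
    using uv x(2) c y subringE(2)[OF I.subring_dom] by auto
  then have "([(2 :: nat)] \<cdot> \<one>) \<otimes> (v \<otimes> y) \<noteq> \<zero>"
    using two c y(1) by (simp add: integral_iff)
  ultimately have "g x \<noteq> x"
    using c y(1) uv(3) by (metis r_right_minus_eq a_closed m_closed)
  then show thesis
    using that g by blast
qed


text \<open>Members are functions on the whole type whose values off the carrier are arbitrary, so
  equality of endomorphisms is always meant pointwise on the carrier.\<close>

definition endomorphisms_fixing :: "('a, 'b) ring_scheme \<Rightarrow> 'a set \<Rightarrow> ('a \<Rightarrow> 'a) set" where
  "endomorphisms_fixing R M = {g \<in> ring_hom R R. \<forall>m\<in>M. g m = m}"

context field_with_cube_root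
begin

text \<open>For \<zeta> = 1 the relation \<zeta>^2 + \<zeta> + 1 = 0 would say 3 = 0.\<close>

lemma zeta_neq_one: "\<zeta> \<noteq> \<one>" "\<zeta> [^] (2 :: nat) \<noteq> \<one>"
proof -
  show "\<zeta> \<noteq> \<one>"
  proof
    assume "\<zeta> = \<one>"
    then have "[(3 :: nat)] \<cdot> \<one> = \<zero>"
      using zeta_sum by (simp add: numeral_3_eq_3)
    then show False
      using three_neq_zero by simp
  qed
  moreover have "\<zeta> [^] (3 :: nat) = \<zeta> [^] (2 :: nat) \<otimes> \<zeta>"
    by (simp add: numeral_2_eq_2 numeral_3_eq_3)
  ultimately show "\<zeta> [^] (2 :: nat) \<noteq> \<one>"
    using zeta_cube by (metis l_one zeta_closed)
qed

text \<open>The conjugation is y |-> \<zeta>y. If it fixed x = u + vy + wy^2, cancelling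
  \<open>y\<close> in x - g x would leave a linear relation in \<open>y\<close>; hence v = w = 0 and
  x \<in> M.\<close>

lemma cube_root_conjugation:
  assumes M: "subfield M R" "K \<subseteq> M" and y: "y \<in> carrier R" "y [^] (3 :: nat) \<in> M" "y \<notin> M"
    and x: "x \<in> simple_extension M y" "x \<notin> M"
  obtains g where "subfield_embedding R (simple_extension M y) g" "\<And>m. m \<in> M \<Longrightarrow> g m = m" "g x \<noteq> x"
proof -
  interpret I: subfield_embedding R M "\<lambda>x. x"
    using subfield_embedding_id[OF M(1)] .
  note irr = Irr_cube_root[OF M y]
  have "(\<zeta> \<otimes> y) [^] (3 :: nat) = y [^] (3 :: nat)"
    using y(1) by (simp add: nat_pow_distrib zeta_cube)
  then have "eval (map (\<lambda>x. x) (Irr M y)) (\<zeta> \<otimes> y) = \<zero>"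
    using y(1) by (simp add: irr(1) r_neg numeral_3_eq_3)
  then obtain g where g: "subfield_embedding R (simple_extension M y) g"
      "\<And>m. m \<in> M \<Longrightarrow> g m = m" "g y = \<zeta> \<otimes> y"
    using I.extends_to_simple_extension[OF y(1) irr(2), of "\<zeta> \<otimes> y"] y(1) by auto
  interpret g: subfield_embedding R "simple_extension M y" g
    using g(1) .
  obtain u v w where uv: "u \<in> M" "v \<in> M" "w \<in> M" "x = u \<oplus> v \<otimes> y \<oplus> w \<otimes> y [^] (2 :: nat)"
    using mem_simple_extension_cube_root[OF M(1) y(1,2) x(1)] by blast
  have c: "u \<in> carrier R" "v \<in> carrier R" "w \<in> carrier R"
    using uv I.dom_carrier by auto
  have E: "M \<subseteq> simple_extension M y" "y \<in> simple_extension M y"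
    using simple_extension_incl[OF I.dom_carrier y(1)] simple_extension_mem[OF I.subring_dom y(1)]
      by auto
  have E2: "y [^] (2 :: nat) \<in> simple_extension M y"
    using E(2) subringE(6)[OF g.subring_dom] y(1) by (simp add: numeral_2_eq_2)
  have gx: "g x = u \<oplus> v \<otimes> (\<zeta> \<otimes> y) \<oplus> w \<otimes> (\<zeta> \<otimes> y) [^] (2 :: nat)"
    using uv E E2 g(2,3) subringE(6,7)[OF g.subring_dom]
    by (simp add: g.hom_add g.hom_mult g.hom_pow subset_iff)
  show thesis
  proof (rule that[OF g(1,2)])
    show "g x \<noteq> x"
    proof
      let ?p = "v \<otimes> (\<one> \<ominus> \<zeta>)" and ?q = "w \<otimes> (\<one> \<ominus> \<zeta> [^] (2 :: nat))"
      assume "g x = x"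
      have "(?p \<oplus> ?q \<otimes> y) \<otimes> y = x \<ominus> g x"
        unfolding uv(4) gx[unfolded uv(4)] using y(1) c zeta_closed
        by (elim section_atE) (simp only: section_at_simps, rule arg_cong[of _ _ "section_at R"],
          simp add: algebra_simps power2_eq_square power3_eq_cube)
      also have "x \<ominus> g x = \<zero>"
        unfolding \<open>g x = x\<close> using uv(4) c y(1) by (simp add: minus_eq r_neg)
      finally have pq: "?p \<oplus> ?q \<otimes> y = \<zero>"
        using c y subringE(2)[OF I.subring_dom] by (auto simp: integral_iff)
      have z: "\<one> \<ominus> \<zeta> \<noteq> \<zero>" "\<one> \<ominus> \<zeta> [^] (2 :: nat) \<noteq> \<zero>"
        using zeta_neq_one by simp_all
      have mem: "?p \<in> M" "?q \<in> M"
        unfolding minus_eq numeral_2_eq_2 using uv zeta_K M(2) subringE(3,5,6,7)[OF I.subring_dom]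
        by (auto intro!: subringE(3,5,6,7)[OF I.subring_dom])
      have "?p = \<zero>" "?q = \<zero>"
        using linear_relation_trivial[OF M(1) mem y(1,3) pq] by auto
      then have "v = \<zero>" "w = \<zero>"
        using z c by (simp_all add: integral_iff)
      then have "x = u"
        using uv(4) c y(1) by simp
      then show False
        using x(2) uv(1) by simp
    qed
  qed
qed

end


section \<open>The Galois property\<close>

locale cubic_pair = field_with_cube_root R K \<zeta>
  for R (structure) and K :: "'a set" and \<zeta> :: 'a +
  fixes \<alpha> \<beta> \<delta> a b :: 'a
  assumes alpha_closed [simp]: "\<alpha> \<in> carrier R" and beta_closed [simp]: "\<beta> \<in> carrier R"
    and a_K: "a \<in> K" and b_K: "b \<in> K"
    and cubes_sum: "\<alpha> [^] (3 :: nat) \<oplus> \<beta> [^] (3 :: nat) = \<ominus> a"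
    and cubes_prod: "\<alpha> [^] (3 :: nat) \<otimes> \<beta> [^] (3 :: nat) = b"
    and cubes_neq: "\<alpha> [^] (3 :: nat) \<noteq> \<beta> [^] (3 :: nat)"
    and alpha_neq_zero: "\<alpha> \<noteq> \<zero>" and beta_neq_zero: "\<beta> \<noteq> \<zero>"
    and generated: "adjoin R K {\<alpha>, \<beta>} = carrier R"
    and delta_cases: "\<delta> = \<alpha> [^] (3 :: nat) \<ominus> \<beta> [^] (3 :: nat) \<or> \<delta> = \<beta> [^] (3 :: nat) \<ominus> \<alpha> [^] (3 :: nat)"
begin

lemma K_carrier: "K \<subseteq> carrier R"
  using subfieldE(3)[OF subfield_K] .

lemma delta_closed [simp]: "\<delta> \<in> carrier R"
  using delta_cases by auto

lemma generatedD:
  assumes "subfield M R" "K \<subseteq> M" "\<alpha> \<in> M" "\<beta> \<in> M"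
  shows "M = carrier R"
  using adjoin_minimal[OF K_carrier _ assms(1,2), of "{\<alpha>, \<beta>}"] assms(3,4) generated
    subfieldE(3)[OF assms(1)] by auto

lemma delta_square_mem: "\<delta> [^] (2 :: nat) \<in> K"
proof -
  note mem = subringE(3,5,6,7)[OF subfieldE(1)[OF subfield_K]]
  have [simp]: "a \<in> carrier R" "b \<in> carrier R"
    using a_K b_K K_carrier by auto
  have "(\<alpha> [^] (3 :: nat) \<ominus> \<beta> [^] (3 :: nat)) [^] (2 :: nat) =
      (\<alpha> [^] (3 :: nat) \<oplus> \<beta> [^] (3 :: nat)) [^] (2 :: nat) \<ominus> [(4 :: nat)] \<cdot> (\<alpha> [^] (3 :: nat) \<otimes> \<beta>
        [^] (3 :: nat))"
      "(\<beta> [^] (3 :: nat) \<ominus> \<alpha> [^] (3 :: nat)) [^] (2 :: nat) =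
      (\<alpha> [^] (3 :: nat) \<oplus> \<beta> [^] (3 :: nat)) [^] (2 :: nat) \<ominus> [(4 :: nat)] \<cdot> (\<alpha> [^] (3 :: nat) \<otimes> \<beta>
        [^] (3 :: nat))"
    using alpha_closed beta_closed
    by (elim section_atE, simp only: section_at_simps, intro arg_cong[of _ _ "section_at R"],
        simp add: algebra_simps power2_eq_square power3_eq_cube)+
  then have "\<delta> [^] (2 :: nat) = (\<ominus> a) [^] (2 :: nat) \<ominus> [(4 :: nat)] \<cdot> b"
    using delta_cases by (auto simp: cubes_sum cubes_prod)
  also have "\<dots> = (\<ominus> a) \<otimes> (\<ominus> a) \<oplus> \<ominus> (b \<oplus> b \<oplus> b \<oplus> b)"
    by (simp add: numeral_eq_Suc minus_eq)
  also have "\<dots> \<in> K"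
    using a_K b_K mem by simp
  finally show ?thesis .
qed

text \<open>The cubes are the halves of -a + \<delta> and -a - \<delta>, and 2 is
  invertible.\<close>

lemma cubes_mem:
  assumes M: "subfield M R" "K \<subseteq> M" "\<delta> \<in> M"
  shows "\<alpha> [^] (3 :: nat) \<in> M" "\<beta> [^] (3 :: nat) \<in> M"
proof -
  note mem = subringE(3,5,6,7)[OF subfieldE(1)[OF M(1)]]
  have half: "x \<in> M" if "x \<in> carrier R" "x \<oplus> x \<in> M" for x
  proof -
    let ?t = "[(2 :: nat)] \<cdot> \<one>"
    have "?t \<in> M"
      using mem(1,4) by (simp add: numeral_2_eq_2)
    then have inv: "inv ?t \<in> M" "inv ?t \<otimes> ?t = \<one>"
      using subfield_m_inv[OF M(1)] two_neq_zero by auto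
    then have "inv ?t \<in> carrier R"
      using subfieldE(3)[OF M(1)] by auto
    moreover have "x \<oplus> x = ?t \<otimes> x"
      using that(1) by (simp add: numeral_2_eq_2 l_distr)
    ultimately have "inv ?t \<otimes> (x \<oplus> x) = x"
      using inv(2) that(1) by (simp add: m_assoc[symmetric])
    then show ?thesis
      using mem(3) inv(1) that(2) by metis
  qed
  have "\<ominus> a \<oplus> \<delta> \<in> M" "\<ominus> a \<oplus> \<ominus> \<delta> \<in> M"
    using M mem a_K by auto
  moreover have "\<alpha> [^] (3 :: nat) \<oplus> \<beta> [^] (3 :: nat) \<oplus> (\<alpha> [^] (3 :: nat) \<ominus> \<beta> [^] (3 :: nat)) =
      \<alpha> [^] (3 :: nat) \<oplus> \<alpha> [^] (3 :: nat)"
    "\<alpha> [^] (3 :: nat) \<oplus> \<beta> [^] (3 :: nat) \<oplus> \<ominus> (\<beta> [^] (3 :: nat) \<ominus> \<alpha> [^] (3 :: nat)) =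
      \<alpha> [^] (3 :: nat) \<oplus> \<alpha> [^] (3 :: nat)"
    "\<alpha> [^] (3 :: nat) \<oplus> \<beta> [^] (3 :: nat) \<oplus> (\<beta> [^] (3 :: nat) \<ominus> \<alpha> [^] (3 :: nat)) =
      \<beta> [^] (3 :: nat) \<oplus> \<beta> [^] (3 :: nat)"
    "\<alpha> [^] (3 :: nat) \<oplus> \<beta> [^] (3 :: nat) \<oplus> \<ominus> (\<alpha> [^] (3 :: nat) \<ominus> \<beta> [^] (3 :: nat)) =
      \<beta> [^] (3 :: nat) \<oplus> \<beta> [^] (3 :: nat)"
    using alpha_closed beta_closed
    by (elim section_atE, simp only: section_at_simps, intro arg_cong[of _ _ "section_at R"],
        simp add: algebra_simps)+
  ultimately show "\<alpha> [^] (3 :: nat) \<in> M" "\<beta> [^] (3 :: nat) \<in> M"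
    using delta_cases half[of "\<alpha> [^] (3 :: nat)"] half[of "\<beta> [^] (3 :: nat)"]
    unfolding cubes_sum by auto
qed

text \<open>An embedding over K preserves the sum and the product of the two cubes, so the image of
  A satisfies (h A - A)(h A - B) = 0.\<close>

lemma embedding_cubes:
  assumes "subfield_embedding R M h" and M: "K \<subseteq> M" "\<And>k. k \<in> K \<Longrightarrow> h k = k"
    and c: "\<alpha> [^] (3 :: nat) \<in> M" "\<beta> [^] (3 :: nat) \<in> M"
  shows "h (\<alpha> [^] (3 :: nat)) = \<alpha> [^] (3 :: nat) \<and> h (\<beta> [^] (3 :: nat)) = \<beta> [^] (3 :: nat) \<or>
    h (\<alpha> [^] (3 :: nat)) = \<beta> [^] (3 :: nat) \<and> h (\<beta> [^] (3 :: nat)) = \<alpha> [^] (3 :: nat)"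
proof -
  interpret h: subfield_embedding R M h by fact
  define A B where "A = \<alpha> [^] (3 :: nat)" and "B = \<beta> [^] (3 :: nat)"
  have car: "A \<in> carrier R" "B \<in> carrier R" "h A \<in> carrier R" "h B \<in> carrier R"
    using c h.hom_closed by (auto simp: A_def B_def)
  have "\<ominus> a \<in> K"
    using a_K subringE(5)[OF subfieldE(1)[OF subfield_K]] by simp
  then have s: "h A \<oplus> h B = A \<oplus> B"
    using h.hom_add[OF c] M(2) cubes_sum by (simp add: A_def B_def)
  have p: "h A \<otimes> h B = A \<otimes> B"
    using h.hom_mult[OF c] M(2) cubes_prod b_K by (simp add: A_def B_def)
  have "(h A \<ominus> A) \<otimes> (h A \<ominus> B) = h A \<otimes> ((h A \<oplus> h B) \<ominus> (A \<oplus> B)) \<ominus> (h A \<otimes> h B \<ominus> A \<otimes> B)"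
    using car
    by (elim section_atE) (simp only: section_at_simps, rule arg_cong[of _ _ "section_at R"],
        simp add: algebra_simps)
  then have "h A = A \<or> h A = B"
    using car by (simp add: s p integral_iff minus_eq r_neg[of "A \<oplus> B"] r_neg[of "A \<otimes> B"])
      (simp add: minus_eq[symmetric])
  moreover have "h B = B" if "h A = A"
    using s car that by simp
  moreover have "h B = A" if "h A = B"
    using s car that by (metis a_comm add.l_cancel)
  ultimately show ?thesis
    by (auto simp: A_def B_def)
qed

text \<open>If y \<notin> M, its minimal polynomial is X^3 - y^3 and \<open>y'\<close> is a root of
  the image polynomial. If y \<in> M, nothing has to be extended, which is why the conclusion
  prescribes no value at \<open>y\<close>.\<close>

lemma embedding_extends_to_cube_root:
  assumes "subfield_embedding R M h" and M: "K \<subseteq> M"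
    and y: "y \<in> carrier R" "y [^] (3 :: nat) \<in> M"
    and y': "y' \<in> carrier R" "y' [^] (3 :: nat) = h (y [^] (3 :: nat))"
  obtains M' h' where "subfield_embedding R M' h'" "M \<subseteq> M'" "y \<in> M'" "\<And>m. m \<in> M \<Longrightarrow> h' m = h m"
proof (cases "y \<in> M")
  case True
  then show thesis using that assms(1) by blast
next
  case False
  interpret h: subfield_embedding R M h by fact
  note irr = Irr_cube_root[OF h.subfield_dom M y False]
  have "eval [\<one>, \<zero>, \<zero>, \<ominus> w] y' = y' [^] (3 :: nat) \<ominus> w" if "w \<in> carrier R" for w
    using y'(1) that by (simp add: minus_eq numeral_3_eq_3)
  then have "eval (map h (Irr M y)) y' = \<zero>"
    using y' h.hom_closed[OF y(2)]
    by (simp only: irr(1) list.map h.hom_one h.hom_zero h.hom_a_inv[OF y(2)]) (simp add: r_neg minus_eq)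
  then obtain g where g: "subfield_embedding R (simple_extension M y) g" "\<And>m. m \<in> M \<Longrightarrow> g m = h m"
    using h.extends_to_simple_extension[OF y(1) irr(2) y'(1)] by metis
  then show thesis
    using that[OF g(1)] simple_extension_incl[OF h.dom_carrier y(1)]
      simple_extension_mem[OF h.subring_dom y(1)] by blast
qed

lemma embedding_extends_to_top:
  assumes h: "subfield_embedding R M h" and M: "K \<subseteq> M" "\<And>k. k \<in> K \<Longrightarrow> h k = k"
    and c: "\<alpha> [^] (3 :: nat) \<in> M" "\<beta> [^] (3 :: nat) \<in> M"
  obtains g where "g \<in> ring_hom R R" "\<And>m. m \<in> M \<Longrightarrow> g m = h m"
proof -
  note hc = embedding_cubes[OF h M c]
  \<comment> \<open>One of \<alpha> and \<beta>, since \<open>h\<close> permutes their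
    cubes.\<close>
  obtain x where x: "x \<in> carrier R" "x [^] (3 :: nat) = h (\<alpha> [^] (3 :: nat))"
    using hc alpha_closed beta_closed by metis
  obtain M1 h1 where M1: "subfield_embedding R M1 h1" "M \<subseteq> M1" "\<alpha> \<in> M1" "\<And>m. m \<in> M \<Longrightarrow> h1 m = h m"
    using embedding_extends_to_cube_root[OF h M(1) alpha_closed c(1) x]
    by metis
  obtain y where y: "y \<in> carrier R" "y [^] (3 :: nat) = h1 (\<beta> [^] (3 :: nat))"
    using hc alpha_closed beta_closed M1(4)[OF c(2)] by metis
  have KM1: "K \<subseteq> M1" and bM1: "\<beta> [^] (3 :: nat) \<in> M1"
    using M(1) M1(2) c(2) by auto
  obtain M2 h2 where M2: "subfield_embedding R M2 h2" "M1 \<subseteq> M2" "\<beta> \<in> M2" "\<And>m. m \<in> M1 \<Longrightarrow> h2 m = h1 m"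
    using embedding_extends_to_cube_root[OF M1(1) KM1 beta_closed bM1 y]
    by metis
  interpret h2: subfield_embedding R M2 h2 by fact
  have "M2 = carrier R"
    using generatedD[OF h2.subfield_dom] KM1 M2(2,3) M1(3) by auto
  then have "h2 \<in> ring_hom R R"
    using h2.hom by simp
  then show thesis
    using that[of h2] M1(2,4) M2(4) by (simp add: subset_iff)
qed

text \<open>The Galois property of \<open>F\<close> over every intermediate field. The tower
  \<open>E \<subseteq> E(\<delta>) \<subseteq> E(\<delta>, \<alpha>) \<subseteq> E(\<delta>, \<alpha>, \<beta>) = F\<close> consists of Kummer steps, and an element that is new
  at one step is moved by the conjugation of that step, which extends to \<open>F\<close>.\<close>

theorem moving_endomorphism:
  assumes E: "subfield E R" "K \<subseteq> E" and x: "x \<in> carrier R" "x \<notin> E"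
  shows "\<exists>g\<in>endomorphisms_fixing R E. g x \<noteq> x"
proof -
  let ?goal = "\<exists>g\<in>endomorphisms_fixing R E. g x \<noteq> x"
  \<comment> \<open>A conjugation at any level containing \<delta> suffices: the level then contains
    both cubes, so the map extends to the top.\<close>
  have lift: ?goal
    if asm: "subfield_embedding R M h" "E \<subseteq> M" "\<delta> \<in> M" "x \<in> M" "\<And>e. e \<in> E \<Longrightarrow> h e = e" "h x \<noteq> x" for M h
  proof -
    interpret h: subfield_embedding R M h by fact
    obtain g where "g \<in> ring_hom R R" "\<And>m. m \<in> M \<Longrightarrow> g m = h m"
      using embedding_extends_to_top[OF asm(1)] cubes_mem[OF h.subfield_dom] E(2) asm(2,3,5) by blast
    then show ?thesis
      using asm(2,4,5,6) by (intro bexI[of _ g]) (auto simp: endomorphisms_fixing_def)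
  qed
  have cube_step: ?goal if M: "subfield M R" "E \<subseteq> M" "\<delta> \<in> M" and y: "y \<in> carrier R" "y [^] (3 ::
    nat) \<in> M" "y \<notin> M"
    and xM: "x \<in> simple_extension M y" "x \<notin> M" for M y
  proof -
    have KM: "K \<subseteq> M" using E M by auto
    obtain g where g: "subfield_embedding R (simple_extension M y) g" "\<And>m. m \<in> M \<Longrightarrow> g m = m" "g x \<noteq> x"
      using cube_root_conjugation[OF M(1) KM y xM] by metis
    have "M \<subseteq> simple_extension M y"
      using simple_extension_incl[OF subfieldE(3)[OF M(1)] y(1)] .
    then show ?thesis
      using lift[OF g(1)] M xM g by blast
  qed
  note ER = subfieldE(3)[OF E(1)]
  have d2: "\<delta> [^] (2 :: nat) \<in> E"
    using delta_square_mem E(2) by auto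
  \<comment> \<open>Either \<open>x\<close> is new at this level, and the conjugation proves the
    goal, or it survives to the next level. The level is trivial if \<delta> already lies in
    \<open>E\<close>.\<close>
  obtain E1 where E1: "subfield E1 R" "E \<subseteq> E1" "\<delta> \<in> E1" "x \<notin> E1 \<or> ?goal"
  proof (cases "\<delta> \<in> E")
    case True
    then show thesis using that[of E] E x(2) by auto
  next
    case False
    note irr = Irr_square_root[OF E(1) delta_closed d2 False]
    have incl: "E \<subseteq> simple_extension E \<delta>" "\<delta> \<in> simple_extension E \<delta>"
      using simple_extension_incl[OF ER delta_closed] simple_extension_mem[OF subfieldE(1)[OF
        E(1)] delta_closed] by auto
    have ?goal if xE: "x \<in> simple_extension E \<delta>"
    proof -
      obtain g where g: "subfield_embedding R (simple_extension E \<delta>) g" "\<And>m. m \<in> E \<Longrightarrow> g m = m" "g x \<noteq> x"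
        using square_root_conjugation[OF two_neq_zero E(1) delta_closed d2 False xE x(2)] by metis
      then show ?thesis
        using lift[OF g(1) incl xE] g by blast
    qed
    then show thesis
      using that[OF _ incl] simple_extension_is_subfield[OF E(1) delta_closed] irr(2)
      by (auto simp: over_def)
  qed
  have KE1: "K \<subseteq> E1" using E E1 by auto
  note c1 = cubes_mem[OF E1(1) KE1 E1(3)]
  obtain E2 where E2: "subfield E2 R" "E1 \<subseteq> E2" "\<alpha> \<in> E2" "x \<notin> E2 \<or> ?goal"
  proof (cases "\<alpha> \<in> E1")
    case True
    then show thesis using that[of E1] E1 by auto
  next
    case False
    note irr = Irr_cube_root[OF E1(1) KE1 alpha_closed c1(1) False]
    have incl: "E1 \<subseteq> simple_extension E1 \<alpha>" "\<alpha> \<in> simple_extension E1 \<alpha>"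
      using simple_extension_incl[OF subfieldE(3)[OF E1(1)] alpha_closed]
        simple_extension_mem[OF subfieldE(1)[OF E1(1)] alpha_closed] by auto
    have "x \<notin> simple_extension E1 \<alpha> \<or> ?goal"
      using cube_step[OF E1(1-3) alpha_closed c1(1) False] E1(4) by blast
    then show thesis
      using that[OF _ incl] simple_extension_is_subfield[OF E1(1) alpha_closed] irr(2)
      by (auto simp: over_def)
  qed
  show ?thesis
  proof (rule ccontr)
    assume not: "\<not> ?goal"
    then have "x \<notin> E2" using E2 by simp
    have KE2: "K \<subseteq> E2" and c2: "\<beta> [^] (3 :: nat) \<in> E2" using KE1 E2 c1 by auto
    \<comment> \<open>Otherwise \<open>E2\<close> would contain all generators and hence
      \<open>x\<close>.\<close>
    have "\<beta> \<notin> E2"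
      using generatedD[OF E2(1) KE2 E2(3)] \<open>x \<notin> E2\<close> x(1) by auto
    note irr = Irr_cube_root[OF E2(1) KE2 beta_closed c2 this]
    have "simple_extension E2 \<beta> = carrier R"
      using generatedD[of "simple_extension E2 \<beta>"] simple_extension_is_subfield[OF E2(1)
        beta_closed] irr(2)
        simple_extension_incl[OF subfieldE(3)[OF E2(1)] beta_closed]
        simple_extension_mem[OF subfieldE(1)[OF E2(1)] beta_closed] KE2 E2(3)
      by (auto simp: over_def)
    then show False
      using cube_step[OF E2(1) _ _ beta_closed c2 \<open>\<beta> \<notin> E2\<close> _ \<open>x \<notin> E2\<close>] E1 E2 x(1) not by auto
  qed
qed

end


section \<open>Normal subextensions\<close>

lemma (in ring) a_inv_consistent:
  assumes "subring E R" "x \<in> E"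
  shows "\<ominus>\<^bsub>R\<lparr>carrier := E\<rparr>\<^esub> x = \<ominus> x"
proof -
  interpret E: ring "R\<lparr>carrier := E\<rparr>"
    using subring_is_ring[OF assms(1)] .
  show ?thesis
    using E.minus_equality[of "\<ominus> x" x] assms subringE(1,5)[OF assms(1)] l_neg by auto
qed

context field
begin

lemma endomorphism_embedding:
  "g \<in> ring_hom R R \<Longrightarrow> subfield_embedding R (carrier R) g"
  using carrier_is_subfield
  by (intro subfield_embedding.intro subfield_embedding_axioms.intro field_axioms) simp_all

lemma pdivides_consistent:
  assumes E: "subfield E R" and p: "p \<in> carrier (E[X])" "q \<in> carrier (E[X])"
  shows "p pdivides\<^bsub>R\<lparr>carrier := E\<rparr>\<^esub> q \<longleftrightarrow> p pdivides q"
  using pdivides_iff_shell[OF E p] univ_poly_consistent[OF subfieldE(1)[OF E]]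
  by (simp add: pdivides_def)

text \<open>The minimal polynomial of \<open>y\<close> over \<open>E\<close> is an irreducible
  factor of a split polynomial, hence linear, which forces y \<in> E.\<close>

lemma splitted_imp_root_mem:
  assumes E: "subfield E R" and p: "p \<in> carrier (E[X])" "p \<noteq> []"
    and split: "ring.splitted (R\<lparr>carrier := E\<rparr>) p"
    and y: "y \<in> carrier R" "eval p y = \<zero>"
  shows "y \<in> E"
proof (rule ccontr)
  assume "y \<notin> E"
  interpret E: field "R\<lparr>carrier := E\<rparr>"
    using subfield_iff(2)[OF E] .
  note cons = univ_poly_consistent[OF subfieldE(1)[OF E]]
  have alg: "(algebraic over E) y"
    using algebraicI[OF p y(2)] .
  note I = IrrE[OF E y(1) alg]
  have "Irr E y pdivides\<^bsub>R\<lparr>carrier := E\<rparr>\<^esub> p"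
    using Irr_minimal[OF E y(1) alg p(1) y(2)] pdivides_consistent[OF E I(1) p(1)] by simp
  then have "degree (Irr E y) = 1"
    using E.splitted_imp_trivial_factors[of p "Irr E y"] p split I by (simp add: cons)
  then show False
    using degree_Irr_ge_2[OF E y(1) alg \<open>y \<notin> E\<close>] by simp
qed

text \<open>The map fixes the coefficients of the minimal polynomial of \<open>x\<close> over
  \<open>K\<close>, so g x is another root of it, and by normality all its roots lie in
  \<open>E\<close>.\<close>

lemma normal_imp_invariant:
  assumes K: "subfield K R" and E: "subfield E R" "K \<subseteq> E" "normal_extension R K E"
    and x: "x \<in> E" and g: "g \<in> endomorphisms_fixing R K"
  shows "g x \<in> E"
proof -
  interpret g: subfield_embedding R "carrier R" g
    using endomorphism_embedding g by (simp add: endomorphisms_fixing_def)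
  have xR: "x \<in> carrier R"
    using x subfieldE(3)[OF E(1)] by auto
  have alg: "(algebraic over K) x"
    using E(3) x by (simp add: normal_extension_def over_def)
  note I = IrrE[OF K xR alg]
  have IE: "Irr K x \<in> carrier (E[X])"
    using I(1) E(2) unfolding sym[OF univ_poly_carrier] polynomial_def by auto
  have IR: "Irr K x \<in> carrier (poly_ring R)"
    using I(1) carrier_polynomial_shell[OF subfieldE(1)[OF K]] by auto
  have "Irr K x \<noteq> []"
    using pirreducibleE(1)[OF subfieldE(1)[OF K] I(1,2)] .
  have "ring.splitted (R\<lparr>carrier := E\<rparr>) (Irr K x)"
    using E(3) x I unfolding normal_extension_def by blast
  moreover have "map g (Irr K x) = Irr K x"
    using I(1) g unfolding sym[OF univ_poly_carrier] polynomial_def endomorphisms_fixing_def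
    by (auto intro!: map_idI)
  then have "eval (Irr K x) (g x) = \<zero>"
    using g.hom_eval[OF IR xR] I(4) g.hom_zero by simp
  ultimately show ?thesis
    using splitted_imp_root_mem[OF E(1) IE \<open>Irr K x \<noteq> []\<close>] g.hom_closed[OF xR] by simp
qed

text \<open>The minimal polynomial of \<open>x\<close> divides the product of \<open>X - y\<close> over the conjugates \<open>y\<close> of \<open>x\<close>,
  whose coefficients are fixed by all endomorphisms.\<close>

lemma invariant_imp_normal:
  assumes K: "subfield K R" and E: "subfield E R" "K \<subseteq> E"
    and alg: "\<And>x. x \<in> E \<Longrightarrow> (algebraic over K) x"
    and fixed: "\<And>x. \<lbrakk>x \<in> carrier R; \<And>g. g \<in> endomorphisms_fixing R K \<Longrightarrow> g x = x\<rbrakk> \<Longrightarrow> x \<in> K"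
    and invar: "\<And>x g. \<lbrakk>x \<in> E; g \<in> endomorphisms_fixing R K\<rbrakk> \<Longrightarrow> g x \<in> E"
  shows "normal_extension R K E"
  unfolding normal_extension_def
proof (intro conjI ballI impI)
  show "\<And>x. x \<in> E \<Longrightarrow> algebraic K x"
    using alg by (simp add: over_def)
next
  fix p assume p: "p \<in> carrier (K[X])" "pirreducible K p \<and> (\<exists>x\<in>E. eval p x = \<zero>)"
  then obtain x where x: "x \<in> E" "eval p x = \<zero>" by blast
  let ?G = "endomorphisms_fixing R K"
  note ER = subfieldE(3)[OF E(1)] and subrE = subfieldE(1)[OF E(1)]
  have xR: "x \<in> carrier R" using x ER by auto
  interpret P: domain "poly_ring R"
    using univ_poly_is_domain[OF carrier_is_subring] .
  interpret E: field "R\<lparr>carrier := E\<rparr>"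
    using subfield_iff(2)[OF E(1)] .
  note cons = univ_poly_consistent[OF subrE]
  interpret PE: domain "E[X]"
    using univ_poly_is_domain[OF subrE] .
  have pR: "p \<in> carrier (poly_ring R)"
    using p(1) carrier_polynomial_shell[OF subfieldE(1)[OF K]] by auto
  have pn: "p \<noteq> []"
    using pirreducibleE(1)[OF subfieldE(1)[OF K] p(1)] p(2) by blast
  define C where "C = (\<lambda>g. g x) ` ?G"
  have CE: "C \<subseteq> E"
    using invar x(1) by (auto simp: C_def)
  have "is_root p y" if "y \<in> C" for y
  proof -
    from that obtain g where g: "g \<in> ?G" "y = g x" by (auto simp: C_def)
    interpret g: subfield_embedding R "carrier R" g
      using endomorphism_embedding g by (simp add: endomorphisms_fixing_def)
    have "map g p = p"
      using p(1) g(1) unfolding sym[OF univ_poly_carrier] polynomial_def endomorphisms_fixing_def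
      by (auto intro!: map_idI)
    then show ?thesis
      using g.hom_eval[OF pR xR] x(2) g.hom_zero g.hom_closed[OF xR] pn g(2) by (simp add: is_root_def)
  qed
  \<comment> \<open>All conjugates of \<open>x\<close> are roots of \<open>p\<close>.\<close>
  then have finC: "finite C"
    using finite_number_of_roots[OF pR] by (meson finite_subset mem_Collect_eq subsetI)
  have "(\<lambda>z. z) \<in> ?G"
    by (auto simp: endomorphisms_fixing_def intro: ring_hom_memI)
  then have xC: "x \<in> C"
    by (force simp: C_def)
  have lin: "[\<one>, \<ominus> y] \<in> carrier (E[X])" if "y \<in> E" for y
    using that subringE(3,5)[OF subrE] unfolding sym[OF univ_poly_carrier] polynomial_def by auto
  have linR: "[\<one>, \<ominus> y] \<in> carrier (poly_ring R)" if "y \<in> E" for y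
    using lin[OF that] carrier_polynomial_shell[OF subrE] by auto
  define q where "q = finprod (poly_ring R) (\<lambda>y. [\<one>, \<ominus> y]) C"
  have q: "q \<in> carrier (E[X]) \<and> q \<noteq> [] \<and> ring.splitted (R\<lparr>carrier := E\<rparr>) q \<and>
      (\<forall>y\<in>C. eval q y = \<zero>)"
    unfolding q_def using finC CE
  proof (induction C)
    case empty
    have one: "[\<one>] \<in> carrier (E[X])"
      using PE.one_closed by (simp add: univ_poly_one)
    then show ?case
      using E.degree_zero_imp_splitted[of "[\<one>]"] by (simp add: univ_poly_one cons)
  next
    case (insert y C)
    let ?q = "finprod (poly_ring R) (\<lambda>y. [\<one>, \<ominus> y]) C"
    have IH: "?q \<in> carrier (E[X])" "?q \<noteq> []" "ring.splitted (R\<lparr>carrier := E\<rparr>) ?q"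
        "\<And>z. z \<in> C \<Longrightarrow> eval ?q z = \<zero>" and y: "y \<in> E" and C: "C \<subseteq> E"
      using insert by auto
    have qR: "?q \<in> carrier (poly_ring R)"
      using IH(1) carrier_polynomial_shell[OF subrE] by auto
    have "finprod (poly_ring R) (\<lambda>y. [\<one>, \<ominus> y]) (insert y C) = [\<one>, \<ominus> y] \<otimes>\<^bsub>poly_ring R\<^esub> ?q"
      using insert linR by (intro P.finprod_insert) auto
    also have eq: "\<dots> = [\<one>, \<ominus> y] \<otimes>\<^bsub>E[X]\<^esub> ?q"
      by (simp add: univ_poly_mult)
    finally have step: "finprod (poly_ring R) (\<lambda>y. [\<one>, \<ominus> y]) (insert y C) = [\<one>, \<ominus> y] \<otimes>\<^bsub>E[X]\<^esub> ?q" .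
    have closed: "[\<one>, \<ominus> y] \<otimes>\<^bsub>E[X]\<^esub> ?q \<in> carrier (E[X])"
      using lin[OF y] IH(1) by simp
    have "[\<one>, \<ominus> y] \<otimes>\<^bsub>E[X]\<^esub> ?q \<noteq> []"
      using PE.integral_iff[OF lin[OF y] IH(1)] IH(2) by (simp add: univ_poly_zero)
    moreover have "ring.splitted (R\<lparr>carrier := E\<rparr>) ([\<one>, \<ominus> y] \<otimes>\<^bsub>E[X]\<^esub> ?q)"
    proof -
      \<comment> \<open>Each factor X - y adds one root, counted with multiplicity, and one to the
        degree, so the two numbers stay equal.\<close>
      have "E.roots ([\<one>, \<ominus> y] \<otimes>\<^bsub>E[X]\<^esub> ?q) = add_mset y (E.roots ?q)"
        using E.poly_mult_degree_one_monic_imp_same_roots[of y ?q] y IH(1,2)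
        by (simp add: cons a_inv_consistent[OF subrE])
      moreover have "degree ([\<one>, \<ominus> y] \<otimes>\<^bsub>E[X]\<^esub> ?q) = Suc (degree ?q)"
        using poly_mult_degree_eq[OF subrE, of "[\<one>, \<ominus> y]" ?q] lin[OF y] IH(1,2)
        by (simp add: univ_poly_mult univ_poly_carrier)
      ultimately show ?thesis
        using IH(3) by (simp add: E.splitted_def)
    qed
    moreover have "eval ([\<one>, \<ominus> y] \<otimes>\<^bsub>E[X]\<^esub> ?q) z = \<zero>" if "z \<in> insert y C" for z
    proof -
      have z: "z \<in> carrier R" "y \<in> carrier R"
        using that y C ER by auto
      have "eval ([\<one>, \<ominus> y] \<otimes>\<^bsub>E[X]\<^esub> ?q) z = eval [\<one>, \<ominus> y] z \<otimes> eval ?q z"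
        using ring_hom_memE(2)[OF eval_is_hom[OF carrier_is_subring z(1)] linR[OF y] qR]
        by (simp add: eq[symmetric])
      moreover have "eval [\<one>, \<ominus> y] z = z \<oplus> \<ominus> y"
        using z by simp
      moreover have "eval ?q z \<in> carrier R"
        using ring_hom_memE(1)[OF eval_is_hom[OF carrier_is_subring z(1)] qR] .
      ultimately show ?thesis
        using that z IH(4)[of z] by (cases "z = y") (auto simp: r_neg)
    qed
    ultimately show ?case
      unfolding step using closed by blast
  qed
  then have qR: "q \<in> carrier (poly_ring R)"
    using carrier_polynomial_shell[OF subrE] by auto
  have "map g q = q" if g: "g \<in> ?G" for g
  proof -
    interpret g: subfield_embedding R "carrier R" g
      using endomorphism_embedding g by (simp add: endomorphisms_fixing_def)
    have "map g \<in> ring_hom (poly_ring R) (poly_ring R)"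
      using g.map_hom .
    then interpret mg: ring_hom_cring "poly_ring R" "poly_ring R" "map g"
      by unfold_locales
    have CR: "C \<subseteq> carrier R" using CE ER by auto
    have injC: "inj_on g C"
      using g.inj CR inj_on_subset by blast
    \<comment> \<open>Composition maps conjugates to conjugates. An injective self-map of a finite
      set permutes it, so the factors of \<open>q\<close> are permuted and its coefficients are
      fixed.\<close>
    have "g ` C \<subseteq> C"
    proof
      fix z assume "z \<in> g ` C"
      then obtain h where h: "h \<in> ?G" "z = g (h x)" by (auto simp: C_def)
      then have "(\<lambda>u. g (h u)) \<in> ?G"
        using g by (auto simp: endomorphisms_fixing_def ring_hom_def Pi_def)
      then show "z \<in> C"
        unfolding C_def h(2) by (rule rev_image_eqI) simp
    qed
    then have gC: "g ` C = C"
      using finC injC by (simp add: endo_inj_surj)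
    have linC: "[\<one>, \<ominus> g y] \<in> carrier (poly_ring R)" if "y \<in> C" for y
      using linR[of "g y"] CE imageI[OF that, of g] unfolding gC by auto
    have "map g q = finprod (poly_ring R) (map g \<circ> (\<lambda>y. [\<one>, \<ominus> y])) C"
      unfolding q_def using linR CE by (intro mg.hom_finprod) auto
    also have "\<dots> = finprod (poly_ring R) (\<lambda>y. [\<one>, \<ominus> g y]) C"
      using CR linC by (intro P.finprod_cong') (auto simp: g.hom_one g.hom_a_inv)
    also have "\<dots> = finprod (poly_ring R) (\<lambda>y. [\<one>, \<ominus> y]) (g ` C)"
      using linR CE gC injC by (intro P.finprod_reindex[symmetric]) auto
    finally show ?thesis
      by (simp add: gC q_def)
  qed
  then have inv: "\<And>g. g \<in> ?G \<Longrightarrow> map g q = q" .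
  have "set q \<subseteq> K"
  proof
    fix u assume u: "u \<in> set q"
    then have "u \<in> carrier R"
      using qR unfolding sym[OF univ_poly_carrier] polynomial_def by auto
    moreover have "g u = u" if "g \<in> ?G" for g
      using inv[OF that] u by (metis list.map_ident map_eq_conv)
    ultimately show "u \<in> K"
      by (rule fixed)
  qed
  then have qK: "q \<in> carrier (K[X])"
    using q unfolding sym[OF univ_poly_carrier] polynomial_def by auto
  have algx: "(algebraic over K) x"
    using alg x(1) .
  note I = IrrE[OF K xR algx]
  interpret PK: domain "K[X]"
    using univ_poly_is_domain[OF subfieldE(1)[OF K]] .
  have "Irr K x divides\<^bsub>K[X]\<^esub> p" "Irr K x divides\<^bsub>K[X]\<^esub> q"
    using Irr_minimal[OF K xR algx] p(1) x(2) qK q xC pdivides_iff_shell[OF K I(1)] by auto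
  \<comment> \<open>The polynomial \<open>p\<close> need not be monic, but it is irreducible with
    root \<open>x\<close> and thus associated to the minimal polynomial; this transfers divisibility
    of \<open>q\<close> to \<open>p\<close>.\<close>
  moreover have "p divides\<^bsub>K[X]\<^esub> Irr K x"
    using divides_pirreducible_condition[OF _ I(1) calculation(1)] p(2) pirreducibleE(2)[OF
      subfieldE(1)[OF K] I(1,2)]
    by (auto simp: associated_def)
  ultimately have "p divides\<^bsub>K[X]\<^esub> q"
    using PK.divides_trans p(1) by blast
  then have "p pdivides q"
    using pdivides_iff_shell[OF K p(1) qK] by simp
  moreover have pE: "p \<in> carrier (E[X])"
    using p(1) E(2) unfolding sym[OF univ_poly_carrier] polynomial_def by auto
  ultimately have "p pdivides\<^bsub>R\<lparr>carrier := E\<rparr>\<^esub> q"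
    using pdivides_consistent[OF E(1) pE] q by simp
  then show "E.splitted p"
    using E.pdivides_imp_splitted[of p q] q pE by (simp add: cons)
qed

end


section \<open>Codes of automorphisms\<close>

text \<open>The code \<open>(s, i, j)\<close>, with \<open>i\<close> and \<open>j\<close> in \<open>\<int>/3\<close>, stands for \<open>\<alpha> \<mapsto> \<zeta>\<^sup>i \<alpha>, \<beta> \<mapsto> \<zeta>\<^sup>j \<beta>\<close> if \<open>s\<close> is
  false and for \<open>\<alpha> \<mapsto> \<zeta>\<^sup>i \<beta>, \<beta> \<mapsto> \<zeta>\<^sup>j \<alpha>\<close> if \<open>s\<close> is true. The codes form a group isomorphic to
  \<open>C\<^sub>3 \<times> S\<^sub>3\<close>; \<open>fix_root k\<close> is the stabilizer of the root \<open>\<alpha>\<beta>(\<alpha>\<zeta>\<^sup>k + \<beta>\<zeta>\<^sup>2\<^sup>k)\<close> of the resolvent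
  \<open>x\<^sup>3 - 3bx + ab\<close>.\<close>

datatype tri = T0 | T1 | T2

fun tadd :: "tri \<Rightarrow> tri \<Rightarrow> tri" where
  "tadd T0 j = j"
| "tadd T1 j = (case j of T0 \<Rightarrow> T1 | T1 \<Rightarrow> T2 | T2 \<Rightarrow> T0)"
| "tadd T2 j = (case j of T0 \<Rightarrow> T2 | T1 \<Rightarrow> T0 | T2 \<Rightarrow> T1)"

type_synonym code = "bool \<times> tri \<times> tri"

fun code_mult :: "code \<Rightarrow> code \<Rightarrow> code" where
  "code_mult (s, i, j) (s', i', j') =
    (s \<noteq> s', tadd (if s' then j else i) i', tadd (if s' then i else j) j')"

text \<open>Inverses come for free: in a finite group a product-closed set with identity is a
  subgroup.\<close>

definition code_subgroup :: "code set \<Rightarrow> bool" where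
  "code_subgroup H \<longleftrightarrow> (False, T0, T0) \<in> H \<and> (\<forall>x\<in>H. \<forall>y\<in>H. code_mult x y \<in> H)"

fun fix_delta :: "code \<Rightarrow> bool" where "fix_delta (s, i, j) \<longleftrightarrow> \<not> s"
fun fix_gamma :: "code \<Rightarrow> bool" where "fix_gamma (s, i, j) \<longleftrightarrow> tadd i j = T0"
fun fix_root :: "tri \<Rightarrow> code \<Rightarrow> bool" where
  "fix_root k (s, i, j) \<longleftrightarrow> j = (if s then tadd i k else i)"
fun fix_alpha :: "code \<Rightarrow> bool" where "fix_alpha (s, i, j) \<longleftrightarrow> \<not> s \<and> i = T0"
fun fix_beta :: "code \<Rightarrow> bool" where "fix_beta (s, i, j) \<longleftrightarrow> \<not> s \<and> j = T0"

lemma all_tri: "(\<forall>i. P i) \<longleftrightarrow> P T0 \<and> P T1 \<and> P T2"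
  by (metis tri.exhaust)

text \<open>The codes without swap form the plane \<int>/3 x \<int>/3, whose subgroups are the
  plane, four lines and zero: six subgroups. If \<open>H\<close> contains a swap (k, l), it consists
  of its swap-free part and one coset. That part is symmetric and contains (k + l, k + l), so the
  axes drop out. The plane gives 1 subgroup, the diagonal 3, the antidiagonal 1 and zero 3, which
  makes 14 in total.\<close>

lemma code_subgroup_cases:
  assumes "code_subgroup H"
  shows "H \<in> {UNIV, {x. fix_delta x}, {x. fix_gamma x}, {x. fix_root T0 x}, {x. fix_root T1 x},
    {x. fix_root T2 x},
    {x. fix_delta x \<and> fix_root T0 x}, {x. fix_delta x \<and> fix_gamma x}, {x. fix_alpha x}, {x. fix_beta x},
    {x. fix_gamma x \<and> fix_root T0 x}, {x. fix_gamma x \<and> fix_root T1 x}, {x. fix_gamma x \<and> fix_root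
      T2 x},
    {x. fix_alpha x \<and> fix_beta x}}"
proof -
  define p where "p i j \<longleftrightarrow> (False, i, j) \<in> H" for i j
  define q where "q i j \<longleftrightarrow> (True, i, j) \<in> H" for i j
  have mult: "\<And>x y. x \<in> H \<Longrightarrow> y \<in> H \<Longrightarrow> code_mult x y \<in> H" and p0: "p T0 T0"
    using assms by (auto simp: code_subgroup_def p_def)
  have pp: "p (tadd i i') (tadd j j')" if "p i j" "p i' j'" for i j i' j'
    using mult[of "(False, i, j)" "(False, i', j')"] that by (simp add: p_def)
  have pq: "q (tadd j i') (tadd i j')" if "p i j" "q i' j'" for i j i' j'
    using mult[of "(False, i, j)" "(True, i', j')"] that by (simp add: p_def q_def)
  have qp: "q (tadd i i') (tadd j j')" if "q i j" "p i' j'" for i j i' j'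
    using mult[of "(True, i, j)" "(False, i', j')"] that by (simp add: p_def q_def)
  have qq: "p (tadd j i') (tadd i j')" if "q i j" "q i' j'" for i j i' j'
    using mult[of "(True, i, j)" "(True, i', j')"] that by (simp add: p_def q_def)
  \<comment> \<open>Doubling is negation in \<int>/3, so one of its two nonzero vectors decides
    whether a line lies in \<open>H\<close>.\<close>
  have dbl: "p T2 T0 = p T1 T0" "p T0 T2 = p T0 T1" "p T2 T2 = p T1 T1" "p T2 T1 = p T1 T2"
    using pp[of T1 T0 T1 T0] pp[of T2 T0 T2 T0] pp[of T0 T1 T0 T1] pp[of T0 T2 T0 T2]
      pp[of T1 T1 T1 T1] pp[of T2 T2 T2 T2] pp[of T1 T2 T1 T2] pp[of T2 T1 T2 T1] by auto
  \<comment> \<open>Two distinct lines generate the plane.\<close>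
  have span: "p T1 T0 \<and> p T0 T1 \<longrightarrow> p T1 T1 \<and> p T1 T2" "p T1 T0 \<and> p T1 T1 \<longrightarrow> p T0 T1"
    "p T1 T0 \<and> p T1 T2 \<longrightarrow> p T0 T1" "p T0 T1 \<and> p T1 T1 \<longrightarrow> p T1 T0"
    "p T0 T1 \<and> p T1 T2 \<longrightarrow> p T1 T0" "p T1 T1 \<and> p T1 T2 \<longrightarrow> p T1 T0"
    using pp[of T1 T0 T0 T1, unfolded tadd.simps tri.case dbl]
      pp[of T1 T0 T0 T2, unfolded tadd.simps tri.case dbl]
      pp[of T2 T0 T1 T1, unfolded tadd.simps tri.case dbl]
      pp[of T2 T0 T1 T2, unfolded tadd.simps tri.case dbl]
      pp[of T0 T2 T1 T1, unfolded tadd.simps tri.case dbl]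
      pp[of T0 T1 T1 T2, unfolded tadd.simps tri.case dbl]
      pp[of T1 T1 T1 T2, unfolded tadd.simps tri.case dbl]
    by blast+
  then consider
      "p T1 T0 \<and> p T0 T1 \<and> p T1 T1 \<and> p T1 T2"
    | "p T1 T0 \<and> \<not> p T0 T1 \<and> \<not> p T1 T1 \<and> \<not> p T1 T2"
    | "\<not> p T1 T0 \<and> p T0 T1 \<and> \<not> p T1 T1 \<and> \<not> p T1 T2"
    | "\<not> p T1 T0 \<and> \<not> p T0 T1 \<and> p T1 T1 \<and> \<not> p T1 T2"
    | "\<not> p T1 T0 \<and> \<not> p T0 T1 \<and> \<not> p T1 T1 \<and> p T1 T2"
    | "\<not> p T1 T0 \<and> \<not> p T0 T1 \<and> \<not> p T1 T1 \<and> \<not> p T1 T2"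
    by blast
  note p_cases = this
  note defs = set_eq_iff all_tri split_paired_All all_bool_eq p_def[symmetric] q_def[symmetric] dbl p0
  show ?thesis
  proof (cases "\<exists>i j. q i j")
    case False
    then have "\<And>i j. \<not> q i j"
      by auto
    with p_cases show ?thesis
      by cases (simp_all add: defs)
  next
    case True
    then obtain k l where kl: "q k l"
      by blast
    \<comment> \<open>The inverse of the swap (k, l), obtained as its fifth power.\<close>
    have kl2: "q (tadd l l) (tadd k k)"
      using qp[OF qp[OF kl qq[OF kl kl]] qq[OF kl kl]] by (cases k; cases l) simp_all
    \<comment> \<open>Multiplication by that inverse carries the swaps in \<open>H\<close> to its
      swap-free part.\<close>
    have coset: "q i j \<longleftrightarrow> p (tadd j (tadd l l)) (tadd i (tadd k k))" for i j
    proof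
      assume "p (tadd j (tadd l l)) (tadd i (tadd k k))"
      from pq[OF this kl] show "q i j"
        by (cases i; cases j; cases k; cases l) simp_all
    next
      assume "q i j"
      from qq[OF this kl2] show "p (tadd j (tadd l l)) (tadd i (tadd k k))" .
    qed
    have sq: "p (tadd k l) (tadd k l)"
      using qq[OF kl kl] by (cases k; cases l) simp_all
    have conj: "p j i" if "p i j" for i j
      using qq[OF qp[OF kl that] kl2] by (cases i; cases j; cases k; cases l) simp_all
    have sym: "p T0 T1 \<longleftrightarrow> p T1 T0"
      using conj by blast
    \<comment> \<open>Conjugation by the swap exchanges the two axes, so neither axis alone can be
      the swap-free part.\<close>
    have lines: "(p T1 T0 \<and> p T1 T1 \<and> p T1 T2) \<or> (\<not> p T1 T0 \<and> p T1 T1 \<and> \<not> p T1 T2) \<or>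
        (\<not> p T1 T0 \<and> \<not> p T1 T1 \<and> p T1 T2) \<or> (\<not> p T1 T0 \<and> \<not> p T1 T1 \<and> \<not> p T1 T2)"
      using span sym by blast
    note q_eqs = coset[of T0 T0] coset[of T0 T1] coset[of T0 T2] coset[of T1 T0] coset[of T1 T1]
      coset[of T1 T2] coset[of T2 T0] coset[of T2 T1] coset[of T2 T2]
    show ?thesis
      by (simp add: defs)
        (insert q_eqs sq sym, (cases k; cases l; simp only: tadd.simps tri.case dbl p0 simp_thms),
          (insert lines, (elim disjE conjE; simp)+)+)
  qed
qed


section \<open>Stabilizers as sets of codes, and the Galois correspondence\<close>

context cubic_pair
begin

definition zeta_pow :: "tri \<Rightarrow> 'a" where
  "zeta_pow i = (case i of T0 \<Rightarrow> \<one> | T1 \<Rightarrow> \<zeta> | T2 \<Rightarrow> \<zeta> [^] (2 :: nat))"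

lemma zeta_pow_simps: "zeta_pow T0 = \<one>" "zeta_pow T1 = \<zeta>" "zeta_pow T2 = \<zeta> [^] (2 :: nat)"
  by (simp_all add: zeta_pow_def)

lemma zeta_pow_closed [simp]: "zeta_pow i \<in> carrier R"
  by (cases i) (simp_all add: zeta_pow_def)

lemma zeta_pow_mem: "zeta_pow i \<in> K"
  using zeta_K subringE(3,6)[OF subfieldE(1)[OF subfield_K]]
  by (cases i) (simp_all add: zeta_pow_def numeral_2_eq_2)

lemma zeta_pow_tadd: "zeta_pow (tadd i j) = zeta_pow i \<otimes> zeta_pow j"
proof -
  have "\<zeta> \<otimes> \<zeta> = \<zeta> [^] (2 :: nat)" "\<zeta> [^] (2 :: nat) \<otimes> \<zeta> = \<one>" "\<zeta> \<otimes> \<zeta> [^] (2 :: nat) = \<one>"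
      "\<zeta> [^] (2 :: nat) \<otimes> \<zeta> [^] (2 :: nat) = \<zeta>"
    using zeta_cube by (simp_all add: numeral_2_eq_2 numeral_3_eq_3 m_assoc)
  then show ?thesis
    by (cases i; cases j) (simp_all add: zeta_pow_def)
qed

lemma zeta_pow_eq_one_iff: "zeta_pow i = \<one> \<longleftrightarrow> i = T0"
  using zeta_neq_one by (cases i) (simp_all add: zeta_pow_def)

lemma zeta_pow_cube: "zeta_pow i [^] (3 :: nat) = \<one>"
proof -
  have "zeta_pow (tadd i (tadd i i)) = \<one>"
    by (cases i) (simp_all add: zeta_pow_def)
  then show ?thesis
    by (simp add: zeta_pow_tadd numeral_3_eq_3 m_assoc)
qed

lemma zeta_pow_mult_cube:
  "x \<in> carrier R \<Longrightarrow> (zeta_pow i \<otimes> x) [^] (3 :: nat) = x [^] (3 :: nat)"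
  by (simp add: nat_pow_distrib zeta_pow_cube)

lemma zeta_pow_mult_eq_self_iff:
  assumes "x \<in> carrier R" "x \<noteq> \<zero>"
  shows "zeta_pow i \<otimes> x = x \<longleftrightarrow> i = T0"
  using assms m_rcancel[of x "zeta_pow i" \<one>] by (simp add: zeta_pow_eq_one_iff)

abbreviation "endos \<equiv> endomorphisms_fixing R"

fun acts :: "('a \<Rightarrow> 'a) \<Rightarrow> code \<Rightarrow> bool" where
  "acts g (s, i, j) \<longleftrightarrow> g \<alpha> = zeta_pow i \<otimes> (if s then \<beta> else \<alpha>) \<and> g \<beta> = zeta_pow j \<otimes> (if s then \<alpha> else \<beta>)"

definition codes :: "'a set \<Rightarrow> code set" where
  "codes E = {x. \<exists>g\<in>endos E. acts g x}"

lemma endos_embedding: "g \<in> endos E \<Longrightarrow> subfield_embedding R (carrier R) g"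
  using endomorphism_embedding by (simp add: endomorphisms_fixing_def)

lemma endos_fix: "\<lbrakk>g \<in> endos E; x \<in> E\<rbrakk> \<Longrightarrow> g x = x"
  by (simp add: endomorphisms_fixing_def)

lemma endos_mono: "E \<subseteq> E' \<Longrightarrow> endos E' \<subseteq> endos E"
  by (auto simp: endomorphisms_fixing_def)

lemma codes_mono: "E \<subseteq> E' \<Longrightarrow> codes E' \<subseteq> codes E"
  using endos_mono unfolding codes_def by blast

lemma endos_comp: "\<lbrakk>g \<in> endos E; h \<in> endos E\<rbrakk> \<Longrightarrow> (\<lambda>x. g (h x)) \<in> endos E"
  by (auto simp: endomorphisms_fixing_def ring_hom_def Pi_def)

lemma endos_id: "(\<lambda>x. x) \<in> endos E"
  by (auto simp: endomorphisms_fixing_def intro: ring_hom_memI)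

lemma acts_exists:
  assumes g: "g \<in> endos K"
  obtains x where "acts g x"
proof -
  interpret g: subfield_embedding R "carrier R" g
    using endos_embedding[OF g] .
  have gc: "g \<alpha> \<in> carrier R" "g \<beta> \<in> carrier R"
    by (simp_all add: g.hom_closed)
  have root: "\<exists>i. u = zeta_pow i \<otimes> v"
    if "u \<in> carrier R" "v \<in> carrier R" "u [^] (3 :: nat) = v [^] (3 :: nat)" for u v
    using cube_eq_cases[OF that] that(2) zeta_pow_simps by (metis l_one)
  have "g \<alpha> [^] (3 :: nat) = \<alpha> [^] (3 :: nat) \<and> g \<beta> [^] (3 :: nat) = \<beta> [^] (3 :: nat) \<or>
      g \<alpha> [^] (3 :: nat) = \<beta> [^] (3 :: nat) \<and> g \<beta> [^] (3 :: nat) = \<alpha> [^] (3 :: nat)"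
    using embedding_cubes[OF g.subfield_embedding_axioms K_carrier endos_fix[OF g]]
    by (simp add: g.hom_pow)
  then consider i j where "g \<alpha> = zeta_pow i \<otimes> \<alpha>" "g \<beta> = zeta_pow j \<otimes> \<beta>"
    | i j where "g \<alpha> = zeta_pow i \<otimes> \<beta>" "g \<beta> = zeta_pow j \<otimes> \<alpha>"
    using root gc alpha_closed beta_closed by metis
  then show thesis
  proof cases
    case (1 i j)
    then show ?thesis using that[of "(False, i, j)"] by simp
  next
    case (2 i j)
    then show ?thesis using that[of "(True, i, j)"] by simp
  qed
qed

lemma zeta_pow_alpha_neq_beta:
  "zeta_pow i \<otimes> \<alpha> \<noteq> zeta_pow j \<otimes> \<beta>" "zeta_pow j \<otimes> \<beta> \<noteq> zeta_pow i \<otimes> \<alpha>"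
  using cubes_neq zeta_pow_mult_cube[of \<alpha> i] zeta_pow_mult_cube[of \<beta> j] by auto

text \<open>Reduces equality of endomorphisms to the generators \<alpha> and \<beta>; with the
  identity as second map it reduces fixing an adjunction to fixing the adjoined elements.\<close>

lemma subfield_equalizer:
  assumes g: "g \<in> endos K" and h: "h \<in> endos K"
  shows "subfield {x \<in> carrier R. g x = h x} R"
proof (rule subfieldI')
  interpret g: subfield_embedding R "carrier R" g
    using endos_embedding[OF g] .
  interpret h: subfield_embedding R "carrier R" h
    using endos_embedding[OF h] .
  show "subring {x \<in> carrier R. g x = h x} R"
    by (rule subringI)
      (auto simp: g.hom_one h.hom_one g.hom_add h.hom_add g.hom_mult h.hom_mult g.hom_a_inv h.hom_a_inv)
  show "inv k \<in> {x \<in> carrier R. g x = h x}" if k: "k \<in> {x \<in> carrier R. g x = h x} - {\<zero>}" for k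
  proof -
    have kc: "k \<in> carrier R" "k \<noteq> \<zero>" "g k = h k" using k by auto
    have ik: "inv k \<in> carrier R" "inv k \<otimes> k = \<one>"
      using kc field_Units by auto
    have "g (inv k) \<otimes> g k = \<one>" "h (inv k) \<otimes> h k = \<one>"
      by (simp_all add: g.hom_mult[OF ik(1) kc(1), symmetric] h.hom_mult[OF ik(1) kc(1), symmetric]
          ik(2) g.hom_one h.hom_one)
    then have "g (inv k) \<otimes> g k = h (inv k) \<otimes> g k"
      by (simp add: kc(3))
    then have "g (inv k) = h (inv k)"
      using m_rcancel[of "g k"] kc ik g.hom_closed h.hom_closed h.hom_eq_zero_iff by simp
    then show ?thesis using ik by simp
  qed
qed

lemma endos_eqI:
  assumes g: "g \<in> endos K" "h \<in> endos K" and "acts g x" "acts h x" and y: "y \<in> carrier R"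
  shows "g y = h y"
proof -
  have "K \<subseteq> {y \<in> carrier R. g y = h y}"
    using endos_fix[OF g(1)] endos_fix[OF g(2)] K_carrier by auto
  then have "{y \<in> carrier R. g y = h y} = carrier R"
    using generatedD[OF subfield_equalizer[OF g]] assms(3,4) by (cases x) auto
  then show ?thesis using y by auto
qed

lemma endos_adjoin_iff:
  assumes g: "g \<in> endos K" and S: "S \<subseteq> carrier R"
  shows "g \<in> endos (adjoin R K S) \<longleftrightarrow> (\<forall>s\<in>S. g s = s)"
proof
  assume "g \<in> endos (adjoin R K S)"
  then show "\<forall>s\<in>S. g s = s"
    using adjoin_incl(2)[OF K_carrier S] by (auto simp: endomorphisms_fixing_def)
next
  assume s: "\<forall>s\<in>S. g s = s"
  have "adjoin R K S \<subseteq> {y \<in> carrier R. g y = y}"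
    using adjoin_minimal[OF K_carrier S subfield_equalizer[OF g endos_id]] K_carrier S s
      endos_fix[OF g] by auto
  then show "g \<in> endos (adjoin R K S)"
    using g by (auto simp: endomorphisms_fixing_def)
qed

lemma codes_adjoin:
  assumes S: "S \<subseteq> carrier R"
    and crit: "\<And>g x. \<lbrakk>g \<in> endos K; acts g x\<rbrakk> \<Longrightarrow> (\<forall>s\<in>S. g s = s) \<longleftrightarrow> P x"
  shows "codes (adjoin R K S) = {x \<in> codes K. P x}"
proof -
  have "endos (adjoin R K S) \<subseteq> endos K"
    using endos_mono[OF adjoin_incl(1)[OF K_carrier S]] .
  then show ?thesis
    using endos_adjoin_iff[OF _ S] crit unfolding codes_def by blast
qed

lemma endos_zeta_pow: "g \<in> endos K \<Longrightarrow> g (zeta_pow i) = zeta_pow i"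
  using endos_fix zeta_pow_mem by auto

lemma acts_comp:
  assumes g: "g \<in> endos K" "acts g x" and h: "acts h y"
  shows "acts (\<lambda>z. g (h z)) (code_mult x y)"
proof -
  interpret g: subfield_embedding R "carrier R" g
    using endos_embedding[OF g(1)] .
  show ?thesis
    using g(2) h endos_zeta_pow[OF g(1)]
    by (cases x; cases y) (auto simp: g.hom_mult zeta_pow_tadd m_ac)
qed

lemma code_subgroup_codes:
  assumes "K \<subseteq> E"
  shows "code_subgroup (codes E)"
  unfolding code_subgroup_def
proof (intro conjI ballI)
  show "(False, T0, T0) \<in> codes E"
    using endos_id[of E] by (force simp: codes_def zeta_pow_def)
next
  fix x y assume "x \<in> codes E" "y \<in> codes E"
  then obtain g h where g: "g \<in> endos E" "acts g x" and h: "h \<in> endos E" "acts h y"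
    by (auto simp: codes_def)
  then show "code_mult x y \<in> codes E"
    using endos_comp[OF g(1) h(1)] acts_comp[OF _ g(2) h(2)] endos_mono[OF assms]
    by (auto simp: codes_def)
qed

text \<open>An element of \<open>E\<close> outside \<open>E'\<close> is moved by some
  \<open>g\<close> over \<open>E'\<close>. If the code of \<open>g\<close> also came from a map over
  \<open>E\<close>, the two maps would agree, yet the latter fixes the element.\<close>

lemma codes_antimono_iff:
  assumes E: "subfield E R" "K \<subseteq> E" and E': "subfield E' R" "K \<subseteq> E'"
  shows "codes E' \<subseteq> codes E \<longleftrightarrow> E \<subseteq> E'"
proof
  assume sub: "codes E' \<subseteq> codes E"
  show "E \<subseteq> E'"
  proof (rule ccontr)
    assume "\<not> E \<subseteq> E'"
    then obtain y where y: "y \<in> E" "y \<notin> E'" by blast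
    have yR: "y \<in> carrier R" using y(1) subfieldE(3)[OF E(1)] by auto
    obtain g where g: "g \<in> endos E'" "g y \<noteq> y"
      using moving_endomorphism[OF E' yR y(2)] by blast
    have gK: "g \<in> endos K" using g(1) endos_mono[OF E'(2)] by auto
    obtain x where x: "acts g x" using acts_exists[OF gK] .
    then have "x \<in> codes E" using sub g(1) by (auto simp: codes_def)
    then obtain h where h: "h \<in> endos E" "acts h x" by (auto simp: codes_def)
    have "g y = h y"
      using endos_eqI[OF gK _ x h(2) yR] h(1) endos_mono[OF E(2)] by auto
    then show False
      using endos_fix[OF h(1) y(1)] g(2) by simp
  qed
qed (rule codes_mono)

lemma codes_eq_iff:
  assumes "subfield E R" "K \<subseteq> E" "subfield E' R" "K \<subseteq> E'"
  shows "codes E = codes E' \<longleftrightarrow> E = E'"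
  using codes_antimono_iff[OF assms] codes_antimono_iff[OF assms(3,4,1,2)] by blast

end


section \<open>The generators of the listed fields and the codes fixing them\<close>

context cubic_pair
begin

definition \<gamma> :: 'a where "\<gamma> = \<alpha> \<otimes> \<beta>"

definition root_sum :: "tri \<Rightarrow> 'a" where
  "root_sum k = \<alpha> \<otimes> zeta_pow k \<oplus> \<beta> \<otimes> zeta_pow (tadd k k)"

lemma gamma_closed [simp]: "\<gamma> \<in> carrier R" and root_sum_closed [simp]: "root_sum k \<in> carrier R"
  by (simp_all add: \<gamma>_def root_sum_def)

lemma gamma_neq_zero: "\<gamma> \<noteq> \<zero>"
  using alpha_neq_zero beta_neq_zero by (simp add: \<gamma>_def integral_iff)

lemma gamma_cube: "\<gamma> [^] (3 :: nat) = b"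
  using cubes_prod by (simp add: \<gamma>_def nat_pow_distrib)

text \<open>The predicate is constrained only at codes realized by some endomorphism over
  \<open>K\<close>, so one predicate serves all three cases.\<close>

definition fixed_iff :: "'a \<Rightarrow> (code \<Rightarrow> bool) \<Rightarrow> bool" where
  "fixed_iff x P \<longleftrightarrow> x \<in> carrier R \<and> (\<forall>g\<in>endos K. \<forall>y. acts g y \<longrightarrow> (g x = x \<longleftrightarrow> P y))"

lemma mem_iff_codes:
  assumes E: "subfield E R" "K \<subseteq> E" and P: "fixed_iff x P"
  shows "x \<in> E \<longleftrightarrow> (\<forall>y\<in>codes E. P y)"
proof
  assume "x \<in> E"
  then show "\<forall>y\<in>codes E. P y"
    using P endos_mono[OF E(2)] endos_fix unfolding codes_def fixed_iff_def by blast
next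
  assume *: "\<forall>y\<in>codes E. P y"
  show "x \<in> E"
  proof (rule ccontr)
    assume "x \<notin> E"
    then obtain g where g: "g \<in> endos E" "g x \<noteq> x"
      using moving_endomorphism[OF E _ \<open>x \<notin> E\<close>] P unfolding fixed_iff_def by blast
    then have gK: "g \<in> endos K" using endos_mono[OF E(2)] by auto
    then obtain y where "acts g y" using acts_exists by blast
    then show False
      using * g gK P unfolding codes_def fixed_iff_def by blast
  qed
qed

lemma codes_adjoin_list:
  assumes "list_all2 fixed_iff xs Ps"
  shows "codes (adjoin R K (set xs)) = {y \<in> codes K. \<forall>P\<in>set Ps. P y}"
proof (rule codes_adjoin)
  show "set xs \<subseteq> carrier R"
    using assms by (induction rule: list_all2_induct) (simp_all add: fixed_iff_def)
  show "(\<forall>s\<in>set xs. g s = s) \<longleftrightarrow> (\<forall>P\<in>set Ps. P y)" if g: "g \<in> endos K" "acts g y" for g y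
  proof -
    have "list_all2 (\<lambda>x P. g x = x \<longleftrightarrow> P y) xs Ps"
      using assms by (rule list_all2_mono) (use g fixed_iff_def in blast)
    then show ?thesis
      by (induction rule: list_all2_induct) simp_all
  qed
qed

lemma fixed_iff_alpha: "fixed_iff \<alpha> fix_alpha"
  unfolding fixed_iff_def
proof (intro conjI ballI allI impI)
  fix g y assume "acts g y"
  obtain s i j where sij: "y = (s, i, j)" by (cases y)
  have "g \<alpha> = zeta_pow i \<otimes> (if s then \<beta> else \<alpha>)"
    using \<open>acts g y\<close> by (simp add: sij)
  moreover have "zeta_pow i \<otimes> \<beta> \<noteq> \<alpha>"
    using zeta_pow_alpha_neq_beta(2)[of i T0] by (simp add: zeta_pow_def)
  ultimately show "g \<alpha> = \<alpha> \<longleftrightarrow> fix_alpha y"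
    by (simp add: sij zeta_pow_mult_eq_self_iff[OF alpha_closed alpha_neq_zero])
qed simp

lemma fixed_iff_beta: "fixed_iff \<beta> fix_beta"
  unfolding fixed_iff_def
proof (intro conjI ballI allI impI)
  fix g y assume "acts g y"
  obtain s i j where sij: "y = (s, i, j)" by (cases y)
  have "g \<beta> = zeta_pow j \<otimes> (if s then \<alpha> else \<beta>)"
    using \<open>acts g y\<close> by (simp add: sij)
  moreover have "zeta_pow j \<otimes> \<alpha> \<noteq> \<beta>"
    using zeta_pow_alpha_neq_beta(1)[of j T0] by (simp add: zeta_pow_def)
  ultimately show "g \<beta> = \<beta> \<longleftrightarrow> fix_beta y"
    by (simp add: sij zeta_pow_mult_eq_self_iff[OF beta_closed beta_neq_zero])
qed simp

lemma fixed_iff_gamma: "fixed_iff \<gamma> fix_gamma"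
  unfolding fixed_iff_def
proof (intro conjI ballI allI impI)
  fix g y assume g: "g \<in> endos K" and y: "acts g y"
  interpret g: subfield_embedding R "carrier R" g
    using endos_embedding[OF g] .
  obtain s i j where sij: "y = (s, i, j)" by (cases y)
  have "g \<gamma> = zeta_pow (tadd i j) \<otimes> \<gamma>"
    using y by (auto simp: sij \<gamma>_def g.hom_mult zeta_pow_tadd m_ac split: if_splits)
  then show "g \<gamma> = \<gamma> \<longleftrightarrow> fix_gamma y"
    by (simp add: sij zeta_pow_mult_eq_self_iff[OF gamma_closed gamma_neq_zero])
qed simp

lemma fixed_iff_delta: "fixed_iff \<delta> fix_delta"
  unfolding fixed_iff_def
proof (intro conjI ballI allI impI)
  fix g y assume g: "g \<in> endos K" and y: "acts g y"
  interpret g: subfield_embedding R "carrier R" g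
    using endos_embedding[OF g] .
  obtain s i j where sij: "y = (s, i, j)" by (cases y)
  have neg: "g \<delta> = (if s then \<ominus> \<delta> else \<delta>)"
  proof -
    have swap: "\<ominus> (x \<ominus> z) = z \<ominus> x" if "x \<in> carrier R" "z \<in> carrier R" for x z
      using that by (simp add: minus_eq minus_add a_comm)
    have "g (\<alpha> [^] (3 :: nat)) = (if s then \<beta> [^] (3 :: nat) else \<alpha> [^] (3 :: nat))"
      "g (\<beta> [^] (3 :: nat)) = (if s then \<alpha> [^] (3 :: nat) else \<beta> [^] (3 :: nat))"
      using y by (simp_all add: sij g.hom_pow zeta_pow_mult_cube)
    then show ?thesis
      using delta_cases by (elim disjE) (simp_all add: g.hom_minus swap)
  qed
  \<comment> \<open>A swap negates \<delta>, and this moves it because 2 is nonzero and the cubes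
    differ.\<close>
  have "\<ominus> \<delta> \<noteq> \<delta>"
  proof
    assume "\<ominus> \<delta> = \<delta>"
    then have "\<delta> \<oplus> \<delta> = \<zero>"
      by (metis delta_closed l_neg)
    moreover have "\<delta> \<oplus> \<delta> = [(2 :: nat)] \<cdot> \<one> \<otimes> \<delta>"
      by (simp add: numeral_2_eq_2 l_distr)
    ultimately have "\<delta> = \<zero>"
      using two_neq_zero by (simp add: integral_iff)
    then show False
      using delta_cases cubes_neq by (metis alpha_closed beta_closed nat_pow_closed r_right_minus_eq)
  qed
  with neg show "g \<delta> = \<delta> \<longleftrightarrow> fix_delta y"
    by (simp add: sij)
qed simp

text \<open>For w = 1 equality would mean (\<zeta> - 1)(u - \<zeta>^2 v) = 0 and hence u^3 = v^3; w
  = 2 is the same with u and v exchanged.\<close>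

lemma twisted_sum_eq_iff:
  assumes u: "u \<in> carrier R" "v \<in> carrier R" and neq: "u [^] (3 :: nat) \<noteq> v [^] (3 :: nat)"
  shows "zeta_pow w \<otimes> u \<oplus> zeta_pow (tadd w w) \<otimes> v = u \<oplus> v \<longleftrightarrow> w = T0"
proof -
  have key: "\<zeta> \<otimes> u \<oplus> \<zeta> [^] (2 :: nat) \<otimes> v \<noteq> u \<oplus> v"
    if u: "u \<in> carrier R" "v \<in> carrier R" and neq: "u [^] (3 :: nat) \<noteq> v [^] (3 :: nat)" for u v
  proof
    assume eq: "\<zeta> \<otimes> u \<oplus> \<zeta> [^] (2 :: nat) \<otimes> v = u \<oplus> v"
    have "(\<zeta> \<ominus> \<one>) \<otimes> (u \<ominus> \<zeta> [^] (2 :: nat) \<otimes> v) =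
        (\<zeta> \<otimes> u \<oplus> \<zeta> [^] (2 :: nat) \<otimes> v) \<ominus> (u \<oplus> v) \<ominus> (\<zeta> \<ominus> \<one>) \<otimes> (\<zeta> [^] (2 :: nat) \<oplus> \<zeta> \<oplus> \<one>) \<otimes> v"
      using u zeta_closed
      by (elim section_atE) (simp only: section_at_simps, rule arg_cong[of _ _ "section_at R"],
        simp add: algebra_simps power2_eq_square)
    also have "\<dots> = \<zero>"
      using u by (simp add: eq zeta_sum minus_eq r_neg)
    finally have "u = zeta_pow T2 \<otimes> v"
      using u zeta_neq_one(1) by (simp add: integral_iff zeta_pow_def)
    then show False
      using zeta_pow_mult_cube[OF u(2)] neq by simp
  qed
  show ?thesis
  proof (cases w)
    case T0
    then show ?thesis using u by (simp add: zeta_pow_def)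
  next
    case T1
    then show ?thesis using key[OF assms] by (simp add: zeta_pow_def)
  next
    case T2
    have "\<zeta> [^] (2 :: nat) \<otimes> u \<oplus> \<zeta> \<otimes> v \<noteq> u \<oplus> v"
      using key[OF u(2,1) neq[symmetric]] u by (metis a_comm m_closed nat_pow_closed zeta_closed)
    then show ?thesis using T2 by (simp add: zeta_pow_def)
  qed
qed

lemma fixed_iff_root: "fixed_iff (\<gamma> \<otimes> root_sum k) (fix_root k)"
  unfolding fixed_iff_def
proof (intro conjI ballI allI impI)
  fix g y assume g: "g \<in> endos K" and y: "acts g y"
  interpret g: subfield_embedding R "carrier R" g
    using endos_embedding[OF g] .
  obtain s i j where sij: "y = (s, i, j)" by (cases y)
  define u v where "u = \<gamma> \<otimes> (\<alpha> \<otimes> zeta_pow k)" and "v = \<gamma> \<otimes> (\<beta> \<otimes> zeta_pow (tadd k k))"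
  have [simp]: "u \<in> carrier R" "v \<in> carrier R"
    by (simp_all add: u_def v_def)
  have sum: "\<gamma> \<otimes> root_sum k = u \<oplus> v"
    by (simp add: u_def v_def root_sum_def r_distr)
  have "u [^] (3 :: nat) = \<gamma> [^] (3 :: nat) \<otimes> \<alpha> [^] (3 :: nat)"
    "v [^] (3 :: nat) = \<gamma> [^] (3 :: nat) \<otimes> \<beta> [^] (3 :: nat)"
    by (simp_all add: u_def v_def nat_pow_distrib zeta_pow_cube)
  then have neq: "u [^] (3 :: nat) \<noteq> v [^] (3 :: nat)"
    using m_lcancel[of "\<gamma> [^] (3 :: nat)"] cubes_neq gamma_neq_zero by (simp add: integral_iff
      numeral_3_eq_3)
  have g\<gamma>: "g \<gamma> = zeta_pow (tadd i j) \<otimes> \<gamma>"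
    using y by (auto simp: sij \<gamma>_def g.hom_mult zeta_pow_tadd m_ac split: if_splits)
  have shuffle: "zeta_pow w \<otimes> \<gamma> \<otimes> (zeta_pow w' \<otimes> x \<otimes> zeta_pow m) = zeta_pow (tadd w (tadd w' m)) \<otimes>
    (\<gamma> \<otimes> x)"
      "zeta_pow w \<otimes> (\<gamma> \<otimes> (x \<otimes> zeta_pow m)) = zeta_pow (tadd w m) \<otimes> (\<gamma> \<otimes> x)"
    if "x \<in> carrier R" for w w' m x
    unfolding zeta_pow_tadd
    using that gamma_closed zeta_pow_closed[of w] zeta_pow_closed[of w'] zeta_pow_closed[of m]
    by (elim section_atE, simp only: section_at_simps, intro arg_cong[of _ _ "section_at R"], simp
      add: mult.left_commute mult.commute mult.assoc)+
  have gu: "g u = zeta_pow (tadd i j) \<otimes> \<gamma> \<otimes> (g \<alpha> \<otimes> zeta_pow k)"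
    and gv: "g v = zeta_pow (tadd i j) \<otimes> \<gamma> \<otimes> (g \<beta> \<otimes> zeta_pow (tadd k k))"
    by (simp_all add: u_def v_def g.hom_mult g\<gamma> endos_zeta_pow[OF g])
  have gsum: "g (u \<oplus> v) = g u \<oplus> g v"
    by (simp add: g.hom_add)
  show "g (\<gamma> \<otimes> root_sum k) = \<gamma> \<otimes> root_sum k \<longleftrightarrow> fix_root k y"
  proof (cases s)
    case False
    \<comment> \<open>The factor \<gamma> contributes i + j and \<alpha> contributes i. For \<beta>
      the exponent is i + 2j = 2w in \<int>/3, so the image is a twisted sum.\<close>
    define w where "w = tadd (tadd i i) j"
    have "tadd (tadd i j) (tadd i k) = tadd w k" "tadd (tadd i j) (tadd j (tadd k k)) = tadd (tadd
      w w) (tadd k k)"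
      unfolding w_def by (cases i; cases j; cases k; simp)+
    then have "g u = zeta_pow w \<otimes> u" "g v = zeta_pow (tadd w w) \<otimes> v"
      using y False unfolding gu gv by (simp_all add: sij shuffle) (simp_all add: u_def v_def shuffle)
    moreover have "w = T0 \<longleftrightarrow> fix_root k y"
      unfolding w_def sij using False by (cases i; cases j) simp_all
    ultimately show ?thesis
      unfolding sum gsum using twisted_sum_eq_iff[OF _ _ neq] by simp
  next
    case True
    \<comment> \<open>Now u goes to a multiple of v: the exponent 2i + j + k of \<beta> is compared
      with the 2k already present in v, and -k = 2k in \<int>/3.\<close>
    define w where "w = tadd (tadd i i) (tadd j (tadd k k))"
    have "tadd (tadd i j) (tadd i k) = tadd w (tadd k k)" "tadd (tadd i j) (tadd j (tadd k k)) =
      tadd (tadd w w) k"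
      unfolding w_def by (cases i; cases j; cases k; simp)+
    then have "g u = zeta_pow w \<otimes> v" "g v = zeta_pow (tadd w w) \<otimes> u"
      using y True unfolding gu gv by (simp_all add: sij shuffle) (simp_all add: u_def v_def shuffle)
    then have "g u \<oplus> g v = zeta_pow w \<otimes> v \<oplus> zeta_pow (tadd w w) \<otimes> u"
      by simp
    moreover have "w = T0 \<longleftrightarrow> fix_root k y"
      unfolding w_def sij using True by (cases i; cases j; cases k) simp_all
    moreover have "u \<oplus> v = v \<oplus> u"
      by (rule a_comm) simp_all
    ultimately show ?thesis
      unfolding sum gsum using twisted_sum_eq_iff[OF _ _ neq[symmetric], of w] by simp
  qed
qed simp

end


section \<open>Degrees, normality and the resolvent\<close>

lemma (in ring) eval_trinomial:
  assumes "x \<in> carrier R" "u \<in> carrier R" "v \<in> carrier R"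
  shows "eval [\<one>, \<zero>, \<zero>, u, \<zero>, \<zero>, v] x = x [^] (3 :: nat) \<otimes> x [^] (3 :: nat) \<oplus> (u \<otimes> x [^] (3 ::
    nat) \<oplus> v)"
  using assms by (simp add: nat_pow_mult numeral_3_eq_3 m_assoc)

lemma (in field) Irr_eq_irreducible:
  assumes K: "subfield K R" and x: "x \<in> carrier R"
    and p: "p \<in> carrier (K[X])" "pirreducible K p" "lead_coeff p = \<one>" "eval p x = \<zero>"
  shows "Irr K x = p" "(algebraic over K) x"
proof -
  show alg: "(algebraic over K) x"
    using algebraicI[OF p(1) _ p(4)] pirreducibleE(1)[OF subfieldE(1)[OF K] p(1,2)] by simp
  show "Irr K x = p"
    using minimal_polynomial_is_unique[OF K x alg] IrrE[OF K x alg] p by blast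
qed

lemma (in field) dimension_adjoin:
  assumes M: "subfield M R" and x: "x \<in> carrier R" "(algebraic over M) x"
  shows "dimension (degree (Irr M x)) M (adjoin R M {x})"
  using dimension_simple_extension[OF M x] simple_extension_eq_adjoin[OF M x] by simp

lemma (in field) adjoin_adjoin:
  assumes K: "K \<subseteq> carrier R" and S: "S \<subseteq> carrier R" "T \<subseteq> carrier R"
  shows "adjoin R (adjoin R K S) T = adjoin R K (S \<union> T)"
proof
  note A = subfield_adjoin[OF K S(1)] adjoin_incl[OF K S(1)]
  have AR: "adjoin R K S \<subseteq> carrier R" using subfieldE(3)[OF A(1)] .
  note B = subfield_adjoin[OF AR S(2)] adjoin_incl[OF AR S(2)]
  have ST: "S \<union> T \<subseteq> carrier R" using S by auto
  note C = subfield_adjoin[OF K ST] adjoin_incl[OF K ST]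
  show "adjoin R (adjoin R K S) T \<subseteq> adjoin R K (S \<union> T)"
    using adjoin_minimal[OF AR S(2) C(1)] adjoin_minimal[OF K S(1) C(1)] C by auto
  show "adjoin R K (S \<union> T) \<subseteq> adjoin R (adjoin R K S) T"
    using adjoin_minimal[OF K ST B(1)] A B by auto
qed

text \<open>In \<int>/3 the negative of i is \<open>tadd i i\<close>; inverting a swap also
  exchanges the two exponents.\<close>

fun code_inv :: "code \<Rightarrow> code" where
  "code_inv (s, i, j) = (if s then (True, tadd j j, tadd i i) else (False, tadd i i, tadd j j))"

text \<open>The group of codes has exponent 6.\<close>

lemma code_inv_eq_power: "code_inv x = code_mult x (code_mult x (code_mult x (code_mult x x)))"
proof -
  obtain s i j where "x = (s, i, j)" by (cases x)
  then show ?thesis by (cases s; cases i; cases j) simp_all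
qed

lemma code_mult_inv_conj: "code_mult x (code_mult (code_inv x) y) = y"
proof -
  obtain s i j s' i' j' where "x = (s, i, j)" "y = (s', i', j')" by (cases x; cases y) blast
  then show ?thesis by (cases s; cases s'; cases i; cases j; cases i'; cases j') simp_all
qed

lemma code_mult_inv_left: "code_mult (code_inv x) x = (False, T0, T0)"
proof -
  obtain s i j where "x = (s, i, j)" by (cases x)
  then show ?thesis by (cases s; cases i; cases j) simp_all
qed

context cubic_pair
begin

lemma code_inv_mem: "x \<in> codes K \<Longrightarrow> code_inv x \<in> codes K"
  unfolding code_inv_eq_power using code_subgroup_codes[of K] by (simp add: code_subgroup_def)

definition trinomial :: "'a list" where
  "trinomial = [\<one>, \<zero>, \<zero>, a, \<zero>, \<zero>, b]"

lemma trinomial_closed: "trinomial \<in> carrier (K[X])"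
  using a_K b_K subringE(2,3)[OF subfieldE(1)[OF subfield_K]]
  unfolding sym[OF univ_poly_carrier] polynomial_def by (auto simp: trinomial_def)

lemma trinomial_roots: "eval trinomial \<alpha> = \<zero>" "eval trinomial \<beta> = \<zero>"
proof -
  have ab: "a \<in> carrier R" "b \<in> carrier R" using a_K b_K K_carrier by auto
  have root: "eval trinomial y = \<zero>"
    if y: "y \<in> carrier R" "z \<in> carrier R" "y [^] (3 :: nat) \<oplus> z [^] (3 :: nat) = \<ominus> a"
      "y [^] (3 :: nat) \<otimes> z [^] (3 :: nat) = b" for y z
  proof -
    have "Y \<otimes> Y \<oplus> ((\<ominus> (Y \<oplus> Z)) \<otimes> Y \<oplus> Y \<otimes> Z) = \<zero>"
      if "Y \<in> carrier R" "Z \<in> carrier R" for Y Z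
      using that by (elim section_atE) (simp only: section_at_simps, rule arg_cong[of _ _
        "section_at R"],
        simp add: algebra_simps)
    from this[of "y [^] (3 :: nat)" "z [^] (3 :: nat)"] show ?thesis
      unfolding trinomial_def eval_trinomial[OF y(1) ab] y(3,4)
      using y(1,2) by (simp only: nat_pow_closed minus_minus ab)
  qed
  show "eval trinomial \<alpha> = \<zero>" "eval trinomial \<beta> = \<zero>"
    using root[of \<alpha> \<beta>] root[of \<beta> \<alpha>] cubes_sum cubes_prod by (simp_all add: a_comm m_comm)
qed

text \<open>The algebraic elements form a subfield containing \<open>K\<close>, \<alpha> and
  \<beta>.\<close>

lemma all_algebraic:
  assumes "x \<in> carrier R"
  shows "(algebraic over K) x"
proof -
  let ?A = "{y \<in> carrier R. (algebraic over K) y}"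
  have "trinomial \<noteq> []" by (simp add: trinomial_def)
  then have "\<alpha> \<in> ?A" "\<beta> \<in> ?A"
    using algebraicI[OF trinomial_closed] trinomial_roots by simp_all
  moreover have "K \<subseteq> ?A"
    using algebraic_self[OF subfieldE(1)[OF subfield_K]] K_carrier by auto
  ultimately have "?A = carrier R"
    using generatedD[OF subfield_of_algebraics[OF subfield_K]] by simp
  then show ?thesis using assms by blast
qed

theorem normal_iff_codes:
  assumes E: "subfield E R" "K \<subseteq> E"
  shows "normal_extension R K E \<longleftrightarrow>
    (\<forall>x\<in>codes K. \<forall>y\<in>codes E. code_mult (code_inv x) (code_mult y x) \<in> codes E)"
proof
  note endosE = subsetD[OF endos_mono[OF E(2)]]
  assume norm: "normal_extension R K E"
  show "\<forall>x\<in>codes K. \<forall>y\<in>codes E. code_mult (code_inv x) (code_mult y x) \<in> codes E"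
  proof (intro ballI)
    fix x y assume x: "x \<in> codes K" and "y \<in> codes E"
    then obtain g g' h where g: "g \<in> endos K" "acts g x" and g': "g' \<in> endos K" "acts g' (code_inv x)"
      and h: "h \<in> endos E" "acts h y"
      using code_inv_mem[OF x] by (auto simp: codes_def)
    define k where "k = (\<lambda>z. g' (h (g z)))"
    have k: "k \<in> endos K" "acts k (code_mult (code_inv x) (code_mult y x))"
      unfolding k_def using acts_comp[OF g' acts_comp[OF endosE[OF h(1)] h(2) g(2)]]
        endos_comp[OF g'(1) endos_comp[OF endosE[OF h(1)] g(1)]] by auto
    have "k e = e" if e: "e \<in> E" for e
    proof -
      \<comment> \<open>Normality lets \<open>h\<close> fix g e, and g' undoes g because their codes
        are inverse.\<close>
      have "g e \<in> E"
        using normal_imp_invariant[OF subfield_K E norm e g(1)] .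
      then have "k e = g' (g e)"
        using endos_fix[OF h(1)] by (simp add: k_def)
      also have "\<dots> = e"
        using endos_eqI[OF endos_comp[OF g'(1) g(1)] endos_id acts_comp[OF g' g(2)]] e
          subfieldE(3)[OF E(1)]
        by (auto simp: code_mult_inv_left zeta_pow_def)
      finally show ?thesis .
    qed
    then have "k \<in> endos E"
      using k(1) by (simp add: endomorphisms_fixing_def)
    then show "code_mult (code_inv x) (code_mult y x) \<in> codes E"
      using k(2) by (auto simp: codes_def)
  qed
next
  note endosE = subsetD[OF endos_mono[OF E(2)]]
  assume conj: "\<forall>x\<in>codes K. \<forall>y\<in>codes E. code_mult (code_inv x) (code_mult y x) \<in> codes E"
  show "normal_extension R K E"
  proof (rule invariant_imp_normal[OF subfield_K E])
    fix x assume "x \<in> E"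
    then show "(algebraic over K) x"
      using all_algebraic subfieldE(3)[OF E(1)] by blast
  next
    fix x assume "x \<in> carrier R" "\<And>g. g \<in> endos K \<Longrightarrow> g x = x"
    then show "x \<in> K"
      using moving_endomorphism[OF subfield_K subset_refl] by blast
  next
    fix e g assume e: "e \<in> E" and g: "g \<in> endos K"
    have eR: "e \<in> carrier R" using e subfieldE(3)[OF E(1)] by auto
    have geR: "g e \<in> carrier R"
      using subfield_embedding.hom_closed[OF endos_embedding[OF g] eR] .
    obtain x where x: "acts g x" using acts_exists[OF g] .
    show "g e \<in> E"
    proof (rule ccontr)
      assume "g e \<notin> E"
      then obtain h where h: "h \<in> endos E" "h (g e) \<noteq> g e"
        using moving_endomorphism[OF E geR] by blast
      obtain y where y: "acts h y" using acts_exists[OF endosE[OF h(1)]] .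
      have "x \<in> codes K" "y \<in> codes E"
        using g x h(1) y unfolding codes_def by blast+
      then have "code_mult (code_inv x) (code_mult y x) \<in> codes E"
        using conj by blast
      then obtain h' where h': "h' \<in> endos E" "acts h' (code_mult (code_inv x) (code_mult y x))"
        by (auto simp: codes_def)
      \<comment> \<open>Both sides have the code of \<open>h\<close> after \<open>g\<close>, since
        \<open>h'\<close> has the conjugated code.\<close>
      have "h (g e) = g (h' e)"
        using endos_eqI[OF endos_comp[OF endosE[OF h(1)] g] endos_comp[OF g endosE[OF h'(1)]]
            acts_comp[OF endosE[OF h(1)] y x] acts_comp[OF g x h'(2), unfolded code_mult_inv_conj] eR] .
      then show False
        using h(2) endos_fix[OF h'(1) e] by simp
    qed
  qed
qed

lemma dimension_adjoin_delta:
  assumes M: "subfield M R" "K \<subseteq> M" "\<delta> \<notin> M"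
  shows "dimension 2 M (adjoin R M {\<delta>})"
proof -
  have "\<delta> [^] (2 :: nat) \<in> M" using delta_square_mem M(2) by auto
  note irr = Irr_square_root[OF M(1) delta_closed this M(3)]
  show ?thesis
    using dimension_adjoin[OF M(1) delta_closed irr(2)] by (simp add: irr(1) numeral_2_eq_2)
qed

lemma dimension_adjoin_gamma:
  assumes M: "subfield M R" "K \<subseteq> M" "\<gamma> \<notin> M"
  shows "dimension 3 M (adjoin R M {\<gamma>})"
proof -
  have "\<gamma> [^] (3 :: nat) \<in> M" using gamma_cube b_K M(2) by auto
  note irr = Irr_cube_root[OF M(1,2) gamma_closed this M(3)]
  show ?thesis
    using dimension_adjoin[OF M(1) gamma_closed irr(2)] by (simp add: irr(1) numeral_3_eq_3)
qed

text \<open>Cardano's factorization of x^3 - 3uvx - (u^3 + v^3) into the linear factors of u + v,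
  u\<zeta> + v\<zeta>^2 and u\<zeta>^2 + v\<zeta>, for u = \<gamma>\<alpha> and v =
  \<gamma>\<beta>.\<close>

lemma eval_resolvent_eq_zero_iff:
  assumes x: "x \<in> carrier R"
  shows "eval [\<one>, \<zero>, \<ominus> ([(3 :: nat)] \<cdot> b), a \<otimes> b] x = \<zero> \<longleftrightarrow> (\<exists>k. x = \<gamma> \<otimes> root_sum k)"
proof -
  have [simp]: "a \<in> carrier R" "b \<in> carrier R" using a_K b_K K_carrier by auto
  define u v where "u = \<gamma> \<otimes> \<alpha>" and "v = \<gamma> \<otimes> \<beta>"
  have [simp]: "u \<in> carrier R" "v \<in> carrier R" by (simp_all add: u_def v_def)
  have uv: "u \<otimes> v = b"
    unfolding gamma_cube[symmetric] by (simp add: u_def v_def \<gamma>_def numeral_3_eq_3 m_ac)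
  have "u [^] (3 :: nat) \<oplus> v [^] (3 :: nat) = b \<otimes> (\<alpha> [^] (3 :: nat) \<oplus> \<beta> [^] (3 :: nat))"
    by (simp add: u_def v_def nat_pow_distrib gamma_cube r_distr)
  then have cubes: "u [^] (3 :: nat) \<oplus> v [^] (3 :: nat) = \<ominus> (a \<otimes> b)"
    by (simp add: cubes_sum r_minus m_comm)
  have roots: "\<gamma> \<otimes> root_sum T0 = u \<oplus> v" "\<gamma> \<otimes> root_sum T1 = u \<otimes> \<zeta> \<oplus> v \<otimes> \<zeta> [^] (2 :: nat)"
    "\<gamma> \<otimes> root_sum T2 = u \<otimes> \<zeta> [^] (2 :: nat) \<oplus> v \<otimes> \<zeta>"
    by (simp_all add: root_sum_def zeta_pow_def u_def v_def r_distr m_assoc)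
  let ?q = "\<zeta> [^] (2 :: nat) \<oplus> \<zeta> \<oplus> \<one>"
  \<comment> \<open>The last line is the multiple of \<open>?q\<close> by which the two sides differ
    for an arbitrary \<zeta>.\<close>
  have "(x \<ominus> \<gamma> \<otimes> root_sum T1) \<otimes> (x \<ominus> \<gamma> \<otimes> root_sum T2) =
      (x [^] (2 :: nat) \<oplus> x \<otimes> (u \<oplus> v) \<oplus> u [^] (2 :: nat) \<oplus> v [^] (2 :: nat) \<ominus> u \<otimes> v) \<oplus>
      ?q \<otimes> ((\<zeta> \<ominus> \<one>) \<otimes> (u [^] (2 :: nat) \<oplus> v [^] (2 :: nat)) \<oplus> u \<otimes> v \<otimes> (\<zeta> [^] (2 :: nat) \<ominus> \<zeta> \<oplus> \<one>)
        \<ominus> x \<otimes> (u \<oplus> v))"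
    unfolding roots
    using x \<open>u \<in> carrier R\<close> \<open>v \<in> carrier R\<close> zeta_closed
    by (elim section_atE) (simp only: section_at_simps, rule arg_cong[of _ _ "section_at R"],
        simp add: algebra_simps power2_eq_square)
  also have "\<dots> = x [^] (2 :: nat) \<oplus> x \<otimes> (u \<oplus> v) \<oplus> u [^] (2 :: nat) \<oplus> v [^] (2 :: nat) \<ominus> u \<otimes> v"
    using x by (simp add: zeta_sum)
  finally have "(x \<ominus> \<gamma> \<otimes> root_sum T0) \<otimes> ((x \<ominus> \<gamma> \<otimes> root_sum T1) \<otimes> (x \<ominus> \<gamma> \<otimes> root_sum T2)) =
      (x \<ominus> (u \<oplus> v)) \<otimes> (x [^] (2 :: nat) \<oplus> x \<otimes> (u \<oplus> v) \<oplus> u [^] (2 :: nat) \<oplus> v [^] (2 :: nat) \<ominus> u \<otimes> v)"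
    by (simp add: roots(1))
  also have "\<dots> = x [^] (3 :: nat) \<ominus> (u \<otimes> v \<oplus> u \<otimes> v \<oplus> u \<otimes> v) \<otimes> x \<ominus> (u [^] (3 :: nat) \<oplus> v [^] (3 :: nat))"
    using x \<open>u \<in> carrier R\<close> \<open>v \<in> carrier R\<close>
    by (elim section_atE) (simp only: section_at_simps, rule arg_cong[of _ _ "section_at R"],
        simp add: algebra_simps power2_eq_square power3_eq_cube)
  also have "\<dots> = eval [\<one>, \<zero>, \<ominus> ([(3 :: nat)] \<cdot> b), a \<otimes> b] x"
    unfolding uv cubes using x by (simp add: numeral_3_eq_3 minus_eq l_minus a_assoc)
  finally have prod: "eval [\<one>, \<zero>, \<ominus> ([(3 :: nat)] \<cdot> b), a \<otimes> b] x =
      (x \<ominus> \<gamma> \<otimes> root_sum T0) \<otimes> ((x \<ominus> \<gamma> \<otimes> root_sum T1) \<otimes> (x \<ominus> \<gamma> \<otimes> root_sum T2))" by simp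
  have "(\<exists>k. x = \<gamma> \<otimes> root_sum k) \<longleftrightarrow>
      x = \<gamma> \<otimes> root_sum T0 \<or> x = \<gamma> \<otimes> root_sum T1 \<or> x = \<gamma> \<otimes> root_sum T2"
    by (metis tri.exhaust)
  then show ?thesis
    unfolding prod using x by (simp add: integral_iff)
qed

text \<open>From r^3 = -a + 3\<gamma>r follows \<gamma> = (a + r^3)/(3r), where both 3 and r are
  nonzero; conversely r is the quotient of \<gamma>r by \<gamma>.\<close>

lemma adjoin_root_sum:
  assumes "root_sum k \<noteq> \<zero>"
  shows "adjoin R K {root_sum k} = adjoin R K {\<gamma>, \<gamma> \<otimes> root_sum k}"
proof -
  let ?r = "root_sum k"
  have S: "{?r} \<subseteq> carrier R" "{\<gamma>, \<gamma> \<otimes> ?r} \<subseteq> carrier R" by auto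
  note A = subfield_adjoin[OF K_carrier S(1)] adjoin_incl[OF K_carrier S(1)]
  note B = subfield_adjoin[OF K_carrier S(2)] adjoin_incl[OF K_carrier S(2)]
  note Asub = subringE(3,5,6,7)[OF subfieldE(1)[OF A(1)]]
  have mult_right: "x \<in> E" if "subfield E R" "x \<in> carrier R" "y \<in> E" "y \<noteq> \<zero>" "x \<otimes> y \<in> E" for E x y
  proof -
    have inv: "inv y \<in> E" "y \<otimes> inv y = \<one>"
      using subfield_m_inv[OF that(1)] that(3,4) by auto
    then have "x \<otimes> y \<otimes> inv y = x"
      using that(1-3) subfieldE(3)[OF that(1)] by (simp add: m_assoc subset_iff)
    then show ?thesis
      using subringE(6)[OF subfieldE(1)[OF that(1)] that(5) inv(1)] by simp
  qed
  have [simp]: "a \<in> carrier R" using a_K K_carrier by auto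
  have "\<gamma> \<in> adjoin R K {?r}"
  proof (rule mult_right[OF A(1)])
    let ?y = "[(3 :: nat)] \<cdot> \<one> \<otimes> ?r"
    show "?y \<in> adjoin R K {?r}"
      using A Asub by (simp add: numeral_3_eq_3)
    show "?y \<noteq> \<zero>"
      using assms three_neq_zero by (simp add: integral_iff)
    define w w2 where "w = zeta_pow k" and "w2 = zeta_pow (tadd k k)"
    have [simp]: "w \<in> carrier R" "w2 \<in> carrier R" by (simp_all add: w_def w2_def)
    have w: "w \<otimes> w2 = \<one>" "w [^] (3 :: nat) = \<one>" "w2 [^] (3 :: nat) = \<one>"
      unfolding w_def w2_def
      by (simp_all add: zeta_pow_cube flip: zeta_pow_tadd) (cases k; simp add: zeta_pow_def)
    have "?r [^] (3 :: nat) = \<alpha> [^] (3 :: nat) \<otimes> w [^] (3 :: nat) \<oplus> \<beta> [^] (3 :: nat) \<otimes> w2 [^] (3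
      :: nat) \<oplus>
        \<alpha> \<otimes> \<beta> \<otimes> (w \<otimes> w2) \<otimes> (?r \<oplus> ?r \<oplus> ?r)"
      unfolding root_sum_def w_def[symmetric] w2_def[symmetric]
      using alpha_closed beta_closed \<open>w \<in> carrier R\<close> \<open>w2 \<in> carrier R\<close>
      by (elim section_atE) (simp only: section_at_simps, rule arg_cong[of _ _ "section_at R"],
        simp add: algebra_simps power3_eq_cube)
    also have "\<dots> = \<ominus> a \<oplus> \<gamma> \<otimes> (?r \<oplus> ?r \<oplus> ?r)"
      by (simp add: w cubes_sum \<gamma>_def)
    also have "?r \<oplus> ?r \<oplus> ?r = ?y"
      by (simp add: numeral_3_eq_3 l_distr)
    finally have "\<gamma> \<otimes> ?y = a \<oplus> ?r [^] (3 :: nat)"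
      by (simp add: r_neg1 r_neg2)
    then show "\<gamma> \<otimes> ?y \<in> adjoin R K {?r}"
      using A Asub a_K by (auto simp: numeral_3_eq_3)
  qed simp
  moreover from this have "\<gamma> \<otimes> ?r \<in> adjoin R K {?r}"
    using A Asub by simp
  ultimately have "adjoin R K {\<gamma>, \<gamma> \<otimes> ?r} \<subseteq> adjoin R K {?r}"
    using adjoin_minimal[OF K_carrier S(2) A(1,2)] by simp
  moreover have "?r \<in> adjoin R K {\<gamma>, \<gamma> \<otimes> ?r}"
    using mult_right[OF B(1), of ?r \<gamma>] B(3) gamma_neq_zero by (simp add: m_comm)
  then have "adjoin R K {?r} \<subseteq> adjoin R K {\<gamma>, \<gamma> \<otimes> ?r}"
    using adjoin_minimal[OF K_carrier S(1) B(1,2)] by simp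
  ultimately show ?thesis by blast
qed

end


section \<open>The lists of intermediate fields\<close>

lemmas code_eqs = set_eq_iff subset_iff split_paired_All all_bool_eq all_tri

text \<open>Every proper subgroup in the classification lies in the stabilizer of \<delta>, \<gamma>
  or a resolvent root.\<close>

lemma code_subgroup_eq_UNIV:
  assumes H: "code_subgroup H" and no: "\<not> H \<subseteq> Collect fix_delta" "\<not> H \<subseteq> Collect fix_gamma"
    "\<And>k. \<not> H \<subseteq> Collect (fix_root k)"
  shows "H = UNIV"
proof -
  have "fix_delta x" if "fix_alpha x \<or> fix_beta x" for x using that by (cases x) auto
  then show ?thesis
  using code_subgroup_cases[OF H] no unfolding insert_iff empty_iff
  by (elim disjE; blast)
qed

lemma code_subgroup_eq_fix_gamma:
  assumes H: "code_subgroup H" and no: "\<not> H \<subseteq> Collect fix_delta" "H \<subseteq> Collect fix_gamma"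
    "\<And>k. \<not> H \<subseteq> Collect (fix_root k)"
  shows "H = Collect fix_gamma"
proof -
  have "\<not> UNIV \<subseteq> Collect fix_gamma" by (simp add: code_eqs)
  moreover have "fix_delta x" if "fix_alpha x \<or> fix_beta x" for x using that by (cases x) auto
  ultimately show ?thesis
  using code_subgroup_cases[OF H] no unfolding insert_iff empty_iff
  by (elim disjE; blast)
qed

text \<open>Distinct \<open>fix_root\<close> stabilizers are not contained in one another, and each
  proper subgroup of one lies in \<open>fix_delta\<close> or \<open>fix_gamma\<close>.\<close>

lemma code_subgroup_eq_fix_root:
  assumes H: "code_subgroup H" and no: "\<not> H \<subseteq> Collect fix_delta" "\<not> H \<subseteq> Collect fix_gamma"
    "H \<subseteq> Collect (fix_root k)"
  shows "H = Collect (fix_root k)"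
proof -
  have "\<not> UNIV \<subseteq> Collect (fix_root k)" by (cases k) (simp_all add: code_eqs)
  moreover have "k = l" if "Collect (fix_root l) \<subseteq> Collect (fix_root k)" for l
    using that by (cases k; cases l) (simp_all add: code_eqs)
  moreover have "fix_delta x" if "fix_alpha x \<or> fix_beta x" for x using that by (cases x) auto
  ultimately show ?thesis
  using code_subgroup_cases[OF H] no unfolding insert_iff empty_iff
  by (elim disjE; blast)
qed

text \<open>Normality relative to \<open>N\<close>, which stands for the group of codes of
  \<open>K\<close> and differs between the cases.\<close>

definition code_normal :: "(code \<Rightarrow> bool) \<Rightarrow> (code \<Rightarrow> bool) \<Rightarrow> bool" where
  "code_normal N P \<longleftrightarrow> (\<forall>x y. N x \<longrightarrow> P y \<longrightarrow> P (code_mult (code_inv x) (code_mult y x)))"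

lemma (in field) irreducible_no_root:
  assumes K: "subfield K R" and p: "p \<in> carrier (K[X])" "pirreducible K p" "lead_coeff p = \<one>"
    "degree p > 1"
    and x: "x \<in> K"
  shows "eval p x \<noteq> \<zero>"
proof
  assume e: "eval p x = \<zero>"
  note subr = subfieldE(1)[OF K]
  have xR: "x \<in> carrier R" using x subfieldE(3)[OF K] by auto
  note irr = Irr_eq_irreducible[OF K xR p(1-3) e]
  have lin: "[\<one>, \<ominus> x] \<in> carrier (K[X])"
    using x subringE(3,5)[OF subr] unfolding sym[OF univ_poly_carrier] polynomial_def by auto
  have "Irr K x pdivides [\<one>, \<ominus> x]"
    using Irr_minimal[OF K xR irr(2) lin] xR by (simp add: r_neg)
  then have "degree (Irr K x) \<le> 1"
    using pdivides_imp_degree_le[OF subr IrrE(1)[OF K xR irr(2)] lin] by simp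
  then show False using irr(1) p(4) by simp
qed

text \<open>Two nonconstant factors with degrees adding up to 3 include a linear one.\<close>

lemma (in field) reducible_cubic_root:
  assumes K: "subfield K R" and p: "p \<in> carrier (K[X])" "degree p = 3" "\<not> pirreducible K p"
  obtains x where "x \<in> K" "eval p x = \<zero>"
proof -
  note subr = subfieldE(1)[OF K]
  have pn: "p \<noteq> []" "p \<notin> Units (K[X])"
    using p(2) univ_poly_units'[OF K, of p] by auto
  obtain q r where qr: "q \<in> carrier (K[X])" "r \<in> carrier (K[X])" "p = q \<otimes>\<^bsub>K[X]\<^esub> r"
      "q \<notin> Units (K[X])" "r \<notin> Units (K[X])"
    using pirreducibleI[OF subr p(1) pn] p(3) by blast
  have pol: "polynomial K q" "polynomial K r" using qr(1,2) univ_poly_carrier by auto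
  have nz: "q \<noteq> []" "r \<noteq> []"
    using qr(3) pn(1) poly_mult_zero(2)[OF polynomial_in_carrier[OF subr pol(1)]] by (auto simp:
      univ_poly_mult)
  have "degree q + degree r = 3"
    using poly_mult_degree_eq[OF subr pol] nz qr(3) p(2) by (simp add: univ_poly_mult)
  moreover have "degree q \<noteq> 0" "degree r \<noteq> 0"
    using qr nz univ_poly_units'[OF K, of q] univ_poly_units'[OF K, of r] by auto
  ultimately have "degree q = 1 \<or> degree r = 1" by linarith
  moreover have "\<exists>x\<in>K. eval s x = \<zero>" if "s \<in> carrier (K[X])" "degree s = 1" for s
    using degree_one_root[OF K that] subringE(5)[OF subr] by blast
  ultimately obtain x where x: "x \<in> K" "eval q x = \<zero> \<or> eval r x = \<zero>" using qr by blast
  have xR: "x \<in> carrier R" using x subfieldE(3)[OF K] by auto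
  note ev = ring_hom_memE[OF eval_is_hom[OF subr xR]]
  have "eval p x = \<zero>"
    using ev(2)[OF qr(1,2)] ev(1)[OF qr(1)] ev(1)[OF qr(2)] x(2) qr(3) by auto
  then show thesis using that x(1) by blast
qed

context cubic_pair
begin

lemma codes_carrier: "codes (carrier R) = {(False, T0, T0)}"
proof -
  have one: "fix_alpha y \<and> fix_beta y \<longleftrightarrow> y = (False, T0, T0)" for y
    by (cases y) auto
  have "codes (adjoin R K (set [\<alpha>, \<beta>])) = {y \<in> codes K. \<forall>P\<in>set [fix_alpha, fix_beta]. P y}"
    by (rule codes_adjoin_list) (simp add: fixed_iff_alpha fixed_iff_beta)
  then have "codes (carrier R) = {y \<in> codes K. y = (False, T0, T0)}"
    by (simp only: list.set ball_simps generated one simp_thms)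
  moreover have "(False, T0, T0) \<in> codes K"
    by (rule conjunct1[OF code_subgroup_codes[OF subset_refl, unfolded code_subgroup_def]])
  ultimately show ?thesis by blast
qed

text \<open>Reduces the classification of fields to one of subgroups: \<open>codes\<close> is
  injective on intermediate fields, so \<open>L\<close> is complete once the parallel list
  \<open>Ps\<close> is. The two excluded subgroups belong to \<open>K\<close> and to the whole
  field.\<close>

lemma complete_list_of_codes:
  assumes N: "codes K = Collect N"
    and L: "list_all2 (\<lambda>x P. subfield (fst x) R \<and> K \<subseteq> fst x \<and> codes (fst x) = Collect P \<and>
        dimension (fst (snd x)) K (fst x) \<and> (code_normal N P \<longleftrightarrow> snd (snd x))) L Ps"
    and dist: "distinct (map Collect Ps)"
    and all: "\<And>H. \<lbrakk>code_subgroup H; H \<subseteq> Collect N; H \<noteq> Collect N; H \<noteq> {(False, T0, T0)}\<rbrakk>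
        \<Longrightarrow> H \<in> set (map Collect Ps)"
    and strict: "Collect N \<notin> set (map Collect Ps)" "{(False, T0, T0)} \<notin> set (map Collect Ps)"
  shows "card (strict_intermediate_fields R K) = length L \<and> complete_list_of_intermediate_fields R K L"
proof -
  have map: "map codes (map fst L) = map Collect Ps"
  proof -
    have "list_all2 (\<lambda>x P. codes (fst x) = Collect P) L Ps"
      using L by (rule list_all2_mono) (elim conjE)
    then show ?thesis
      by (induction rule: list_all2_induct) (simp_all only: list.map)
  qed
  have entry: "subfield E R \<and> K \<subseteq> E \<and> dimension d K E \<and> (normal_extension R K E \<longleftrightarrow> \<nu>)"
    if mem: "(E, d, \<nu>) \<in> set L" for E d \<nu>
  proof -
    obtain i where i: "i < length L" "L ! i = (E, d, \<nu>)"
      using mem unfolding in_set_conv_nth by blast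
    define P where "P = Ps ! i"
    have P: "subfield E R" "K \<subseteq> E" "codes E = Collect P" "dimension d K E" "code_normal N P \<longleftrightarrow> \<nu>"
      using list_all2_nthD[OF L i(1)] unfolding i(2) P_def[symmetric] by (simp_all only: fst_conv
        snd_conv)
    have "normal_extension R K E \<longleftrightarrow> \<nu>"
      using P(5) unfolding normal_iff_codes[OF P(1,2)] N P(3) code_normal_def by blast
    with P show ?thesis by blast
  qed
  have dist': "distinct (map fst L)"
    using dist map distinct_map by metis
  have cset: "codes ` set (map fst L) = set (map Collect Ps)"
    unfolding map[symmetric] by (simp only: set_map)
  have "set (map fst L) = strict_intermediate_fields R K"
  proof (intro subset_antisym subsetI)
    fix E assume E: "E \<in> set (map fst L)"
    then have sub: "subfield E R" "K \<subseteq> E" using entry by force+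
    have "codes E \<in> set (map Collect Ps)" using E cset by blast
    then have "E \<noteq> K" "E \<noteq> carrier R"
      using strict N codes_carrier by (metis, metis)
    then show "E \<in> strict_intermediate_fields R K"
      using sub subfieldE(3)[OF sub(1)] by (simp add: strict_intermediate_fields_def psubset_eq)
  next
    fix E assume "E \<in> strict_intermediate_fields R K"
    then have E: "subfield E R" "K \<subseteq> E" "E \<noteq> K" "E \<noteq> carrier R"
      by (auto simp: strict_intermediate_fields_def)
    have "codes E \<noteq> Collect N" "codes E \<noteq> {(False, T0, T0)}"
      using codes_eq_iff[OF E(1,2) subfield_K] codes_eq_iff[OF E(1,2) carrier_is_subfield
        K_carrier] E(3,4)
      by (simp_all only: N codes_carrier subset_refl not_False_eq_True)
    then have "codes E \<in> codes ` set (map fst L)"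
      unfolding cset using all code_subgroup_codes[OF E(2)] codes_mono[OF E(2)] N by metis
    then obtain E' where E': "E' \<in> set (map fst L)" "codes E = codes E'" by blast
    then have "subfield E' R" "K \<subseteq> E'" using entry by force+
    then show "E \<in> set (map fst L)"
      using codes_eq_iff[OF E(1,2)] E' by metis
  qed
  then show ?thesis
    using dist' entry distinct_card[OF dist'] unfolding complete_list_of_intermediate_fields_def
    by auto
qed

definition resolvent :: "'a list" where
  "resolvent = [\<one>, \<zero>, \<ominus> ([(3 :: nat)] \<cdot> b), a \<otimes> b]"

lemma resolvent_closed: "resolvent \<in> carrier (K[X])"
proof -
  note mem = subringE(2,3,5,6,7)[OF subfieldE(1)[OF subfield_K]]
  have "b \<in> carrier R" using b_K K_carrier by auto
  then show ?thesis
    using a_K b_K mem unfolding sym[OF univ_poly_carrier] polynomial_def resolvent_def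
    by (auto simp: numeral_3_eq_3)
qed

text \<open>An irreducible cubic has no root in \<open>K\<close>. In particular 0 is not a root, and
  the resolvent is the minimal polynomial of each of its roots.\<close>

lemma irreducible_resolvent:
  assumes "pirreducible K resolvent"
  shows "\<gamma> \<otimes> root_sum k \<notin> K" "root_sum k \<noteq> \<zero>"
    "dimension 3 K (adjoin R K {\<gamma> \<otimes> root_sum k})"
proof -
  let ?t = "\<gamma> \<otimes> root_sum k"
  have e: "eval resolvent ?t = \<zero>"
    unfolding resolvent_def using eval_resolvent_eq_zero_iff[of ?t] by auto
  have m: "lead_coeff resolvent = \<one>" "length resolvent = 4"
    by (simp_all add: resolvent_def)
  show nK: "?t \<notin> K"
    using irreducible_no_root[OF subfield_K resolvent_closed assms m(1)] e m(2) by auto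
  then show "root_sum k \<noteq> \<zero>"
    using subringE(2)[OF subfieldE(1)[OF subfield_K]] by auto
  have "?t \<in> carrier R" by simp
  note irr = Irr_eq_irreducible[OF subfield_K this resolvent_closed assms m(1) e]
  show "dimension 3 K (adjoin R K {?t})"
    using dimension_adjoin[OF subfield_K _ irr(2)] by (simp add: irr(1) m(2))
qed

lemma reducible_resolvent:
  assumes "\<not> pirreducible K resolvent"
  obtains k where "\<gamma> \<otimes> root_sum k \<in> K"
proof -
  obtain x where "x \<in> K" "eval resolvent x = \<zero>"
    using reducible_cubic_root[OF subfield_K resolvent_closed _ assms] by (auto simp: resolvent_def)
  then show thesis
    using that eval_resolvent_eq_zero_iff[of x] K_carrier unfolding resolvent_def by blast
qed

lemma K_mem_iff:
  "\<gamma> \<in> K \<longleftrightarrow> codes K \<subseteq> Collect fix_gamma" "\<gamma> \<otimes> root_sum k \<in> K \<longleftrightarrow> codes K \<subseteq> Collect (fix_root k)"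
  "\<delta> \<in> K \<longleftrightarrow> codes K \<subseteq> Collect fix_delta"
  using mem_iff_codes[OF subfield_K subset_refl] fixed_iff_gamma fixed_iff_root fixed_iff_delta
  by blast+

end


section \<open>Normal subgroups and intermediate subgroups in the three cases\<close>

lemma code_normal_UNIV:
  "code_normal (\<lambda>_. True) fix_delta" "code_normal (\<lambda>_. True) fix_gamma" "\<not> code_normal (\<lambda>_. True)
    (fix_root k)"
  "code_normal (\<lambda>_. True) (\<lambda>x. fix_delta x \<and> fix_root T0 x)"
  "code_normal (\<lambda>_. True) (\<lambda>x. fix_delta x \<and> fix_gamma x)"
  "\<not> code_normal (\<lambda>_. True) fix_alpha" "\<not> code_normal (\<lambda>_. True) fix_beta"
  "\<not> code_normal (\<lambda>_. True) (\<lambda>x. fix_gamma x \<and> fix_root k x)"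
  unfolding code_normal_def
  by (cases k; simp add: split_paired_All all_bool_eq all_tri)+

text \<open>\<open>fix_gamma\<close> is a copy of S3: its rotations fix \<delta>, and each of its
  reflections fixes one resolvent root.\<close>

lemma code_normal_fix_gamma:
  "code_normal fix_gamma (\<lambda>x. fix_gamma x \<and> fix_delta x)" "\<not> code_normal fix_gamma (\<lambda>x. fix_gamma
    x \<and> fix_root k x)"
  unfolding code_normal_def
  by (cases k; simp add: split_paired_All all_bool_eq all_tri)+

text \<open>\<open>fix_root k\<close> is cyclic of order 6, so all its subgroups are normal.\<close>

lemma code_normal_fix_root:
  "code_normal (fix_root k) (\<lambda>x. fix_root k x \<and> fix_delta x)" "code_normal (fix_root k) (\<lambda>x.
    fix_root k x \<and> fix_gamma x)"
  unfolding code_normal_def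
  by (cases k; simp add: split_paired_All all_bool_eq all_tri)+

lemma distinct_code_subgroups: "distinct (map Collect [fix_delta, fix_gamma, fix_root T0, fix_root
  T1, fix_root T2,
    \<lambda>x. fix_delta x \<and> fix_root T0 x, \<lambda>x. fix_delta x \<and> fix_gamma x, fix_alpha, fix_beta,
    \<lambda>x. fix_gamma x \<and> fix_root T0 x, \<lambda>x. fix_gamma x \<and> fix_root T1 x, \<lambda>x. fix_gamma x \<and> fix_root T2 x])"
  by (simp add: code_eqs)

lemma fix_alpha_beta: "{x. fix_alpha x \<and> fix_beta x} = {(False, T0, T0)}"
  by auto

lemma code_subgroup_between_fix_root:
  assumes "code_subgroup H" and sub: "H \<subseteq> Collect (fix_root k)"
    and neq: "H \<noteq> Collect (fix_root k)" "H \<noteq> {(False, T0, T0)}"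
  shows "H = {x. fix_root k x \<and> fix_delta x} \<or> H = {x. fix_root k x \<and> fix_gamma x}"
proof -
  have no: "\<not> UNIV \<subseteq> Collect (fix_root k)" "\<not> {x. fix_delta x} \<subseteq> Collect (fix_root k)"
    "\<not> {x. fix_gamma x} \<subseteq> Collect (fix_root k)" "\<not> {x. fix_delta x \<and> fix_gamma x} \<subseteq> Collect
      (fix_root k)"
    "\<not> {x. fix_alpha x} \<subseteq> Collect (fix_root k)" "\<not> {x. fix_beta x} \<subseteq> Collect (fix_root k)"
    by (cases k; simp add: code_eqs)+
  have neq_no: "H \<noteq> S" if "\<not> S \<subseteq> Collect (fix_root k)" for S
    using that sub by blast
  \<comment> \<open>The index k matters only for swaps, so the index 0 of the classification stands
    for any k.\<close>
  have delta: "{x. fix_delta x \<and> fix_root T0 x} = {x. fix_root k x \<and> fix_delta x}"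
    by (auto split: if_splits)
  have t: "{x. fix_root l x} \<subseteq> Collect (fix_root k) \<Longrightarrow> {x. fix_root l x} = Collect (fix_root k)" for l
    by (cases k; cases l; simp add: code_eqs)
  have ct: "{x. fix_gamma x \<and> fix_root l x} \<subseteq> Collect (fix_root k) \<Longrightarrow>
      {x. fix_gamma x \<and> fix_root l x} = {x. fix_root k x \<and> fix_gamma x}" for l
    by (cases k; cases l; simp add: code_eqs)
  have neq_t: "H \<noteq> {x. fix_root l x}" for l
    using t[of l] sub neq(1) by metis
  have eq_ct: "H = {x. fix_root k x \<and> fix_gamma x}" if "H = {x. fix_gamma x \<and> fix_root l x}" for l
    using ct[OF sub[unfolded that]] that by (rule trans[rotated])
  show ?thesis
    using code_subgroup_cases[OF assms(1), unfolded fix_alpha_beta delta insert_iff empty_iff]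
    by (elim disjE)
      (erule no[THEN neq_no, THEN notE] neq_t[THEN notE] neq(2)[THEN notE] eq_ct[THEN disjI2]
        disjI1 FalseE)+
qed

lemma code_subgroup_between_fix_gamma:
  assumes "code_subgroup H" and sub: "H \<subseteq> Collect fix_gamma"
    and neq: "H \<noteq> Collect fix_gamma" "H \<noteq> {(False, T0, T0)}"
  shows "H = {x. fix_gamma x \<and> fix_delta x} \<or> H = {x. fix_gamma x \<and> fix_root T0 x} \<or>
    H = {x. fix_gamma x \<and> fix_root T1 x} \<or> H = {x. fix_gamma x \<and> fix_root T2 x}"
proof -
  have no: "\<not> UNIV \<subseteq> Collect fix_gamma" "\<not> {x. fix_delta x} \<subseteq> Collect fix_gamma"
    "\<not> {x. fix_delta x \<and> fix_root T0 x} \<subseteq> Collect fix_gamma"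
    "\<not> {x. fix_alpha x} \<subseteq> Collect fix_gamma" "\<not> {x. fix_beta x} \<subseteq> Collect fix_gamma"
    by (simp add: code_eqs)+
  have no_t: "\<not> {x. fix_root k x} \<subseteq> Collect fix_gamma" for k
    by (cases k; simp add: code_eqs)
  have neq_no: "H \<noteq> S" if "\<not> S \<subseteq> Collect fix_gamma" for S
    using that sub by blast
  have delta: "{x. fix_delta x \<and> fix_gamma x} = {x. fix_gamma x \<and> fix_delta x}"
    by auto
  show ?thesis
    using code_subgroup_cases[OF assms(1), unfolded fix_alpha_beta delta insert_iff empty_iff]
    by (elim disjE)
      (erule no[THEN neq_no, THEN notE] no_t[THEN neq_no, THEN notE] neq[THEN notE] FalseE
        | (intro disjI1, assumption) | (intro disjI2, assumption) | (rule disjI2, rule disjI1,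
          assumption)
        | (rule disjI2, rule disjI2, rule disjI1, assumption))+
qed


section \<open>The lists of fields in the three cases\<close>

context cubic_pair
begin

lemma adjoin_props:
  assumes "S \<subseteq> carrier R"
  shows "subfield (adjoin R K S) R" "K \<subseteq> adjoin R K S"
  using subfield_adjoin[OF K_carrier assms] adjoin_incl(1)[OF K_carrier assms] by auto

lemma codes_adjoin_pair:
  assumes "fixed_iff x P" "fixed_iff y Q"
  shows "codes (adjoin R K {x}) = {z \<in> codes K. P z}"
    and "codes (adjoin R K {x, y}) = {z \<in> codes K. P z \<and> Q z}"
  using codes_adjoin_list[of "[x]" "[P]"] codes_adjoin_list[of "[x, y]" "[P, Q]"] assms by simp_all

lemma Irr_root:
  assumes "pirreducible K trinomial" "x \<in> {\<alpha>, \<beta>}"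
  shows "Irr K x = trinomial" "(algebraic over K) x"
proof -
  have m: "lead_coeff trinomial = \<one>" by (simp add: trinomial_def)
  show "Irr K x = trinomial" "(algebraic over K) x"
    using Irr_eq_irreducible[OF subfield_K _ trinomial_closed assms(1) m] assms(2) trinomial_roots
      by auto
qed

lemma dimension_adjoin_root:
  assumes "pirreducible K trinomial"
  shows "dimension 6 K (adjoin R K {\<alpha>})" "dimension 6 K (adjoin R K {\<beta>})"
  using dimension_adjoin[OF subfield_K _ Irr_root(2)[OF assms], of \<alpha>]
    dimension_adjoin[OF subfield_K _ Irr_root(2)[OF assms], of \<beta>]
  by (simp_all add: Irr_root(1)[OF assms] trinomial_def eval_nat_numeral)

text \<open>If \<delta> were in \<open>K\<close>, so would be \<alpha>^3, and \<alpha> would have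
  degree at most 3 in place of 6.\<close>

lemma delta_notin:
  assumes "pirreducible K trinomial"
  shows "\<delta> \<notin> K"
proof
  assume "\<delta> \<in> K"
  then have c: "\<alpha> [^] (3 :: nat) \<in> K"
    using cubes_mem(1)[OF subfield_K subset_refl] by simp
  let ?p = "[\<one>, \<zero>, \<zero>, \<ominus> (\<alpha> [^] (3 :: nat))]"
  have p: "?p \<in> carrier (K[X])"
    using c subringE(2,3,5)[OF subfieldE(1)[OF subfield_K]]
    unfolding sym[OF univ_poly_carrier] polynomial_def by auto
  have alg: "(algebraic over K) \<alpha>" and irr: "Irr K \<alpha> = trinomial"
    using Irr_root[OF assms, of \<alpha>] by simp_all
  have "eval ?p \<alpha> = \<zero>"
    by (simp add: r_neg numeral_3_eq_3)
  then have "degree (Irr K \<alpha>) \<le> degree ?p"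
    using pdivides_imp_degree_le[OF subfieldE(1)[OF subfield_K] IrrE(1)[OF subfield_K alpha_closed
      alg] p]
      Irr_minimal[OF subfield_K alpha_closed alg p] by simp
  then show False by (simp add: irr trinomial_def)
qed

text \<open>Some resolvent root, for an unspecified k, lies in \<open>K\<close>, while \<delta> and
  \<gamma> do not. The group is therefore cyclic of order 6, with two proper nontrivial
  subgroups.\<close>

theorem intermediate_fields_A:
  assumes c: "\<gamma> \<notin> K" and r: "\<not> pirreducible K resolvent" and f: "pirreducible K trinomial"
  shows "card (strict_intermediate_fields R K) = 2 \<and> complete_list_of_intermediate_fields R K
    [(adjoin R K {\<delta>}, 2, True), (adjoin R K {\<gamma>}, 3, True)]"
proof -
  obtain k where k: "\<gamma> \<otimes> root_sum k \<in> K"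
    using reducible_resolvent[OF r] .
  have N: "codes K = Collect (fix_root k)"
    using code_subgroup_eq_fix_root[OF code_subgroup_codes[OF subset_refl] delta_notin[OF f,
      unfolded K_mem_iff(3)]] c k
    unfolding K_mem_iff(1,2) by blast
  let ?Ps = "[\<lambda>x. fix_root k x \<and> fix_delta x, \<lambda>x. fix_root k x \<and> fix_gamma x]"
  have "list_all2 (\<lambda>x P. subfield (fst x) R \<and> K \<subseteq> fst x \<and> codes (fst x) = Collect P \<and>
      dimension (fst (snd x)) K (fst x) \<and> (code_normal (fix_root k) P \<longleftrightarrow> snd (snd x)))
      [(adjoin R K {\<delta>}, 2, True), (adjoin R K {\<gamma>}, 3, True)] ?Ps"
    using adjoin_props codes_adjoin_pair[OF fixed_iff_delta fixed_iff_delta]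
      codes_adjoin_pair[OF fixed_iff_gamma fixed_iff_gamma] dimension_adjoin_delta[OF subfield_K
        subset_refl delta_notin[OF f]]
      dimension_adjoin_gamma[OF subfield_K subset_refl c]
    by (simp add: N code_normal_fix_root)
  moreover have "distinct (map Collect ?Ps)" "Collect (fix_root k) \<notin> set (map Collect ?Ps)"
      "{(False, T0, T0)} \<notin> set (map Collect ?Ps)"
    by (cases k; simp add: code_eqs)+
  moreover have "H \<in> set (map Collect ?Ps)"
    if "code_subgroup H" "H \<subseteq> Collect (fix_root k)" "H \<noteq> Collect (fix_root k)" "H \<noteq> {(False, T0,
      T0)}" for H
    using code_subgroup_between_fix_root[OF that] by simp
  ultimately show ?thesis
    using complete_list_of_codes[OF N, of "[(adjoin R K {\<delta>}, 2, True), (adjoin R K {\<gamma>}, 3, True)]" ?Ps]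
    by simp
qed

text \<open>The group is S3. As \<gamma> \<in> K, adjoining \<open>root_sum k\<close> is the same as
  adjoining a root of the resolvent, hence degree 3.\<close>

theorem intermediate_fields_B:
  assumes c: "\<gamma> \<in> K" and r: "pirreducible K resolvent" and f: "pirreducible K trinomial"
  shows "card (strict_intermediate_fields R K) = 4 \<and> complete_list_of_intermediate_fields R K
    [(adjoin R K {\<delta>}, 2, True), (adjoin R K {root_sum T0}, 3, False),
     (adjoin R K {root_sum T1}, 3, False), (adjoin R K {root_sum T2}, 3, False)]"
    (is "_ \<and> complete_list_of_intermediate_fields R K ?L")
proof -
  note irr = irreducible_resolvent[OF r]
  have N: "codes K = Collect fix_gamma"
    using code_subgroup_eq_fix_gamma[OF code_subgroup_codes[OF subset_refl] delta_notin[OF f,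
      unfolded K_mem_iff(3)]] c irr(1)
    unfolding K_mem_iff(1,2) by blast
  have root: "adjoin R K {root_sum k} = adjoin R K {\<gamma> \<otimes> root_sum k}" for k
  proof -
    have "\<gamma> \<in> adjoin R K {\<gamma> \<otimes> root_sum k}"
      using adjoin_props(2)[of "{\<gamma> \<otimes> root_sum k}"] c by auto
    then have "adjoin R K {\<gamma>, \<gamma> \<otimes> root_sum k} = adjoin R K {\<gamma> \<otimes> root_sum k}"
      using c unfolding adjoin_def by (simp add: insert_absorb)
    then show ?thesis
      using adjoin_root_sum[OF irr(2)] by simp
  qed
  let ?Ps = "[\<lambda>x. fix_gamma x \<and> fix_delta x, \<lambda>x. fix_gamma x \<and> fix_root T0 x, \<lambda>x. fix_gamma x \<and>
    fix_root T1 x,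
    \<lambda>x. fix_gamma x \<and> fix_root T2 x]"
  have "list_all2 (\<lambda>x P. subfield (fst x) R \<and> K \<subseteq> fst x \<and> codes (fst x) = Collect P \<and>
      dimension (fst (snd x)) K (fst x) \<and> (code_normal fix_gamma P \<longleftrightarrow> snd (snd x))) ?L ?Ps"
    using adjoin_props codes_adjoin_pair(1)[OF fixed_iff_delta fixed_iff_delta]
      codes_adjoin_pair(1)[OF fixed_iff_root fixed_iff_delta]
      dimension_adjoin_delta[OF subfield_K subset_refl delta_notin[OF f]] irr(3)
    by (simp add: N code_normal_fix_gamma root)
  moreover have "distinct (map Collect ?Ps)" "Collect fix_gamma \<notin> set (map Collect ?Ps)"
      "{(False, T0, T0)} \<notin> set (map Collect ?Ps)"
    by (simp add: code_eqs)+
  moreover have "H \<in> set (map Collect ?Ps)"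
    if "code_subgroup H" "H \<subseteq> Collect fix_gamma" "H \<noteq> Collect fix_gamma" "H \<noteq> {(False, T0, T0)}" for H
    using code_subgroup_between_fix_gamma[OF that] by simp
  ultimately show ?thesis
    using complete_list_of_codes[OF N, of ?L ?Ps] by simp
qed

text \<open>All 18 codes occur, and the 12 fields match the 14 subgroups without the two extreme
  ones. Degrees 9 and 6 arise from a cubic field by adjoining \<gamma> or \<delta>, except that
  \<alpha> and \<beta> have degree 6 as roots of the irreducible trinomial.\<close>

theorem intermediate_fields_C:
  assumes c: "\<gamma> \<notin> K" and r: "pirreducible K resolvent" and f: "pirreducible K trinomial"
  shows "card (strict_intermediate_fields R K) = 12 \<and> complete_list_of_intermediate_fields R K
    [(adjoin R K {\<delta>}, 2, True), (adjoin R K {\<gamma>}, 3, True), (adjoin R K {\<gamma> \<otimes> root_sum T0}, 3, False),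
     (adjoin R K {\<gamma> \<otimes> root_sum T1}, 3, False), (adjoin R K {\<gamma> \<otimes> root_sum T2}, 3, False),
     (adjoin R K {\<delta>, \<gamma> \<otimes> root_sum T0}, 6, True), (adjoin R K {\<delta>, \<gamma>}, 6, True),
     (adjoin R K {\<alpha>}, 6, False), (adjoin R K {\<beta>}, 6, False),
     (adjoin R K {root_sum T0}, 9, False), (adjoin R K {root_sum T1}, 9, False),
     (adjoin R K {root_sum T2}, 9, False)]"
    (is "_ \<and> complete_list_of_intermediate_fields R K ?L")
proof -
  note irr = irreducible_resolvent[OF r]
  have UNIV: "codes K = UNIV"
    using code_subgroup_eq_UNIV[OF code_subgroup_codes[OF subset_refl] delta_notin[OF f, unfolded
      K_mem_iff(3)]] c irr(1)
    unfolding K_mem_iff(1,2) by blast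
  then have N: "codes K = Collect (\<lambda>_. True)" by simp
  note root = adjoin_root_sum[OF irr(2)]
  note codes_simps = codes_adjoin_pair(1)[OF fixed_iff_delta fixed_iff_delta]
    codes_adjoin_pair(1)[OF fixed_iff_gamma fixed_iff_delta]
    codes_adjoin_pair(1)[OF fixed_iff_root fixed_iff_delta]
    codes_adjoin_pair(2)[OF fixed_iff_delta fixed_iff_root]
    codes_adjoin_pair(2)[OF fixed_iff_delta fixed_iff_gamma]
    codes_adjoin_pair(1)[OF fixed_iff_alpha fixed_iff_delta]
    codes_adjoin_pair(1)[OF fixed_iff_beta fixed_iff_delta]
    codes_adjoin_pair(2)[OF fixed_iff_gamma fixed_iff_root]
  have tower: "dimension (n * m) K (adjoin R K {y, x})"
    if "x \<in> carrier R" "y \<in> carrier R" "dimension n K (adjoin R K {x})"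
      "dimension m (adjoin R K {x}) (adjoin R (adjoin R K {x}) {y})" for n m x y
    using telescopic_base[OF subfield_K adjoin_props(1) that(3,4)] that(1,2)
    by (simp add: adjoin_adjoin[OF K_carrier] insert_commute)
  have dim_t_gamma: "dimension 9 K (adjoin R K {\<gamma>, \<gamma> \<otimes> root_sum k})" for k
  proof -
    \<comment> \<open>The witness code (False, T1, T1) multiplies both \<alpha> and \<beta> by
      \<zeta>: it fixes every resolvent root but moves \<gamma>.\<close>
    have "\<gamma> \<notin> adjoin R K {\<gamma> \<otimes> root_sum k}"
      using mem_iff_codes[OF adjoin_props fixed_iff_gamma, of "{\<gamma> \<otimes> root_sum k}"]
      by (auto simp: codes_simps UNIV intro!: exI[of _ False] exI[of _ T1])
    then show ?thesis
      using tower[of "\<gamma> \<otimes> root_sum k" \<gamma> 3 3] irr(3) dimension_adjoin_gamma adjoin_props[of "{\<gamma> \<otimes>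
        root_sum k}"]
      by simp
  qed
  have dim_delta: "dimension 6 K (adjoin R K {\<delta>, x})"
    if "x \<in> carrier R" "dimension 3 K (adjoin R K {x})" "fixed_iff x P" "P (True, T0, T0)" for x P
  proof -
    \<comment> \<open>The exchange of \<alpha> and \<beta> fixes \<open>x\<close> and moves
      \<delta>.\<close>
    have "\<delta> \<notin> adjoin R K {x}"
      using mem_iff_codes[OF adjoin_props fixed_iff_delta, of "{x}"] that
      by (auto simp: codes_adjoin_pair(1)[OF that(3) that(3)] UNIV intro!: exI[of _ True] exI[of _ T0])
    then show ?thesis
      using tower[of x \<delta> 3 2] dimension_adjoin_delta adjoin_props[of "{x}"] that by simp
  qed
  note dims = dimension_adjoin_delta[OF subfield_K subset_refl delta_notin[OF f]]
    dimension_adjoin_gamma[OF subfield_K subset_refl c] irr(3) dim_t_gamma dimension_adjoin_root[OF f]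
    dim_delta[OF gamma_closed _ fixed_iff_gamma] dim_delta[OF _ _ fixed_iff_root]
  let ?Ps = "[fix_delta, fix_gamma, fix_root T0, fix_root T1, fix_root T2,
    \<lambda>x. fix_delta x \<and> fix_root T0 x, \<lambda>x. fix_delta x \<and> fix_gamma x, fix_alpha, fix_beta,
    \<lambda>x. fix_gamma x \<and> fix_root T0 x, \<lambda>x. fix_gamma x \<and> fix_root T1 x, \<lambda>x. fix_gamma x \<and> fix_root T2 x]"
  have "list_all2 (\<lambda>x P. subfield (fst x) R \<and> K \<subseteq> fst x \<and> codes (fst x) = Collect P \<and>
      dimension (fst (snd x)) K (fst x) \<and> (code_normal (\<lambda>_. True) P \<longleftrightarrow> snd (snd x))) ?L ?Ps"
    using adjoin_props
    by (simp add: UNIV code_normal_UNIV root codes_simps dims)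
  moreover note distinct_code_subgroups
  moreover have "Collect (\<lambda>_. True) \<notin> set (map Collect ?Ps)"
      "{(False, T0, T0)} \<notin> set (map Collect ?Ps)"
    by (simp add: code_eqs)+
  moreover have "H \<in> set (map Collect ?Ps)"
    if "code_subgroup H" "H \<noteq> Collect (\<lambda>_. True)" "H \<noteq> {(False, T0, T0)}" for H
  proof -
    have "{x. fix_alpha x \<and> fix_beta x} = {(False, T0, T0)}" by auto
    then show ?thesis
      using code_subgroup_cases[OF that(1)] that(2,3)
      by (elim insertE emptyE) simp_all
  qed
  ultimately show ?thesis
    using complete_list_of_codes[OF N, of ?L ?Ps] by simp
qed

end


section \<open>Transfer from the hypotheses of the theorem to the locale\<close>

lemma (in field) ring_char_subfield:
  assumes K: "subfield K R"
  shows "ring_char (R\<lparr>carrier := K\<rparr>) \<noteq> 2 \<Longrightarrow> [(2 :: nat)] \<cdot> \<one> \<noteq> \<zero>"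
    and "ring_char (R\<lparr>carrier := K\<rparr>) \<noteq> 2 \<Longrightarrow> ring_char (R\<lparr>carrier := K\<rparr>) \<noteq> 3 \<Longrightarrow> [(3 :: nat)] \<cdot> \<one> \<noteq> \<zero>"
proof -
  let ?S = "R\<lparr>carrier := K\<rparr>"
  have pow: "add_pow ?S n \<one> = [n] \<cdot> \<one>" for n :: nat
    by (simp add: add_pow_def nat_pow_def)
  have one: "[Suc 0] \<cdot> \<one> \<noteq> \<zero>" by simp
  have char: "ring_char ?S = n" if "n > 0" "[n] \<cdot> \<one> = \<zero>" "\<And>m. \<lbrakk>0 < m; m < n\<rbrakk> \<Longrightarrow> [m] \<cdot> \<one> \<noteq> \<zero>" for n :: nat
  proof -
    have "(LEAST m. m > 0 \<and> [m] \<cdot> \<one> = \<zero>) = n"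
      using that by (intro Least_equality) (auto simp: not_less[symmetric])
    then show ?thesis
      unfolding ring_char_def using that(1,2) by (auto simp: pow)
  qed
  show two: "[(2 :: nat)] \<cdot> \<one> \<noteq> \<zero>" if "ring_char ?S \<noteq> 2"
  proof
    assume "[(2 :: nat)] \<cdot> \<one> = \<zero>"
    moreover have "[m] \<cdot> \<one> \<noteq> \<zero>" if "0 < m" "m < 2" for m :: nat
    proof -
      have "m = Suc 0" using that by simp
      then show ?thesis using one by simp
    qed
    ultimately show False using char[of 2] that by simp
  qed
  show "[(3 :: nat)] \<cdot> \<one> \<noteq> \<zero>" if "ring_char ?S \<noteq> 2" "ring_char ?S \<noteq> 3"
  proof
    assume "[(3 :: nat)] \<cdot> \<one> = \<zero>"
    moreover have "[m] \<cdot> \<one> \<noteq> \<zero>" if m: "0 < m" "m < 3" for m :: nat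
    proof -
      have "m = Suc 0 \<or> m = 2" using m by auto
      \<comment> \<open>For 3 to be the least annihilating multiple, 2 must be nonzero; hence this
        claim also assumes characteristic different from 2.\<close>
      then show ?thesis using one two[OF \<open>ring_char ?S \<noteq> 2\<close>] by auto
    qed
    ultimately show False using char[of 3] that by simp
  qed
qed

lemma (in field) cubic_pairI:
  assumes K: "subfield K R" and char: "ring_char (R\<lparr>carrier := K\<rparr>) \<noteq> 2" "ring_char (R\<lparr>carrier :=
    K\<rparr>) \<noteq> 3"
    and z: "\<zeta> \<in> K" "primitive_root_of_unity R 3 \<zeta>"
    and ab: "a \<in> K" "b \<in> K" and f: "f = [\<one>, \<zero>, \<zero>, a, \<zero>, \<zero>, b]" "pirreducible K f"
    and split: "splitting_field_over R K f"
    and roots: "is_root f \<alpha>" "is_root f \<beta>" "\<alpha> [^] (3 :: nat) \<noteq> \<beta> [^] (3 :: nat)"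
    and \<delta>: "\<delta> \<in> carrier R" "\<delta> [^] (2 :: nat) = a [^] (2 :: nat) \<ominus> [(4 :: nat)] \<cdot> b"
  shows "cubic_pair R K \<zeta> \<alpha> \<beta> \<delta> a b"
proof -
  note KR = subfieldE(3)[OF K] and Ksub = subringE(2,3,5,6,7)[OF subfieldE(1)[OF K]]
  have car: "\<zeta> \<in> carrier R" "a \<in> carrier R" "b \<in> carrier R" "\<alpha> \<in> carrier R" "\<beta> \<in> carrier R"
    using z(1) ab KR roots(1,2) by (auto simp: is_root_def)
  have zeta: "\<zeta> [^] (3 :: nat) = \<one>" "\<zeta> \<noteq> \<one>"
    using z(2) unfolding primitive_root_of_unity_def by (auto dest: spec[of _ 1])
  interpret field_with_cube_root R K \<zeta>
  proof (intro field_with_cube_root.intro field_with_cube_root_axioms.intro field_axioms K z(1)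
      ring_char_subfield(1)[OF K char(1)] ring_char_subfield(2)[OF K char])
    have "(\<zeta> \<ominus> \<one>) \<otimes> (\<zeta> [^] (2 :: nat) \<oplus> \<zeta> \<oplus> \<one>) = \<zeta> [^] (3 :: nat) \<ominus> \<one>"
      using car(1) by (elim section_atE) (simp only: section_at_simps, rule arg_cong[of _ _
        "section_at R"],
        simp add: algebra_simps power2_eq_square power3_eq_cube)
    then show "\<zeta> [^] (2 :: nat) \<oplus> \<zeta> \<oplus> \<one> = \<zero>"
      using car(1) zeta by (simp add: minus_eq r_neg integral_iff) (simp add: minus_eq[symmetric])
  qed
  define A B where "A = \<alpha> [^] (3 :: nat)" and "B = \<beta> [^] (3 :: nat)"
  have AB: "A \<in> carrier R" "B \<in> carrier R" "A \<noteq> B"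
    using car roots(3) by (simp_all add: A_def B_def)
  have root: "x [^] (3 :: nat) \<otimes> x [^] (3 :: nat) \<oplus> (a \<otimes> x [^] (3 :: nat) \<oplus> b) = \<zero>" if "is_root f
    x" for x
    using that eval_trinomial[of x a b] car(2,3) unfolding is_root_def f(1) by metis
  have rA: "A \<otimes> A \<oplus> (a \<otimes> A \<oplus> b) = \<zero>" and rB: "B \<otimes> B \<oplus> (a \<otimes> B \<oplus> b) = \<zero>"
    using root[OF roots(1)] root[OF roots(2)] by (simp_all add: A_def B_def)
  have zero_minus: "\<zero> \<ominus> \<zero> = \<zero>"
    by (simp add: minus_eq)
  \<comment> \<open>Vieta's formulas: subtracting the equations of A and B and cancelling A - B
    gives the sum, and the sum then gives the product.\<close>
  have "(A \<ominus> B) \<otimes> (A \<oplus> B \<oplus> a) = (A \<otimes> A \<oplus> (a \<otimes> A \<oplus> b)) \<ominus> (B \<otimes> B \<oplus> (a \<otimes> B \<oplus> b))"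
    using AB(1,2) car(2,3)
    by (elim section_atE) (simp only: section_at_simps, rule arg_cong[of _ _ "section_at R"],
        simp add: algebra_simps)
  then have "A \<oplus> B \<oplus> a = \<zero>"
    using AB car(2) by (simp add: rA rB zero_minus integral_iff)
  then have sum: "A \<oplus> B = \<ominus> a"
    using AB car(2) by (metis a_closed minus_equality)
  have "A \<otimes> B = (A \<oplus> B \<oplus> a) \<otimes> A \<ominus> (A \<otimes> A \<oplus> (a \<otimes> A \<oplus> b)) \<oplus> b"
    using AB(1,2) car(2,3)
    by (elim section_atE) (simp only: section_at_simps, rule arg_cong[of _ _ "section_at R"],
        simp add: algebra_simps)
  then have prod: "A \<otimes> B = b"
    using AB car(3) by (simp add: \<open>A \<oplus> B \<oplus> a = \<zero>\<close> rA zero_minus)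
  have fK: "f \<in> carrier (K[X])"
    using ab Ksub unfolding sym[OF univ_poly_carrier] polynomial_def by (auto simp: f(1))
  \<comment> \<open>A zero root would lie in \<open>K\<close>, although \<open>f\<close> is
    irreducible of degree 6.\<close>
  have nz: "x \<noteq> \<zero>" if "is_root f x" for x
    using irreducible_no_root[OF K fK f(2), of x] that Ksub(1) by (auto simp: is_root_def f(1))
  \<comment> \<open>The squares of \<delta> and of A - B both equal the discriminant, so \<delta> is
    one of the two differences.\<close>
  have "(\<delta> \<ominus> (A \<ominus> B)) \<otimes> (\<delta> \<ominus> (B \<ominus> A)) =
      \<delta> [^] (2 :: nat) \<ominus> ((A \<oplus> B) [^] (2 :: nat) \<ominus> [(4 :: nat)] \<cdot> (A \<otimes> B))"
    using AB(1,2) \<delta>(1)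
    by (elim section_atE) (simp only: section_at_simps, rule arg_cong[of _ _ "section_at R"],
        simp add: algebra_simps power2_eq_square)
  also have "(A \<oplus> B) [^] (2 :: nat) = a [^] (2 :: nat)"
    using car(2) by (simp add: sum numeral_2_eq_2 l_minus r_minus)
  finally have "(\<delta> \<ominus> (A \<ominus> B)) \<otimes> (\<delta> \<ominus> (B \<ominus> A)) = \<zero>"
    using car(2,3) by (simp add: \<delta>(2) prod minus_eq r_neg)
  then have delta: "\<delta> = A \<ominus> B \<or> \<delta> = B \<ominus> A"
    using AB \<delta>(1) by (simp add: integral_iff)
  let ?M = "adjoin R K {\<alpha>, \<beta>}"
  have S: "{\<alpha>, \<beta>} \<subseteq> carrier R" using car by simp
  note M = subfield_adjoin[OF KR S] adjoin_incl[OF KR S]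
  \<comment> \<open>The cube of any root of \<open>f\<close> is A or B, so the root is \<alpha> or
    \<beta> times a power of \<zeta> and lies in \<open>?M\<close>.\<close>
  have "x \<in> ?M" if x: "is_root f x" for x
  proof -
    define Y where "Y = x [^] (3 :: nat)"
    have xR: "x \<in> carrier R" using x by (simp add: is_root_def)
    then have YR: "Y \<in> carrier R" by (simp add: Y_def)
    have "(Y \<ominus> A) \<otimes> (Y \<ominus> B) = Y \<otimes> Y \<ominus> (A \<oplus> B) \<otimes> Y \<oplus> A \<otimes> B"
      using AB(1,2) YR
      by (elim section_atE) (simp only: section_at_simps, rule arg_cong[of _ _ "section_at R"],
        simp add: algebra_simps)
    also have "\<dots> = Y \<otimes> Y \<oplus> (a \<otimes> Y \<oplus> b)"
      using YR car by (simp add: sum prod minus_eq l_minus a_assoc)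
    also have "\<dots> = \<zero>" using root[OF x] by (simp add: Y_def)
    finally have "Y = A \<or> Y = B" using AB YR by (simp add: integral_iff)
    then show ?thesis
      using root_of_cube_mem[OF M(1,2) _ xR, of \<alpha>] root_of_cube_mem[OF M(1,2) _ xR, of \<beta>] M(3)
      by (auto simp: Y_def A_def B_def)
  qed
  then have "adjoin R K {x. is_root f x} \<subseteq> ?M"
    using adjoin_minimal[OF KR _ M(1,2), of "{x. is_root f x}"] by (auto simp: is_root_def)
  moreover have "adjoin R K {x. is_root f x} = carrier R"
    using split by (simp add: splitting_field_over_def)
  ultimately have gen: "?M = carrier R"
    using subfieldE(3)[OF M(1)] by auto
  show ?thesis
    using car ab sum prod AB(3) nz roots gen delta
    by (intro cubic_pair.intro cubic_pair_axioms.intro field_with_cube_root_axioms)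
      (simp_all add: A_def B_def)
qed

theorem mainTheorem7:
  fixes F :: "('a, 'b) ring_scheme" (structure)
    and K :: "'a set"
    and \<zeta> a b \<Delta> \<delta> \<alpha> \<beta> c :: 'a
    and f r :: "'a list"
  assumes "field F" and "subfield K F"
    and "ring_char (F\<lparr>carrier := K\<rparr>) \<noteq> 2" and "ring_char (F\<lparr>carrier := K\<rparr>) \<noteq> 3"
    and "\<zeta> \<in> K" and "primitive_root_of_unity F 3 \<zeta>"
    and "a \<in> K" and "b \<in> K"
    and "f = [\<one>, \<zero>, \<zero>, a, \<zero>, \<zero>, b]"
    and "pirreducible K f"
    and "splitting_field_over F K f"
    and "\<Delta> = a [^] (2::nat) \<ominus> [(4::nat)] \<cdot> b"
    and "r = [\<one>, \<zero>, \<ominus> ([(3::nat)] \<cdot> b), a \<otimes> b]"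
    and "ring.is_root F f \<alpha>" and "ring.is_root F f \<beta>"
    and "\<alpha> [^] (3::nat) \<noteq> \<beta> [^] (3::nat)"
    and "c = \<alpha> \<otimes> \<beta>"
    and "\<delta> \<in> carrier F" and "\<delta> [^] (2::nat) = \<Delta>"
  shows
    "((\<forall>x\<in>K. x [^] (3::nat) \<noteq> b) \<and> \<not> pirreducible K r \<longrightarrow>
        card (strict_intermediate_fields F K) = 2 \<and>
        complete_list_of_intermediate_fields F K
          [(adjoin F K {\<delta>}, 2, True),
           (adjoin F K {c}, 3, True)])
   \<and> ((\<forall>x\<in>carrier F. x [^] (3::nat) = b \<longrightarrow> x \<in> K) \<and> pirreducible K r \<longrightarrow>
        card (strict_intermediate_fields F K) = 4 \<and>
        complete_list_of_intermediate_fields F K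
          [(adjoin F K {\<delta>}, 2, True),
           (adjoin F K {\<alpha> \<oplus> \<beta>}, 3, False),
           (adjoin F K {\<alpha> \<otimes> \<zeta> \<oplus> \<beta> \<otimes> \<zeta> [^] (2::nat)}, 3, False),
           (adjoin F K {\<alpha> \<otimes> \<zeta> [^] (2::nat) \<oplus> \<beta> \<otimes> \<zeta>}, 3, False)])
   \<and> ((\<forall>x\<in>K. x [^] (3::nat) \<noteq> b) \<and> pirreducible K r \<longrightarrow>
        card (strict_intermediate_fields F K) = 12 \<and>
        complete_list_of_intermediate_fields F K
          [(adjoin F K {\<delta>}, 2, True),
           (adjoin F K {c}, 3, True),
           (adjoin F K {c \<otimes> (\<alpha> \<oplus> \<beta>)}, 3, False),
           (adjoin F K {c \<otimes> (\<alpha> \<otimes> \<zeta> \<oplus> \<beta> \<otimes> \<zeta> [^] (2::nat))}, 3, False),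
           (adjoin F K {c \<otimes> (\<alpha> \<otimes> \<zeta> [^] (2::nat) \<oplus> \<beta> \<otimes> \<zeta>)}, 3, False),
           (adjoin F K {\<delta>, c \<otimes> (\<alpha> \<oplus> \<beta>)}, 6, True),
           (adjoin F K {\<delta>, c}, 6, True),
           (adjoin F K {\<alpha>}, 6, False),
           (adjoin F K {\<beta>}, 6, False),
           (adjoin F K {\<alpha> \<oplus> \<beta>}, 9, False),
           (adjoin F K {\<alpha> \<otimes> \<zeta> \<oplus> \<beta> \<otimes> \<zeta> [^] (2::nat)}, 9, False),
           (adjoin F K {\<alpha> \<otimes> \<zeta> [^] (2::nat) \<oplus> \<beta> \<otimes> \<zeta>}, 9, False)])"
proof -
  interpret field F by fact
  interpret cubic_pair F K \<zeta> \<alpha> \<beta> \<delta> a b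
    using assms by (intro cubic_pairI) auto
  have f: "pirreducible K trinomial"
    using assms(9,10) by (simp add: trinomial_def)
  have r: "resolvent = r"
    using assms(13) by (simp add: resolvent_def)
  have c: "c = \<gamma>"
    using assms(17) by (simp add: \<gamma>_def)
  have sums: "root_sum T0 = \<alpha> \<oplus> \<beta>" "root_sum T1 = \<alpha> \<otimes> \<zeta> \<oplus> \<beta> \<otimes> \<zeta> [^] (2 :: nat)"
    "root_sum T2 = \<alpha> \<otimes> \<zeta> [^] (2 :: nat) \<oplus> \<beta> \<otimes> \<zeta>"
    by (simp_all add: root_sum_def zeta_pow_def)
  \<comment> \<open>Each hypothesis on the cubic roots of b is used for one of them, \<gamma>
    itself.\<close>
  have notin: "\<gamma> \<notin> K" if "\<forall>x\<in>K. x [^] (3 :: nat) \<noteq> b"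
    using that gamma_cube by blast
  have mem: "\<gamma> \<in> K" if "\<forall>x\<in>carrier F. x [^] (3 :: nat) = b \<longrightarrow> x \<in> K"
    using that gamma_cube gamma_closed by blast
  show ?thesis
    using intermediate_fields_A[OF notin _ f] intermediate_fields_B[OF mem _ f]
      intermediate_fields_C[OF notin _ f]
    unfolding r c sums by blast
qed

end
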